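(* Consider the $2$-dimensional Novikov--Poisson algebras $N_{01},\dots,N_{05}$, $N_{06}^{\gamma}$, $N_{07}^{\alpha,\beta}$, $N_{08}^{\alpha,\beta}$, $N_{09}^{\alpha,\beta}$, $N_{10}^{\alpha}$, $N_{11}^{\alpha}$, $N_{12}^{\alpha}$, $N_{13}^{\alpha}$, $N_{14}^{\alpha}$ (all parameters in $\mathbb C$) and the zero algebra $\mathbb C^8$ (both products zero), as defined in the context. Their orbits have the following dimensions: $4$ for $N_{03}$, $N_{07}^{\delta,\varepsilon}$, $N_{08}^{\delta,\varepsilon}$, $N_{10}^{\delta}$, $N_{12}^{\delta}$; $3$ for $N_{02}$, $N_{04}$, $N_{05}$, $N_{06}^{\beta}$ with $\beta\ne0$, $N_{09}^{\beta,\gamma}$, $N_{11}^{\beta}$, $N_{13}^{\beta}$; $2$ for $N_{01}$, $N_{06}^{0}$, $N_{14}^{\alpha}$; $0$ for $\mathbb C^8$. For two algebras $T,T'$ of this list one has $T\to T'$ if and only if $T\cong T'$ or $T'$ can be reached from $T$ by a chain of the following degenerations (valid for all parameter values subject to the indicated restrictions): $N_{03}\to N_{06}^{1}$; $N_{03}\to N_{04}$; $N_{07}^{\delta,\varepsilon}\to N_{11}^{\delta}$ and $N_{07}^{\delta,\varepsilon}\to N_{11}^{\varepsilon}$; $N_{07}^{\delta,\varepsilon}\to N_{01}$ if $\delta\neq\varepsilon$; $N_{07}^{\delta,\varepsilon}\to N_{14}^{\alpha}$ for every $\alpha$ if $\delta\ne\varepsilon$; $N_{07}^{\beta,\beta}\to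 N_{09}^{\beta,\beta}$; $N_{08}^{\delta,\varepsilon}\to N_{09}^{\delta,\varepsilon}$; $N_{08}^{\delta,\varepsilon}\to N_{01}$; $N_{08}^{\delta,\varepsilon}\to N_{14}^{\alpha}$ for every $\alpha$; $N_{10}^{\delta}\to N_{11}^{\delta}$; $N_{10}^{\delta}\to N_{04}$; $N_{10}^{\delta}\to N_{14}^{\alpha}$ if $\alpha\neq\delta$; $N_{12}^{0}\to N_{02}$; $N_{12}^{\delta}\to N_{06}^{\delta^{-1}}$ if $\delta\ne0$; $N_{12}^{\delta}\to N_{14}^{\alpha}$ for every $\alpha$; $N_{09}^{\beta,\gamma}\to N_{14}^{\gamma}$; $N_{11}^{\beta}\to N_{14}^{\beta}$; $N_{13}^{\beta}\to N_{14}^{\beta}$; $N_{13}^{\beta}\to N_{06}^{0}$; $N_{05}\to N_{06}^{0}$; $N_{05}\to N_{01}$; $N_{06}^{\beta}\to N_{01}$ if $\beta\neq0$; $N_{04}\to N_{01}$; $N_{02}\to N_{01}$; $N_{14}^{\alpha}\to\mathbb C^8$; $N_{06}^{0}\to\mathbb C^8$; $N_{01}\to\mathbb C^8$.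
   Context: A Novikov--Poisson algebra is a complex vector space with a commutative associative product $\cdot$ and a Novikov product $\circ$, i.e. a bilinear product with $(x\circ y)\circ z-x\circ(y\circ z)=(y\circ x)\circ z-y\circ(x\circ z)$ and $(x\circ y)\circ z=(x\circ z)\circ y$, such that $(x\cdot y)\circ z=x\cdot(y\circ z)$ and $(x\circ y)\cdot z-(y\circ x)\cdot z=x\circ(y\cdot z)-y\circ(x\cdot z)$. Fix a $2$-dimensional complex vector space $V$ with basis $e_1,e_2$. A $2$-dimensional such algebra is viewed as a pair $(\mu,\mu')\in \mathrm{Bil}(V\times V,V)^2\cong\mathbb C^{16}$ ($\mu$ is $\cdot$, $\mu'$ is $\circ$). $\mathrm{GL}(V)$ acts by $(g*(\mu,\mu'))(x,y)=(g\mu(g^{-1}x,g^{-1}y),\,g\mu'(g^{-1}x,g^{-1}y))$; $O(T)$ is the orbit of a structure representing $T$. We write $T\to T'$ ($T$ degenerates to $T'$) if a structure representing $T'$ lies in the Zariski closure $\overline{O(T)}$. The algebras are (unlisted products are zero, $\cdot$ is commutative): $N_{01}: e_1\circ e_1=e_2$; $N_{02}: e_2\circ e_1=-e_1$; $N_{03}: e_1\circ e_1=e_1,\ e_2\circ e_2=e_2$; $N_{04}: e_1\circ e_1=e_1$; $N_{05}: e_1\circ e_2=e_1,\ e_2\circ e_2=e_1+e_2$; $N_{06}^{\gamma}: e_1\circ e_2=e_1,\ e_2\circ e_1=\gamma e_1,\ e_2\circ e_2=e_2$; $N_{07}^{\alpha,\beta}: e_1\cdot e_1=e_1,\ e_2\cdot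 e_2=e_2,\ e_1\circ e_1=\alpha e_1,\ e_2\circ e_2=\beta e_2$; $N_{08}^{\alpha,\beta}: e_1\cdot e_1=e_1,\ e_1\cdot e_2=e_2,\ e_1\circ e_1=\alpha e_1+e_2,\ e_1\circ e_2=\beta e_2,\ e_2\circ e_1=\alpha e_2$; $N_{09}^{\alpha,\beta}: e_1\cdot e_1=e_1,\ e_1\cdot e_2=e_2,\ e_1\circ e_1=\alpha e_1,\ e_1\circ e_2=\beta e_2,\ e_2\circ e_1=\alpha e_2$; $N_{10}^{\alpha}: e_1\cdot e_1=e_1,\ e_1\circ e_1=\alpha e_1,\ e_2\circ e_2=e_2$; $N_{11}^{\alpha}: e_1\cdot e_1=e_1,\ e_1\circ e_1=\alpha e_1$; $N_{12}^{\alpha}: e_1\cdot e_1=e_2,\ e_1\circ e_1=\alpha e_1,\ e_1\circ e_2=e_2,\ e_2\circ e_1=\alpha e_2$; $N_{13}^{\alpha}: e_1\cdot e_1=e_2,\ e_1\circ e_1=e_1+\alpha e_2,\ e_2\circ e_1=e_2$; $N_{14}^{\alpha}: e_1\cdot e_1=e_2,\ e_1\circ e_1=\alpha e_2$. ($N_{01}$--$N_{06}$ have $\cdot=0$.) *)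

theory Defs
  imports "HOL-Analysis.Analysis" "HOL-Library.Extended_Nat"
begin

section \<open>Pairs of bilinear products on a two-dimensional complex vector space\<close>

type_synonym V = "complex^2"
type_synonym product = "V \<Rightarrow> V \<Rightarrow> V"

text \<open>The first component is the commutative associative product \<open>\<cdot>\<close>,
  the second one the Novikov product \<open>\<circ>\<close>.\<close>

type_synonym bilpair = "product \<times> product"

definition bilinear_product :: "product \<Rightarrow> bool" where
  "bilinear_product m \<longleftrightarrow>
     (\<forall>x. Vector_Spaces.linear (*s) (*s) (\<lambda>y. m x y)) \<and>
     (\<forall>y. Vector_Spaces.linear (*s) (*s) (\<lambda>x. m x y))"

definition Bil2 :: "bilpair set" where
  "Bil2 = {(m, n). bilinear_product m \<and> bilinear_product n}"

definition novikov_poisson :: "bilpair \<Rightarrow> bool" where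
  "novikov_poisson = (\<lambda>(m, n).
     bilinear_product m \<and> bilinear_product n \<and>
     (\<forall>x y. m x y = m y x) \<and>
     (\<forall>x y z. m (m x y) z = m x (m y z)) \<and>
     (\<forall>x y z. n (n x y) z - n x (n y z) = n (n y x) z - n y (n x z)) \<and>
     (\<forall>x y z. n (n x y) z = n (n x z) y) \<and>
     (\<forall>x y z. n (m x y) z = m x (n y z)) \<and>
     (\<forall>x y z. m (n x y) z - m (n y x) z = n x (m y z) - n y (m x z)))"

definition isomorphic :: "bilpair \<Rightarrow> bilpair \<Rightarrow> bool" where
  "isomorphic p q \<longleftrightarrow> (\<exists>g. Vector_Spaces.linear (*s) (*s) g \<and> bij g \<and>
     (\<forall>x y. g (fst p x y) = fst q (g x) (g y)) \<and>
     (\<forall>x y. g (snd p x y) = snd q (g x) (g y)))"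

definition act :: "complex^2^2 \<Rightarrow> bilpair \<Rightarrow> bilpair" where
  "act A = (\<lambda>(m, n).
     (\<lambda>x y. A *v m (matrix_inv A *v x) (matrix_inv A *v y),
      \<lambda>x y. A *v n (matrix_inv A *v x) (matrix_inv A *v y)))"

definition orbit :: "bilpair \<Rightarrow> bilpair set" where
  "orbit p = {act A p | A. invertible A}"


section \<open>The Zariski topology on the 16-dimensional space of pairs\<close>

text \<open>The coordinates are the structure constants in the standard basis.\<close>

inductive polyfun :: "(bilpair \<Rightarrow> complex) \<Rightarrow> bool" where
  const: "polyfun (\<lambda>p. c)"
| coord_fst: "polyfun (\<lambda>p. fst p (axis i 1) (axis j 1) $ k)"
| coord_snd: "polyfun (\<lambda>p. snd p (axis i 1) (axis j 1) $ k)"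
| add: "polyfun f \<Longrightarrow> polyfun g \<Longrightarrow> polyfun (\<lambda>p. f p + g p)"
| mult: "polyfun f \<Longrightarrow> polyfun g \<Longrightarrow> polyfun (\<lambda>p. f p * g p)"

definition algebraic_set :: "bilpair set \<Rightarrow> bool" where
  "algebraic_set Z \<longleftrightarrow>
     (\<exists>F. (\<forall>f\<in>F. polyfun f) \<and> Z = {p \<in> Bil2. \<forall>f\<in>F. f p = 0})"

definition zariski :: "bilpair topology" where
  "zariski = topology (\<lambda>U. U \<subseteq> Bil2 \<and> algebraic_set (Bil2 - U))"

text \<open>The following lemmas show that the predicate used in the definition of \<open>zariski\<close> is a
  topology, so that its closed sets are exactly the algebraic sets.\<close>

lemma algebraic_set_Un:
  assumes "algebraic_set Y" "algebraic_set Z"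
  shows "algebraic_set (Y \<union> Z)"
proof -
  obtain F where F: "\<forall>f\<in>F. polyfun f" "Y = {p \<in> Bil2. \<forall>f\<in>F. f p = 0}"
    using assms(1) unfolding algebraic_set_def by blast
  obtain G where G: "\<forall>f\<in>G. polyfun f" "Z = {p \<in> Bil2. \<forall>f\<in>G. f p = 0}"
    using assms(2) unfolding algebraic_set_def by blast
  define H where "H = (\<lambda>(f, g) p. f p * g p) ` (F \<times> G)"
  have 1: "\<forall>h\<in>H. polyfun h"
    using F(1) G(1) by (simp add: H_def polyfun.mult)
  have "(\<forall>h\<in>H. h p = 0) \<longleftrightarrow> (\<forall>f\<in>F. f p = 0) \<or> (\<forall>g\<in>G. g p = 0)" for p
    unfolding H_def by (simp add: split_paired_all)
  then have "Y \<union> Z = {p \<in> Bil2. \<forall>h\<in>H. h p = 0}"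
    unfolding F(2) G(2) by blast
  with 1 show ?thesis
    unfolding algebraic_set_def by (intro exI[of _ H] conjI)
qed

lemma algebraic_set_Inter:
  assumes "\<And>Z. Z \<in> \<Z> \<Longrightarrow> algebraic_set Z"
  shows "algebraic_set (Bil2 \<inter> \<Inter>\<Z>)"
proof -
  define F where "F = {f. polyfun f \<and> (\<exists>Z\<in>\<Z>. \<forall>p\<in>Z. f p = 0)}"
  have "p \<in> Z" if p: "p \<in> Bil2" "\<forall>f\<in>F. f p = 0" and Z: "Z \<in> \<Z>" for p Z
  proof -
    obtain G where G: "\<forall>f\<in>G. polyfun f" "Z = {p \<in> Bil2. \<forall>f\<in>G. f p = 0}"
      using assms[OF Z] unfolding algebraic_set_def by blast
    have "\<forall>p\<in>Z. f p = 0" if "f \<in> G" for f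
      using that by (simp add: G(2))
    then have "G \<subseteq> F"
      using G(1) Z by (auto simp: F_def)
    then show ?thesis
      using p by (auto simp: G(2))
  qed
  moreover have "f p = 0" if "f \<in> F" "p \<in> \<Inter>\<Z>" for f p
    using that by (auto simp: F_def)
  ultimately have "Bil2 \<inter> \<Inter>\<Z> = {p \<in> Bil2. \<forall>f\<in>F. f p = 0}"
    by blast
  then show ?thesis
    unfolding algebraic_set_def by (intro exI[of _ F]) (simp add: F_def)
qed

lemma istopology_zariski: "istopology (\<lambda>U. U \<subseteq> Bil2 \<and> algebraic_set (Bil2 - U))"
  unfolding istopology_def
proof (intro conjI allI impI)
  fix U W
  assume U: "U \<subseteq> Bil2 \<and> algebraic_set (Bil2 - U)" and W: "W \<subseteq> Bil2 \<and> algebraic_set (Bil2 - W)"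
  then show "U \<inter> W \<subseteq> Bil2" by blast
  have "Bil2 - U \<inter> W = (Bil2 - U) \<union> (Bil2 - W)" by blast
  then show "algebraic_set (Bil2 - U \<inter> W)"
    using U W algebraic_set_Un by presburger
next
  fix \<U>
  assume U: "\<forall>U\<in>\<U>. U \<subseteq> Bil2 \<and> algebraic_set (Bil2 - U)"
  then show "\<Union>\<U> \<subseteq> Bil2" by blast
  have "Bil2 - \<Union>\<U> = Bil2 \<inter> \<Inter>((\<lambda>U. Bil2 - U) ` \<U>)" by blast
  moreover have "algebraic_set (Bil2 \<inter> \<Inter>((\<lambda>U. Bil2 - U) ` \<U>))"
    by (rule algebraic_set_Inter) (use U in auto)
  ultimately show "algebraic_set (Bil2 - \<Union>\<U>)"
    by (simp only:)
qed

lemma openin_zariski: "openin zariski U \<longleftrightarrow> U \<subseteq> Bil2 \<and> algebraic_set (Bil2 - U)"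
  unfolding zariski_def by (simp only: topology_inverse'[OF istopology_zariski])

lemma topspace_zariski: "topspace zariski = Bil2"
proof -
  have "algebraic_set (Bil2 - Bil2)"
    unfolding algebraic_set_def
    by (rule exI[of _ "{\<lambda>p. 1}"]) (auto intro: polyfun.const)
  then show ?thesis
    unfolding topspace_def openin_zariski by blast
qed

lemma closedin_zariski: "closedin zariski Z \<longleftrightarrow> algebraic_set Z"
proof -
  have "algebraic_set Z \<Longrightarrow> Z \<subseteq> Bil2"
    unfolding algebraic_set_def by blast
  then show ?thesis
    unfolding closedin_def topspace_zariski openin_zariski
    by (metis Diff_subset double_diff subset_refl)
qed


section \<open>Degeneration and orbit dimension\<close>

text \<open>The structures representing the isomorphism class of \<open>q\<close> are the elements of its orbit.\<close>

definition degenerates :: "bilpair \<Rightarrow> bilpair \<Rightarrow> bool" where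
  "degenerates p q \<longleftrightarrow> (\<exists>r \<in> orbit q. r \<in> zariski closure_of orbit p)"

definition irreducible_closed :: "'a topology \<Rightarrow> 'a set \<Rightarrow> bool" where
  "irreducible_closed X Z \<longleftrightarrow> closedin X Z \<and> Z \<noteq> {} \<and>
     (\<forall>A B. closedin X A \<longrightarrow> closedin X B \<longrightarrow> Z = A \<union> B \<longrightarrow> Z = A \<or> Z = B)"

text \<open>The Krull dimension of a nonempty space: the supremum of the lengths \<open>n\<close> of the strict
  chains \<open>Z\<^sub>0 \<subset> \<dots> \<subset> Z\<^sub>n\<close> of irreducible closed subsets.  (On the empty space the value is 0.)\<close>

definition krull_dim :: "'a topology \<Rightarrow> enat" where
  "krull_dim X = Sup (enat ` {n. \<exists>Z :: nat \<Rightarrow> 'a set.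
     (\<forall>i\<le>n. irreducible_closed X (Z i)) \<and> (\<forall>i<n. Z i \<subset> Z (Suc i))})"

definition orbit_dim :: "bilpair \<Rightarrow> enat" where
  "orbit_dim p = krull_dim (subtopology zariski (orbit p))"


section \<open>The list of algebras\<close>

datatype algebra =
    N01 | N02 | N03 | N04 | N05 | N06 complex
  | N07 complex complex | N08 complex complex | N09 complex complex
  | N10 complex | N11 complex | N12 complex | N13 complex | N14 complex
  | NZero

definition e1 :: V where "e1 = axis 1 1"
definition e2 :: V where "e2 = axis 2 1"

text \<open>The bilinear product whose values on \<open>(e1,e1)\<close>, \<open>(e1,e2)\<close>, \<open>(e2,e1)\<close>, \<open>(e2,e2)\<close> are
  \<open>a\<close>, \<open>b\<close>, \<open>c\<close>, \<open>d\<close>.\<close>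

definition table :: "V \<Rightarrow> V \<Rightarrow> V \<Rightarrow> V \<Rightarrow> product" where
  "table a b c d = (\<lambda>x y. (x$1 * y$1) *s a + (x$1 * y$2) *s b + (x$2 * y$1) *s c + (x$2 * y$2) *s d)"

fun structure_of :: "algebra \<Rightarrow> bilpair" where
  "structure_of N01 = (table 0 0 0 0, table e2 0 0 0)"
| "structure_of N02 = (table 0 0 0 0, table 0 0 (- e1) 0)"
| "structure_of N03 = (table 0 0 0 0, table e1 0 0 e2)"
| "structure_of N04 = (table 0 0 0 0, table e1 0 0 0)"
| "structure_of N05 = (table 0 0 0 0, table 0 e1 0 (e1 + e2))"
| "structure_of (N06 \<gamma>) = (table 0 0 0 0, table 0 e1 (\<gamma> *s e1) e2)"
| "structure_of (N07 \<alpha> \<beta>) = (table e1 0 0 e2, table (\<alpha> *s e1) 0 0 (\<beta> *s e2))"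
| "structure_of (N08 \<alpha> \<beta>) = (table e1 e2 e2 0, table (\<alpha> *s e1 + e2) (\<beta> *s e2) (\<alpha> *s e2) 0)"
| "structure_of (N09 \<alpha> \<beta>) = (table e1 e2 e2 0, table (\<alpha> *s e1) (\<beta> *s e2) (\<alpha> *s e2) 0)"
| "structure_of (N10 \<alpha>) = (table e1 0 0 0, table (\<alpha> *s e1) 0 0 e2)"
| "structure_of (N11 \<alpha>) = (table e1 0 0 0, table (\<alpha> *s e1) 0 0 0)"
| "structure_of (N12 \<alpha>) = (table e2 0 0 0, table (\<alpha> *s e1) e2 (\<alpha> *s e2) 0)"
| "structure_of (N13 \<alpha>) = (table e2 0 0 0, table (e1 + \<alpha> *s e2) 0 e2 0)"
| "structure_of (N14 \<alpha>) = (table e2 0 0 0, table (\<alpha> *s e2) 0 0 0)"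
| "structure_of NZero = (table 0 0 0 0, table 0 0 0 0)"

lemma table_basis:
  "table a b c d e1 e1 = a" "table a b c d e1 e2 = b"
  "table a b c d e2 e1 = c" "table a b c d e2 e2 = d"
  by (simp_all add: table_def e1_def e2_def axis_def)

lemma bilinear_product_table: "bilinear_product (table a b c d)"
  unfolding bilinear_product_def table_def Vector_Spaces.linear_iff
  by (auto simp: vec_eq_iff algebra_simps vec.vector_space_axioms)

lemma table_nth:
  "table a b c d x y $ i = x$1 * y$1 * a$i + x$1 * y$2 * b$i + x$2 * y$1 * c$i + x$2 * y$2 * d$i"
  by (simp add: table_def)

lemma e1_nth: "e1 $ 1 = 1" "e1 $ 2 = 0" and e2_nth: "e2 $ 1 = 0" "e2 $ 2 = 1"
  by (simp_all add: e1_def e2_def axis_def)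

lemma novikov_poisson_structure_of: "novikov_poisson (structure_of T)"
  by (cases T; simp only: novikov_poisson_def structure_of.simps case_prod_conv;
      intro conjI allI bilinear_product_table;
      simp add: vec_eq_iff forall_2 table_nth e1_nth e2_nth; (simp add: algebra_simps)?)

text \<open>The generating degenerations; chains of them are given by the transitive closure.\<close>

inductive edge :: "algebra \<Rightarrow> algebra \<Rightarrow> bool" where
  "edge N03 (N06 1)"
| "edge N03 N04"
| "edge (N07 \<delta> \<epsilon>) (N11 \<delta>)"
| "edge (N07 \<delta> \<epsilon>) (N11 \<epsilon>)"
| "\<delta> \<noteq> \<epsilon> \<Longrightarrow> edge (N07 \<delta> \<epsilon>) N01"
| "\<delta> \<noteq> \<epsilon> \<Longrightarrow> edge (N07 \<delta> \<epsilon>) (N14 \<alpha>)"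
| "edge (N07 \<beta> \<beta>) (N09 \<beta> \<beta>)"
| "edge (N08 \<delta> \<epsilon>) (N09 \<delta> \<epsilon>)"
| "edge (N08 \<delta> \<epsilon>) N01"
| "edge (N08 \<delta> \<epsilon>) (N14 \<alpha>)"
| "edge (N10 \<delta>) (N11 \<delta>)"
| "edge (N10 \<delta>) N04"
| "\<alpha> \<noteq> \<delta> \<Longrightarrow> edge (N10 \<delta>) (N14 \<alpha>)"
| "edge (N12 0) N02"
| "\<delta> \<noteq> 0 \<Longrightarrow> edge (N12 \<delta>) (N06 (inverse \<delta>))"
| "edge (N12 \<delta>) (N14 \<alpha>)"
| "edge (N09 \<beta> \<gamma>) (N14 \<gamma>)"
| "edge (N11 \<beta>) (N14 \<beta>)"
| "edge (N13 \<beta>) (N14 \<beta>)"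
| "edge (N13 \<beta>) (N06 0)"
| "edge N05 (N06 0)"
| "edge N05 N01"
| "\<beta> \<noteq> 0 \<Longrightarrow> edge (N06 \<beta>) N01"
| "edge N04 N01"
| "edge N02 N01"
| "edge (N14 \<alpha>) NZero"
| "edge (N06 0) NZero"
| "edge N01 NZero"

end

theory Submission
  imports Defs "HOL-Library.Function_Algebras"
begin

text \<open>A structure degenerates to every limit of its structure constants along a curve of bases, which gives
  the listed degenerations.  The others are excluded by identities between the two products and the traces of
  their multiplication operators: such identities are invariant under the linear group and closed.

  For the dimensions, a chain of \<open>n\<close> strict inclusions of irreducible closed sets provides \<open>n\<close> separating
  polynomial functions, and their monomials are linearly independent on the largest set of the chain.  If the translates
  by a family of matrices with \<open>d\<close> parameters are dense in the orbit, the monomials of degree at most \<open>K\<close> in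
  each function become, up to a power of the determinant, polynomials in \<open>d\<close> variables of degree \<open>O(K)\<close>;
  comparing \<open>(K + 1)^n\<close> with \<open>O(K^d)\<close> gives \<open>n \<le> d\<close>.  Conversely, setting the entries of the acting matrix free
  one after the other yields a chain, because the translates by an affine space of matrices are
  irreducible: any two of them lie on a rational curve.\<close>

text \<open>An identity satisfied by the source has the parameters of the source as coefficients.
  Evaluated on the basis of a possible target, it becomes a system of equations for the target's
  parameters, so each exclusion ends in a small computation. The delicate source is
  \<open>N07\<close> with distinct parameters: it degenerates to \<open>N14\<close> for every
  parameter but must be kept away from the local algebras \<open>N08\<close> and \<open>N09\<close>,
  and for this a relation quadratic in the traces is used.

  The Krull dimension is that of the orbit itself, so both bounds are argued with chains inside it.
  The stabilizer serves only to shorten the parametrization: column operations by its elements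
  normalize some entries of the acting matrix, and \<open>d\<close> is the number of entries left.
  The obstacle is that the action involves the inverse matrix and is not polynomial. The adjugate
  replaces the inverse at the price of powers of the determinant, which must be the same for all
  monomials in a linear relation and small enough for the count of monomials to succeed.\<close>

section \<open>Structure constants of bilinear products\<close>

lemma vec2_eq_iff: "(x :: V) = y \<longleftrightarrow> x $ 1 = y $ 1 \<and> x $ 2 = y $ 2"
  by (simp add: vec_eq_iff forall_2)

lemma vector2_nth: "(vector [x, y] :: V) $ 1 = x" "(vector [x, y] :: V) $ 2 = y"
  by (rule vector_2)+

lemma mat_vec_nth: "((A :: complex^2^2) *v x) $ i = A $ i $ 1 * x $ 1 + A $ i $ 2 * x $ 2"
  by (simp add: matrix_vector_mult_def sum_2)

lemma table_eq_table_iff: "table a b c d = table a' b' c' d' \<longleftrightarrow> a = a' \<and> b = b' \<and> c = c' \<and> d = d'"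
  by (metis table_basis)

lemma bilinear_product_eq_table:
  assumes "bilinear_product m"
  shows "m = table (m e1 e1) (m e1 e2) (m e2 e1) (m e2 e2)"
proof (intro ext)
  fix x y :: V
  have l: "m (a *s u + b *s v) w = a *s m u w + b *s m v w"
    and r: "m w (a *s u + b *s v) = a *s m w u + b *s m w v" for a b u v w
    using assms unfolding bilinear_product_def Vector_Spaces.linear_iff by simp_all
  have x: "x = x$1 *s e1 + x$2 *s e2" for x :: V
    by (simp add: vec2_eq_iff e1_nth e2_nth)
  have "m x y = m (x$1 *s e1 + x$2 *s e2) (y$1 *s e1 + y$2 *s e2)"
    using x by metis
  then show "m x y = table (m e1 e1) (m e1 e2) (m e2 e1) (m e2 e2) x y"
    by (simp add: l r table_def vec2_eq_iff algebra_simps)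
qed

lemma Bil2_cases:
  assumes "p \<in> Bil2"
  obtains a b c d a' b' c' d' where "p = (table a b c d, table a' b' c' d')"
  using assms bilinear_product_eq_table unfolding Bil2_def by blast

lemma table_pair_in_Bil2 [simp]: "(table a b c d, table a' b' c' d') \<in> Bil2"
  by (simp add: Bil2_def bilinear_product_table)

lemma structure_of_in_Bil2 [simp]: "structure_of T \<in> Bil2"
  by (cases T) simp_all

lemma Bil2_expand:
  assumes "p \<in> Bil2"
  shows "fst p x y = table (fst p e1 e1) (fst p e1 e2) (fst p e2 e1) (fst p e2 e2) x y"
    "snd p x y = table (snd p e1 e1) (snd p e1 e2) (snd p e2 e1) (snd p e2 e2) x y"
  using assms bilinear_product_eq_table[of "fst p"] bilinear_product_eq_table[of "snd p"]
  unfolding Bil2_def by auto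

lemma Bil2_linear:
  assumes "p \<in> Bil2"
  shows "fst p (x + y) z = fst p x z + fst p y z" "fst p z (x + y) = fst p z x + fst p z y"
    "fst p (c *s x) z = c *s fst p x z" "fst p z (c *s x) = c *s fst p z x"
    "snd p (x + y) z = snd p x z + snd p y z" "snd p z (x + y) = snd p z x + snd p z y"
    "snd p (c *s x) z = c *s snd p x z" "snd p z (c *s x) = c *s snd p z x"
  using assms by (auto elim!: Bil2_cases simp: vec2_eq_iff table_nth algebra_simps)

lemma bilinear_product_conj:
  assumes "bilinear_product m"
  shows "bilinear_product (\<lambda>x y. (A :: complex^2^2) *v m (B *v x) (B *v y))"
proof -
  obtain a b c d where m: "m = table a b c d"
    using bilinear_product_eq_table[OF assms] by blast
  show ?thesis
    unfolding bilinear_product_def Vector_Spaces.linear_iff m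
    by (auto simp: vec2_eq_iff mat_vec_nth table_nth algebra_simps vec.vector_space_axioms)
qed

section \<open>The action of the general linear group\<close>

lemma act_in_Bil2 [simp]: "p \<in> Bil2 \<Longrightarrow> act A p \<in> Bil2"
  by (auto simp: Bil2_def act_def bilinear_product_conj)

lemma fst_act: "fst (act A p) x y = A *v fst p (matrix_inv A *v x) (matrix_inv A *v y)"
  and snd_act: "snd (act A p) x y = A *v snd p (matrix_inv A *v x) (matrix_inv A *v y)"
  by (simp_all add: act_def split_beta)

lemma matrix_inv_left_right:
  assumes "invertible (A :: complex^2^2)"
  shows matrix_inv_left: "matrix_inv A ** A = mat 1" and matrix_inv_right: "A ** matrix_inv A = mat 1"
  using someI_ex[OF assms[unfolded invertible_def]] unfolding matrix_inv_def by simp_all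

lemma invertible_mat_1: "invertible (mat 1 :: complex^2^2)"
  unfolding invertible_def by (rule exI[of _ "mat 1"]) simp

lemma matrix_inv_cancel:
  assumes "invertible (A :: complex^2^2)"
  shows "matrix_inv A *v (A *v x) = x" "A *v (matrix_inv A *v x) = x"
  using assms by (simp_all add: matrix_vector_mul_assoc matrix_inv_left matrix_inv_right)

lemma act_eqI:
  assumes "invertible A"
    and "\<And>x y. fst q (A *v x) (A *v y) = A *v fst p x y"
    and "\<And>x y. snd q (A *v x) (A *v y) = A *v snd p x y"
  shows "act A p = q"
proof (rule prod_eqI; intro ext)
  fix x y
  show "fst (act A p) x y = fst q x y" "snd (act A p) x y = snd q x y"
    using assms(2,3)[of "matrix_inv A *v x" "matrix_inv A *v y"] assms(1)
    by (simp_all add: fst_act snd_act matrix_inv_cancel)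
qed

lemma act_mult:
  assumes "invertible A" "invertible B"
  shows "act A (act B p) = act (A ** B) p"
  by (rule act_eqI[symmetric])
    (simp_all add: assms invertible_mult fst_act snd_act matrix_inv_cancel matrix_vector_mul_assoc[symmetric])

lemma act_mat_1 [simp]: "act (mat 1) p = p"
  by (rule act_eqI) (simp_all add: invertible_mat_1)

lemma invertible_matrix_inv: "invertible (A :: complex^2^2) \<Longrightarrow> invertible (matrix_inv A)"
  by (metis invertible_def matrix_inv_left matrix_inv_right)

lemma act_matrix_inv:
  assumes "invertible A"
  shows "act (matrix_inv A) (act A p) = p" "act A (act (matrix_inv A) p) = p"
  using assms by (simp_all add: act_mult invertible_matrix_inv matrix_inv_left matrix_inv_right)

lemma orbitI: "invertible A \<Longrightarrow> act A p \<in> orbit p"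
  by (auto simp: orbit_def)

lemma orbitE:
  assumes "q \<in> orbit p"
  obtains A where "invertible A" "q = act A p"
  using assms unfolding orbit_def by blast

lemma orbit_refl: "p \<in> orbit p"
  using orbitI[OF invertible_mat_1] by simp

lemma orbit_sym:
  assumes "q \<in> orbit p"
  shows "p \<in> orbit q"
  using assms
proof (rule orbitE)
  fix A assume A: "invertible A" "q = act A p"
  show ?thesis
    using orbitI[OF invertible_matrix_inv[OF A(1)], of q] by (simp add: A(2) act_matrix_inv[OF A(1)])
qed

lemma orbit_act:
  assumes "q \<in> orbit p" "invertible A"
  shows "act A q \<in> orbit p"
  using assms(1)
proof (rule orbitE)
  fix B assume B: "invertible B" "q = act B p"
  show ?thesis
    using orbitI[OF invertible_mult[OF assms(2) B(1)], of p] by (simp add: B(2) act_mult[OF assms(2) B(1)])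
qed

lemma orbit_subset_Bil2: "p \<in> Bil2 \<Longrightarrow> orbit p \<subseteq> Bil2"
  by (auto simp: orbit_def)

lemma isomorphic_refl: "isomorphic p p"
  unfolding isomorphic_def
  by (rule exI[of _ "\<lambda>x. x"]) (simp add: vec.linear_id[unfolded id_def] bij_id[unfolded id_def])

lemma isomorphic_imp_orbit:
  assumes "isomorphic p q"
  shows "q \<in> orbit p"
proof -
  obtain g where g: "Vector_Spaces.linear (*s) (*s) g" "bij g"
    "\<And>x y. g (fst p x y) = fst q (g x) (g y)" "\<And>x y. g (snd p x y) = snd q (g x) (g y)"
    using assms unfolding isomorphic_def by blast
  define A where "A = matrix g"
  have A: "A *v x = g x" for x
    using matrix_works[OF g(1)] by (simp add: A_def)
  have "invertible A"
    using g(2) by (simp add: invertible_eq_bij A[THEN ext])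
  then have "act A p = q"
    by (rule act_eqI) (simp_all add: A g(3,4))
  then show ?thesis
    using \<open>invertible A\<close> orbitI by metis
qed

section \<open>Regular functions\<close>

text \<open>A \<open>bilpair\<close> need not be bilinear, so evaluation at a general vector is not
  a \<open>polyfun\<close>. On \<open>Bil2\<close> it agrees with a polynomial in the structure
  constants, and closures in \<open>zariski\<close> see nothing else.\<close>

definition regular :: "(bilpair \<Rightarrow> complex) \<Rightarrow> bool" where
  "regular f \<longleftrightarrow> (\<exists>g. polyfun g \<and> (\<forall>p\<in>Bil2. f p = g p))"

lemma regular_polyfun: "polyfun f \<Longrightarrow> regular f"
  unfolding regular_def by blast

lemma regular_const: "regular (\<lambda>p. c)"
  by (rule regular_polyfun) (rule polyfun.const)

lemma regular_add: "regular f \<Longrightarrow> regular g \<Longrightarrow> regular (\<lambda>p. f p + g p)"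
  and regular_mult: "regular f \<Longrightarrow> regular g \<Longrightarrow> regular (\<lambda>p. f p * g p)"
  unfolding regular_def by (elim exE, rename_tac f' g', rule_tac x = "\<lambda>p. f' p + g' p" in exI, simp add: polyfun.add,
    elim exE, rename_tac f' g', rule_tac x = "\<lambda>p. f' p * g' p" in exI, simp add: polyfun.mult)

lemma regular_minus: "regular f \<Longrightarrow> regular (\<lambda>p. - f p)"
  using regular_mult[OF regular_const[of "-1"], of f] by simp

lemma regular_diff: "regular f \<Longrightarrow> regular g \<Longrightarrow> regular (\<lambda>p. f p - g p)"
  using regular_add[OF _ regular_minus, of f g] by simp

lemma regular_cong: "(\<And>p. p \<in> Bil2 \<Longrightarrow> f p = g p) \<Longrightarrow> regular f \<longleftrightarrow> regular g"
  unfolding regular_def by simp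

text \<open>The arguments may depend on \<open>p\<close>, so that iterated products and traces of
  products are covered as well.\<close>

lemma regular_fst:
  assumes "\<And>i. regular (\<lambda>p. u p $ i)" "\<And>i. regular (\<lambda>p. v p $ i)"
  shows "regular (\<lambda>p. fst p (u p) (v p) $ k)"
proof -
  have "regular (\<lambda>p. table (fst p e1 e1) (fst p e1 e2) (fst p e2 e1) (fst p e2 e2) (u p) (v p) $ k)"
    unfolding table_nth e1_def e2_def
    by (intro regular_add regular_mult assms regular_polyfun[OF polyfun.coord_fst])
  then show ?thesis
    by (subst regular_cong[OF arg_cong[OF Bil2_expand(1)]])
qed

lemma regular_snd:
  assumes "\<And>i. regular (\<lambda>p. u p $ i)" "\<And>i. regular (\<lambda>p. v p $ i)"
  shows "regular (\<lambda>p. snd p (u p) (v p) $ k)"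
proof -
  have "regular (\<lambda>p. table (snd p e1 e1) (snd p e1 e2) (snd p e2 e1) (snd p e2 e2) (u p) (v p) $ k)"
    unfolding table_nth e1_def e2_def
    by (intro regular_add regular_mult assms regular_polyfun[OF polyfun.coord_snd])
  then show ?thesis
    by (subst regular_cong[OF arg_cong[OF Bil2_expand(2)]])
qed

lemmas regular_intros = regular_const regular_add regular_mult regular_minus regular_diff regular_fst regular_snd

lemma regular_act:
  assumes "regular f"
  shows "regular (\<lambda>p. f (act A p))"
proof -
  obtain g where g: "polyfun g" "\<And>p. p \<in> Bil2 \<Longrightarrow> f p = g p"
    using assms unfolding regular_def by blast
  have "regular (\<lambda>p. g (act A p))"
    using g(1)
    by induction (simp_all add: fst_act snd_act mat_vec_nth, (intro regular_intros; assumption?)+)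
  then show ?thesis
    by (subst regular_cong[of _ "\<lambda>p. g (act A p)"]) (simp_all add: g(2))
qed

lemma closure_of_zariski:
  assumes "S \<subseteq> Bil2"
  shows "zariski closure_of S = {p \<in> Bil2. \<forall>f. regular f \<longrightarrow> (\<forall>q\<in>S. f q = 0) \<longrightarrow> f p = 0}" (is "_ = ?C")
proof
  have "f p = 0" if f: "regular f" "\<forall>q\<in>S. f q = 0" and p: "p \<in> Bil2" "\<forall>g. polyfun g \<longrightarrow> (\<forall>q\<in>S. g q = 0) \<longrightarrow> g p = 0" for f p
  proof -
    obtain g where "polyfun g" "\<And>p. p \<in> Bil2 \<Longrightarrow> f p = g p"
      using f(1) unfolding regular_def by blast
    moreover have "g q = 0" if "q \<in> S" for q
      using calculation(2)[of q] f(2) that assms by auto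
    ultimately show ?thesis
      using p by simp
  qed
  then have "?C = {p \<in> Bil2. \<forall>f \<in> {f. polyfun f \<and> (\<forall>q\<in>S. f q = 0)}. f p = 0}"
    using regular_polyfun by blast
  then have "closedin zariski ?C"
    unfolding closedin_zariski algebraic_set_def
    by (intro exI[of _ "{f. polyfun f \<and> (\<forall>q\<in>S. f q = 0)}"]) simp
  moreover have "S \<subseteq> ?C"
    using assms by auto
  ultimately show "zariski closure_of S \<subseteq> ?C"
    by (rule closure_of_minimal[rotated])
  show "?C \<subseteq> zariski closure_of S"
  proof
    fix p assume p: "p \<in> ?C"
    have "closedin zariski (zariski closure_of S)"
      by simp
    then obtain F where F: "\<forall>f\<in>F. polyfun f" "zariski closure_of S = {p \<in> Bil2. \<forall>f\<in>F. f p = 0}"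
      unfolding closedin_zariski algebraic_set_def by blast
    have "S \<subseteq> zariski closure_of S"
      by (rule closure_of_subset) (simp add: assms topspace_zariski)
    then have "f q = 0" if "f \<in> F" "q \<in> S" for f q
      using that F(2) by auto
    then show "p \<in> zariski closure_of S"
      using p F regular_polyfun by auto
  qed
qed

text \<open>If \<open>f\<close> vanishes on the orbit, so does its composition with
  \<open>act A\<close>; hence the closure is stable under the group.\<close>

lemma closure_orbit_act:
  assumes "p \<in> Bil2" "invertible A" "q \<in> zariski closure_of orbit p"
  shows "act A q \<in> zariski closure_of orbit p"
proof -
  note cl = closure_of_zariski[OF orbit_subset_Bil2[OF assms(1)]]
  have "f (act A q) = 0" if "regular f" "\<forall>r\<in>orbit p. f r = 0" for f
  proof -
    have "\<forall>r\<in>orbit p. f (act A r) = 0"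
      using that(2) orbit_act assms(2) by blast
    then show ?thesis
      using assms(3) regular_act[OF that(1), of A] unfolding cl by auto
  qed
  then show ?thesis
    using assms(3) unfolding cl by auto
qed

text \<open>By stability of the closure, one representative of the target lies in it as soon as any
  other does.\<close>

lemma degenerates_iff:
  assumes "p \<in> Bil2"
  shows "degenerates p q \<longleftrightarrow> q \<in> zariski closure_of orbit p"
proof
  assume "degenerates p q"
  then obtain r where r: "r \<in> orbit q" "r \<in> zariski closure_of orbit p"
    unfolding degenerates_def by (elim bexE)
  show "q \<in> zariski closure_of orbit p"
    using orbit_sym[OF r(1)]
  proof (rule orbitE)
    fix A assume "invertible A" "q = act A r"
    then show ?thesis
      using closure_orbit_act[OF assms _ r(2)] by simp
  qed
next
  assume "q \<in> zariski closure_of orbit p"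
  then show "degenerates p q"
    unfolding degenerates_def using orbit_refl by (rule bexI)
qed

lemma degenerates_iff_regular:
  assumes "p \<in> Bil2" "q \<in> Bil2"
  shows "degenerates p q \<longleftrightarrow>
    (\<forall>f. regular f \<longrightarrow> (\<forall>A. invertible A \<longrightarrow> f (act A p) = 0) \<longrightarrow> f q = 0)"
proof -
  have "(\<forall>r\<in>orbit p. f r = 0) \<longleftrightarrow> (\<forall>A. invertible A \<longrightarrow> f (act A p) = 0)" for f :: "bilpair \<Rightarrow> complex"
    using orbitI[of _ p] by (auto elim!: orbitE)
  then show ?thesis
    by (simp add: degenerates_iff[OF assms(1)] closure_of_zariski[OF orbit_subset_Bil2[OF assms(1)]] assms(2))
qed

lemma degenerates_trans:
  assumes "p \<in> Bil2" "q \<in> Bil2" "degenerates p q" "degenerates q r"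
  shows "degenerates p r"
proof -
  have "orbit q \<subseteq> zariski closure_of orbit p"
    using closure_orbit_act[OF assms(1), of _ q] assms(3) unfolding degenerates_iff[OF assms(1)]
    by (auto elim!: orbitE)
  then have "zariski closure_of orbit q \<subseteq> zariski closure_of orbit p"
    by (simp add: closure_of_minimal)
  then show ?thesis
    using assms(4) unfolding degenerates_iff[OF assms(1)] degenerates_iff[OF assms(2)] by (rule subsetD)
qed

lemma isomorphic_imp_degenerates:
  assumes "p \<in> Bil2" "isomorphic p q"
  shows "degenerates p q"
  using isomorphic_imp_orbit[OF assms(2)] closure_of_subset[of "orbit p" zariski] orbit_subset_Bil2[OF assms(1)]
  unfolding degenerates_iff[OF assms(1)] topspace_zariski by blast

section \<open>Degeneration along a curve of bases\<close>

text \<open>The matrix with columns \<open>u\<close> and \<open>v\<close> carries the table of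
  structure constants relative to this basis to \<open>p\<close>; the orbit relation is
  symmetric.\<close>

lemma orbit_basisI:
  fixes u v :: V
  assumes ind: "u$1 * v$2 - u$2 * v$1 \<noteq> 0" and p: "p \<in> Bil2"
    and "fst p u u = a$1 *s u + a$2 *s v" "fst p u v = b$1 *s u + b$2 *s v"
      "fst p v u = c$1 *s u + c$2 *s v" "fst p v v = d$1 *s u + d$2 *s v"
      "snd p u u = a'$1 *s u + a'$2 *s v" "snd p u v = b'$1 *s u + b'$2 *s v"
      "snd p v u = c'$1 *s u + c'$2 *s v" "snd p v v = d'$1 *s u + d'$2 *s v"
  shows "(table a b c d, table a' b' c' d') \<in> orbit p"
proof -
  define B :: "complex^2^2" where "B = (\<chi> i j. if j = 1 then u$i else v$i)"
  have B: "B *v x = x$1 *s u + x$2 *s v" for x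
    by (simp add: vec2_eq_iff mat_vec_nth B_def mult.commute)
  have "det B \<noteq> 0"
    using ind by (simp add: det_2 B_def mult.commute)
  then have "invertible B"
    by (simp add: invertible_det_nz)
  then have "act B (table a b c d, table a' b' c' d') = p"
    by (rule act_eqI)
      (simp_all add: B Bil2_linear[OF p] assms(3-) table_nth, simp_all add: vec2_eq_iff algebra_simps)
  then show ?thesis
    using orbit_sym orbitI[OF \<open>invertible B\<close>] by metis
qed

text \<open>For \<open>t \<noteq> 0\<close> the tables are structures in the orbit, so a polynomial
  vanishing on the orbit vanishes at \<open>t = 0\<close> by continuity. Only the structure
  constants have to extend to \<open>t = 0\<close>: the basis itself may collapse or blow up
  there.\<close>

lemma degenerates_curveI:
  fixes u v a b c d a' b' c' d' :: "complex \<Rightarrow> V"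
  assumes p: "p \<in> Bil2" and q: "q = (table (a 0) (b 0) (c 0) (d 0), table (a' 0) (b' 0) (c' 0) (d' 0))"
    and basis: "\<And>t. t \<noteq> 0 \<Longrightarrow> u t$1 * v t$2 - u t$2 * v t$1 \<noteq> 0 \<and>
      fst p (u t) (u t) = a t$1 *s u t + a t$2 *s v t \<and> fst p (u t) (v t) = b t$1 *s u t + b t$2 *s v t \<and>
      fst p (v t) (u t) = c t$1 *s u t + c t$2 *s v t \<and> fst p (v t) (v t) = d t$1 *s u t + d t$2 *s v t \<and>
      snd p (u t) (u t) = a' t$1 *s u t + a' t$2 *s v t \<and> snd p (u t) (v t) = b' t$1 *s u t + b' t$2 *s v t \<and>
      snd p (v t) (u t) = c' t$1 *s u t + c' t$2 *s v t \<and> snd p (v t) (v t) = d' t$1 *s u t + d' t$2 *s v t"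
    and cont: "\<forall>w\<in>{a, b, c, d, a', b', c', d'}. isCont (\<lambda>t. w t $ 1) 0 \<and> isCont (\<lambda>t. w t $ 2) 0"
  shows "degenerates p q"
proof -
  define P where "P t = (table (a t) (b t) (c t) (d t), table (a' t) (b' t) (c' t) (d' t))" for t
  have "f q = 0" if f: "regular f" "\<forall>A. invertible A \<longrightarrow> f (act A p) = 0" for f
  proof -
    obtain g where g: "polyfun g" "\<And>p. p \<in> Bil2 \<Longrightarrow> f p = g p"
      using f(1) unfolding regular_def by blast
    have c: "isCont (\<lambda>t. a t $ i) 0" "isCont (\<lambda>t. b t $ i) 0" "isCont (\<lambda>t. c t $ i) 0"
      "isCont (\<lambda>t. d t $ i) 0" "isCont (\<lambda>t. a' t $ i) 0" "isCont (\<lambda>t. b' t $ i) 0"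
      "isCont (\<lambda>t. c' t $ i) 0" "isCont (\<lambda>t. d' t $ i) 0" for i
      using cont exhaust_2[of i] by auto
    have "isCont (\<lambda>t. g (P t)) 0"
      using g(1)
    proof induction
      case (coord_fst i j k)
      show ?case
        unfolding P_def fst_conv table_nth by (intro isCont_add isCont_mult continuous_const c)
    next
      case (coord_snd i j k)
      show ?case
        unfolding P_def snd_conv table_nth by (intro isCont_add isCont_mult continuous_const c)
    qed (simp_all add: isCont_add isCont_mult)
    then have "((\<lambda>t. g (P t)) \<longlongrightarrow> g (P 0)) (at 0)"
      by (simp add: isCont_def)
    moreover have "g (P t) = 0" if "t \<noteq> 0" for t
    proof -
      have "P t \<in> orbit p"
        unfolding P_def by (rule orbit_basisI[of "u t" "v t", OF _ p]) (use basis[OF that] in simp_all)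
      then obtain A where A: "invertible A" "P t = act A p"
        unfolding orbit_def by (elim CollectE exE conjE) simp
      have "g (P t) = f (P t)"
        by (rule g(2)[symmetric]) (simp add: P_def)
      then show ?thesis
        using f(2) A by simp
    qed
    then have "((\<lambda>t. g (P t)) \<longlongrightarrow> 0) (at 0)"
      by (intro tendsto_eventually) (simp add: eventually_at_filter)
    ultimately have "g (P 0) = 0"
      using LIM_unique by blast
    then show ?thesis
      using g(2)[of q] by (simp only: P_def q table_pair_in_Bil2)
  qed
  moreover have "q \<in> Bil2"
    by (simp add: q)
  ultimately show ?thesis
    by (simp add: degenerates_iff_regular p)
qed

section \<open>Explicit curves for the generating degenerations\<close>

lemmas curve_simps = vector2_nth table_eq_table_iff vec2_eq_iff table_nth e1_nth e2_nth ring_distribs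

text \<open>The unit \<open>e1 + e2\<close> is kept and \<open>t e1\<close> becomes nilpotent: the
  product of two fields degenerates to the dual numbers.\<close>

lemma N03_degenerates_N06:
  shows "degenerates (structure_of N03) (structure_of (N06 1))"
  by (rule degenerates_curveI[where u = "\<lambda>t. vector [t, 0]" and v = "\<lambda>t. vector [1, 1]"
      and a = "\<lambda>t. vector [0, 0]" and b = "\<lambda>t. vector [0, 0]"
      and c = "\<lambda>t. vector [0, 0]" and d = "\<lambda>t. vector [0, 0]"
      and a' = "\<lambda>t. vector [t, 0]" and b' = "\<lambda>t. vector [1, 0]"
      and c' = "\<lambda>t. vector [1, 0]" and d' = "\<lambda>t. vector [0, 1]"])
    (simp_all add: curve_simps, (simp add: field_simps)?)

lemma N03_degenerates_N04:
  shows "degenerates (structure_of N03) (structure_of N04)"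
  by (rule degenerates_curveI[where u = "\<lambda>t. vector [1, 0]" and v = "\<lambda>t. vector [0, t]"
      and a = "\<lambda>t. vector [0, 0]" and b = "\<lambda>t. vector [0, 0]"
      and c = "\<lambda>t. vector [0, 0]" and d = "\<lambda>t. vector [0, 0]"
      and a' = "\<lambda>t. vector [1, 0]" and b' = "\<lambda>t. vector [0, 0]"
      and c' = "\<lambda>t. vector [0, 0]" and d' = "\<lambda>t. vector [0, t]"])
    (simp_all add: curve_simps, (simp add: field_simps)?)

lemma N07_degenerates_N11:
  shows "degenerates (structure_of (N07 x y)) (structure_of (N11 x))"
  by (rule degenerates_curveI[where u = "\<lambda>t. vector [1, 0]" and v = "\<lambda>t. vector [0, t]"
      and a = "\<lambda>t. vector [1, 0]" and b = "\<lambda>t. vector [0, 0]"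
      and c = "\<lambda>t. vector [0, 0]" and d = "\<lambda>t. vector [0, t]"
      and a' = "\<lambda>t. vector [x, 0]" and b' = "\<lambda>t. vector [0, 0]"
      and c' = "\<lambda>t. vector [0, 0]" and d' = "\<lambda>t. vector [0, y * t]"])
    (simp_all add: curve_simps, (simp add: field_simps)?)

lemma N07_degenerates_N11_snd:
  shows "degenerates (structure_of (N07 x y)) (structure_of (N11 y))"
  by (rule degenerates_curveI[where u = "\<lambda>t. vector [0, 1]" and v = "\<lambda>t. vector [t, 0]"
      and a = "\<lambda>t. vector [1, 0]" and b = "\<lambda>t. vector [0, 0]"
      and c = "\<lambda>t. vector [0, 0]" and d = "\<lambda>t. vector [0, t]"
      and a' = "\<lambda>t. vector [y, 0]" and b' = "\<lambda>t. vector [0, 0]"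
      and c' = "\<lambda>t. vector [0, 0]" and d' = "\<lambda>t. vector [0, x * t]"])
    (simp_all add: curve_simps, (simp add: field_simps)?)

text \<open>Here \<open>u\<close> is \<open>t\<close> times the unit of \<open>\<cdot>\<close>, so
  \<open>u \<cdot> u = t u\<close> tends to zero, and \<open>v\<close> is
  \<open>u \<circ> u\<close>. The determinant is \<open>t^3 (y - x)\<close>.\<close>

lemma N07_degenerates_N01:
  assumes "x \<noteq> y"
  shows "degenerates (structure_of (N07 x y)) (structure_of N01)"
  by (rule degenerates_curveI[where u = "\<lambda>t. vector [t, t]"
      and v = "\<lambda>t. vector [x * (t * t), y * (t * t)]" and a = "\<lambda>t. vector [t, 0]"
      and b = "\<lambda>t. vector [0, t]" and c = "\<lambda>t. vector [0, t]"
      and d = "\<lambda>t. vector [- (x * y) * (t * t * t), (x + y) * (t * t)]"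
      and a' = "\<lambda>t. vector [0, 1]"
      and b' = "\<lambda>t. vector [- (x * y) * (t * t), (x + y) * t]"
      and c' = "\<lambda>t. vector [- (x * y) * (t * t), (x + y) * t]"
      and d' = "\<lambda>t. vector [- (x + y) * (x * y) * (t * t * t), ((x + y) * (x + y) - x * y) * (t * t)]"])
    (simp_all add: curve_simps assms assms[symmetric], (simp add: field_simps assms assms[symmetric])?)

text \<open>The vector \<open>u\<close> is chosen such that \<open>u \<circ> u - z (u \<cdot> u)\<close> is a multiple of \<open>u\<close>.\<close>

lemma N07_degenerates_N14:
  assumes "x \<noteq> y" "z \<noteq> x" "z \<noteq> y"
  shows "degenerates (structure_of (N07 x y)) (structure_of (N14 z))"
proof -
  have "u1 * v2 - u2 * v1 = t * t * t * ((y - z) * (x - z) * (x - y))"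
    if "u1 = (y - z) * t" "u2 = (x - z) * t" "v1 = (y - z) * (y - z) * (t * t)" "v2 = (x - z) * (x - z) * (t * t)"
    for t u1 u2 v1 v2
    unfolding that by (simp add: algebra_simps)
  then have det: "t \<noteq> 0 \<Longrightarrow> (y - z) * t * ((x - z) * (x - z) * (t * t)) - (x - z) * t * ((y - z) * (y - z) * (t * t)) \<noteq> 0" for t
    using assms by simp
  show ?thesis
    \<comment> \<open>The vector \<open>v\<close> is \<open>u \<cdot> u\<close>. The other constants
      come from reducing powers of \<open>u\<close> by the quadratic equation with roots
      \<open>(y - z) t\<close> and \<open>(x - z) t\<close>, the coordinates of
      \<open>u\<close>.\<close>
    by (rule degenerates_curveI[where u = "\<lambda>t. vector [(y - z) * t, (x - z) * t]"
      and v = "\<lambda>t. vector [(y - z) * (y - z) * (t * t), (x - z) * (x - z) * (t * t)]"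
      and a = "\<lambda>t. vector [0, 1]"
      and b = "\<lambda>t. vector [- ((y - z) * (x - z)) * (t * t), ((y - z) + (x - z)) * t]"
      and c = "\<lambda>t. vector [- ((y - z) * (x - z)) * (t * t), ((y - z) + (x - z)) * t]"
      and d = "\<lambda>t. vector [- ((y - z) * (x - z)) * ((y - z) + (x - z)) * (t * t * t),
          (((y - z) + (x - z)) * ((y - z) + (x - z)) - ((y - z) * (x - z))) * (t * t)]"
      and a' = "\<lambda>t. vector [((y - z) * (x - z)) * t, z]"
      and b' = "\<lambda>t. vector [- z * ((y - z) * (x - z)) * (t * t),
          (z * ((y - z) + (x - z)) + ((y - z) * (x - z))) * t]"
      and c' = "\<lambda>t. vector [- z * ((y - z) * (x - z)) * (t * t),
          (z * ((y - z) + (x - z)) + ((y - z) * (x - z))) * t]"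
      and d' = "\<lambda>t. vector [- ((y - z) * (x - z)) * (z * ((y - z) + (x - z)) + ((y - z) * (x - z))) * (t * t * t),
          (z * (((y - z) + (x - z)) * ((y - z) + (x - z)) - ((y - z) * (x - z))) + ((y - z) * (x - z)) * ((y - z) + (x - z))) * (t * t)]"])
      (simp_all add: curve_simps, (simp add: field_simps)?, (use det in \<open>simp add: algebra_simps\<close>)?)
qed

lemma N07_degenerates_N09:
  shows "degenerates (structure_of (N07 x x)) (structure_of (N09 x x))"
  by (rule degenerates_curveI[where u = "\<lambda>t. vector [1, 1]" and v = "\<lambda>t. vector [t, 0]"
      and a = "\<lambda>t. vector [1, 0]" and b = "\<lambda>t. vector [0, 1]"
      and c = "\<lambda>t. vector [0, 1]" and d = "\<lambda>t. vector [0, t]"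
      and a' = "\<lambda>t. vector [x, 0]" and b' = "\<lambda>t. vector [0, x]"
      and c' = "\<lambda>t. vector [0, x]" and d' = "\<lambda>t. vector [0, x * t]"])
    (simp_all add: curve_simps, (simp add: field_simps)?)

text \<open>Replacing \<open>e2\<close> by \<open>e2 / t\<close> multiplies the \<open>e2\<close>
  part of \<open>e1 \<circ> e1\<close> by \<open>t\<close> and leaves all other structure constants
  alone.\<close>

lemma N08_degenerates_N09:
  shows "degenerates (structure_of (N08 x y)) (structure_of (N09 x y))"
  by (rule degenerates_curveI[where u = "\<lambda>t. vector [1, 0]" and v = "\<lambda>t. vector [0, 1 / t]"
      and a = "\<lambda>t. vector [1, 0]" and b = "\<lambda>t. vector [0, 1]"
      and c = "\<lambda>t. vector [0, 1]" and d = "\<lambda>t. vector [0, 0]"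
      and a' = "\<lambda>t. vector [x, t]" and b' = "\<lambda>t. vector [0, y]"
      and c' = "\<lambda>t. vector [0, x]" and d' = "\<lambda>t. vector [0, 0]"])
    (simp_all add: curve_simps, (simp add: field_simps)?)

lemma N08_degenerates_N01:
  shows "degenerates (structure_of (N08 x y)) (structure_of N01)"
  by (rule degenerates_curveI[where u = "\<lambda>t. vector [t, 0]" and v = "\<lambda>t. vector [0, (t * t)]"
      and a = "\<lambda>t. vector [t, 0]" and b = "\<lambda>t. vector [0, t]"
      and c = "\<lambda>t. vector [0, t]" and d = "\<lambda>t. vector [0, 0]"
      and a' = "\<lambda>t. vector [x * t, 1]" and b' = "\<lambda>t. vector [0, y * t]"
      and c' = "\<lambda>t. vector [0, x * t]" and d' = "\<lambda>t. vector [0, 0]"])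
    (simp_all add: curve_simps, (simp add: field_simps)?)

text \<open>Again \<open>v = u \<cdot> u\<close>. The ratio \<open>z - y\<close> of the coordinates
  of \<open>u\<close> makes \<open>u \<circ> u - z (u \<cdot> u)\<close> a multiple of
  \<open>u\<close>; for \<open>z = y\<close> the vector \<open>v\<close> would be zero.\<close>

lemma N08_degenerates_N14:
  assumes "z \<noteq> y"
  shows "degenerates (structure_of (N08 x y)) (structure_of (N14 z))"
proof -
  have "k * t * (2 * (k * t) * t) - t * (k * (k * t) * t) = t * t * t * (k * k)" for t k :: complex
    by (simp add: algebra_simps)
  then have det: "t \<noteq> 0 \<Longrightarrow> (z - y) * t * (2 * ((z - y) * t) * t) - t * ((z - y) * ((z - y) * t) * t) \<noteq> 0" for t
    using assms by simp
  show ?thesis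
    by (rule degenerates_curveI[where u = "\<lambda>t. vector [((z - y) * t), t]"
      and v = "\<lambda>t. vector [(z - y) * ((z - y) * t) * t, 2 * ((z - y) * t) * t]"
      and a = "\<lambda>t. vector [0, 1]"
      and b = "\<lambda>t. vector [- ((((z - y) * t) * ((z - y) * t))), 2 * ((z - y) * t)]"
      and c = "\<lambda>t. vector [- ((((z - y) * t) * ((z - y) * t))), 2 * ((z - y) * t)]"
      and d = "\<lambda>t. vector [- 2 * (((z - y) * t) * ((z - y) * t) * ((z - y) * t)),
          3 * (((z - y) * t) * ((z - y) * t))]"
      and a' = "\<lambda>t. vector [(x - z) * ((z - y) * t), z]"
      and b' = "\<lambda>t. vector [(x - y - z) * (((z - y) * t) * ((z - y) * t)), (z + y) * ((z - y) * t)]"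
      and c' = "\<lambda>t. vector [- z * (((z - y) * t) * ((z - y) * t)), (x + z) * ((z - y) * t)]"
      and d' = "\<lambda>t. vector [- (z + y) * (((z - y) * t) * ((z - y) * t) * ((z - y) * t)),
          (x + z + y) * (((z - y) * t) * ((z - y) * t))]"])
      (simp_all add: curve_simps, (simp add: field_simps)?, (use det in \<open>simp add: algebra_simps\<close>)?)
qed

lemma N10_degenerates_N11:
  shows "degenerates (structure_of (N10 x)) (structure_of (N11 x))"
  by (rule degenerates_curveI[where u = "\<lambda>t. vector [1, 0]" and v = "\<lambda>t. vector [0, t]"
      and a = "\<lambda>t. vector [1, 0]" and b = "\<lambda>t. vector [0, 0]"
      and c = "\<lambda>t. vector [0, 0]" and d = "\<lambda>t. vector [0, 0]"
      and a' = "\<lambda>t. vector [x, 0]" and b' = "\<lambda>t. vector [0, 0]"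
      and c' = "\<lambda>t. vector [0, 0]" and d' = "\<lambda>t. vector [0, t]"])
    (simp_all add: curve_simps, (simp add: field_simps)?)

lemma N10_degenerates_N04:
  shows "degenerates (structure_of (N10 x)) (structure_of N04)"
  by (rule degenerates_curveI[where u = "\<lambda>t. vector [0, 1]" and v = "\<lambda>t. vector [t, 0]"
      and a = "\<lambda>t. vector [0, 0]" and b = "\<lambda>t. vector [0, 0]"
      and c = "\<lambda>t. vector [0, 0]" and d = "\<lambda>t. vector [0, t]"
      and a' = "\<lambda>t. vector [1, 0]" and b' = "\<lambda>t. vector [0, 0]"
      and c' = "\<lambda>t. vector [0, 0]" and d' = "\<lambda>t. vector [0, x * t]"])
    (simp_all add: curve_simps, (simp add: field_simps)?)

text \<open>With \<open>v = u \<cdot> u\<close>, the ratio \<open>x - z\<close> of the coordinates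
  of \<open>u\<close> gives \<open>u \<circ> u = z v + (x - z) t u\<close>. For \<open>z = x\<close>
  the two vectors would be proportional.\<close>

lemma N10_degenerates_N14:
  assumes "z \<noteq> x"
  shows "degenerates (structure_of (N10 x)) (structure_of (N14 z))"
  by (rule degenerates_curveI[where u = "\<lambda>t. vector [t, (x - z) * t]"
      and v = "\<lambda>t. vector [(t * t), 0]" and a = "\<lambda>t. vector [0, 1]"
      and b = "\<lambda>t. vector [0, t]" and c = "\<lambda>t. vector [0, t]"
      and d = "\<lambda>t. vector [0, (t * t)]" and a' = "\<lambda>t. vector [(x - z) * t, z]"
      and b' = "\<lambda>t. vector [0, x * t]" and c' = "\<lambda>t. vector [0, x * t]"
      and d' = "\<lambda>t. vector [0, x * (t * t)]"])
    (simp_all add: curve_simps assms, (simp add: field_simps assms)?)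

lemma N12_degenerates_N02:
  shows "degenerates (structure_of (N12 0)) (structure_of N02)"
  by (rule degenerates_curveI[where u = "\<lambda>t. vector [0, 1 / t]" and v = "\<lambda>t. vector [- 1, 0]"
      and a = "\<lambda>t. vector [0, 0]" and b = "\<lambda>t. vector [0, 0]"
      and c = "\<lambda>t. vector [0, 0]" and d = "\<lambda>t. vector [t, 0]"
      and a' = "\<lambda>t. vector [0, 0]" and b' = "\<lambda>t. vector [0, 0]"
      and c' = "\<lambda>t. vector [- 1, 0]" and d' = "\<lambda>t. vector [0, 0]"])
    (simp_all add: curve_simps, (simp add: field_simps)?)

text \<open>Stretching \<open>e2\<close> makes \<open>e1 \<cdot> e1\<close> disappear in the limit;
  \<open>e1 / x\<close> is idempotent for \<open>\<circ>\<close> and multiplies \<open>e2\<close> by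
  \<open>1 / x\<close> from the left and by \<open>1\<close> from the right.\<close>

lemma N12_degenerates_N06:
  assumes "x \<noteq> 0"
  shows "degenerates (structure_of (N12 x)) (structure_of (N06 (inverse x)))"
  by (rule degenerates_curveI[where u = "\<lambda>t. vector [0, 1 / t]"
      and v = "\<lambda>t. vector [inverse x, 0]" and a = "\<lambda>t. vector [0, 0]"
      and b = "\<lambda>t. vector [0, 0]" and c = "\<lambda>t. vector [0, 0]"
      and d = "\<lambda>t. vector [inverse x * inverse x * t, 0]"
      and a' = "\<lambda>t. vector [0, 0]" and b' = "\<lambda>t. vector [1, 0]"
      and c' = "\<lambda>t. vector [inverse x, 0]" and d' = "\<lambda>t. vector [0, 1]"])
    (simp_all add: curve_simps assms, (simp add: field_simps assms)?)

lemma N12_degenerates_N14: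
  shows "degenerates (structure_of (N12 x)) (structure_of (N14 z))"
  by (rule degenerates_curveI[where u = "\<lambda>t. vector [t, z * t]"
      and v = "\<lambda>t. vector [0, (t * t)]" and a = "\<lambda>t. vector [0, 1]"
      and b = "\<lambda>t. vector [0, 0]" and c = "\<lambda>t. vector [0, 0]"
      and d = "\<lambda>t. vector [0, 0]" and a' = "\<lambda>t. vector [x * t, z]"
      and b' = "\<lambda>t. vector [0, t]" and c' = "\<lambda>t. vector [0, x * t]"
      and d' = "\<lambda>t. vector [0, 0]"])
    (simp_all add: curve_simps, (simp add: field_simps)?)

lemma N09_degenerates_N14:
  shows "degenerates (structure_of (N09 x y)) (structure_of (N14 y))"
  by (rule degenerates_curveI[where u = "\<lambda>t. vector [t, t]"
      and v = "\<lambda>t. vector [(t * t), 2 * (t * t)]" and a = "\<lambda>t. vector [0, 1]"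
      and b = "\<lambda>t. vector [- ((t * t)), 2 * t]"
      and c = "\<lambda>t. vector [- ((t * t)), 2 * t]"
      and d = "\<lambda>t. vector [- 2 * (t * t * t), 3 * (t * t)]"
      and a' = "\<lambda>t. vector [(x - y) * t, y]"
      and b' = "\<lambda>t. vector [(x - 2 * y) * (t * t), 2 * y * t]"
      and c' = "\<lambda>t. vector [- y * (t * t), (y + x) * t]"
      and d' = "\<lambda>t. vector [- 2 * y * (t * t * t), (2 * y + x) * (t * t)]"])
    (simp_all add: curve_simps, (simp add: field_simps)?)

lemma N11_degenerates_N14:
  shows "degenerates (structure_of (N11 x)) (structure_of (N14 x))"
  by (rule degenerates_curveI[where u = "\<lambda>t. vector [t, t]" and v = "\<lambda>t. vector [(t * t), 0]"
      and a = "\<lambda>t. vector [0, 1]" and b = "\<lambda>t. vector [0, t]"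
      and c = "\<lambda>t. vector [0, t]" and d = "\<lambda>t. vector [0, (t * t)]"
      and a' = "\<lambda>t. vector [0, x]" and b' = "\<lambda>t. vector [0, x * t]"
      and c' = "\<lambda>t. vector [0, x * t]" and d' = "\<lambda>t. vector [0, x * (t * t)]"])
    (simp_all add: curve_simps, (simp add: field_simps)?)

lemma N13_degenerates_N14:
  shows "degenerates (structure_of (N13 x)) (structure_of (N14 x))"
  by (rule degenerates_curveI[where u = "\<lambda>t. vector [t, 0]" and v = "\<lambda>t. vector [0, (t * t)]"
      and a = "\<lambda>t. vector [0, 1]" and b = "\<lambda>t. vector [0, 0]"
      and c = "\<lambda>t. vector [0, 0]" and d = "\<lambda>t. vector [0, 0]"
      and a' = "\<lambda>t. vector [t, x]" and b' = "\<lambda>t. vector [0, 0]"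
      and c' = "\<lambda>t. vector [0, t]" and d' = "\<lambda>t. vector [0, 0]"])
    (simp_all add: curve_simps, (simp add: field_simps)?)

lemma N13_degenerates_N06:
  shows "degenerates (structure_of (N13 x)) (structure_of (N06 0))"
  by (rule degenerates_curveI[where u = "\<lambda>t. vector [0, 1 / t]" and v = "\<lambda>t. vector [1, 0]"
      and a = "\<lambda>t. vector [0, 0]" and b = "\<lambda>t. vector [0, 0]"
      and c = "\<lambda>t. vector [0, 0]" and d = "\<lambda>t. vector [t, 0]"
      and a' = "\<lambda>t. vector [0, 0]" and b' = "\<lambda>t. vector [1, 0]"
      and c' = "\<lambda>t. vector [0, 0]" and d' = "\<lambda>t. vector [x * t, 1]"])
    (simp_all add: curve_simps, (simp add: field_simps)?)

lemma N05_degenerates_N06: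
  shows "degenerates (structure_of N05) (structure_of (N06 0))"
  by (rule degenerates_curveI[where u = "\<lambda>t. vector [1 / t, 0]" and v = "\<lambda>t. vector [0, 1]"
      and a = "\<lambda>t. vector [0, 0]" and b = "\<lambda>t. vector [0, 0]"
      and c = "\<lambda>t. vector [0, 0]" and d = "\<lambda>t. vector [0, 0]"
      and a' = "\<lambda>t. vector [0, 0]" and b' = "\<lambda>t. vector [1, 0]"
      and c' = "\<lambda>t. vector [0, 0]" and d' = "\<lambda>t. vector [t, 1]"])
    (simp_all add: curve_simps, (simp add: field_simps)?)

lemma N05_degenerates_N01:
  shows "degenerates (structure_of N05) (structure_of N01)"
  by (rule degenerates_curveI[where u = "\<lambda>t. vector [0, t]" and v = "\<lambda>t. vector [(t * t), 0]"
      and a = "\<lambda>t. vector [0, 0]" and b = "\<lambda>t. vector [0, 0]"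
      and c = "\<lambda>t. vector [0, 0]" and d = "\<lambda>t. vector [0, 0]"
      and a' = "\<lambda>t. vector [t, 1]" and b' = "\<lambda>t. vector [0, 0]"
      and c' = "\<lambda>t. vector [0, t]" and d' = "\<lambda>t. vector [0, 0]"])
    (simp_all add: curve_simps, (simp add: field_simps)?)

text \<open>For \<open>u = t (e1 + e2)\<close> one has \<open>u \<circ> u = t u + v\<close> with
  \<open>v = x t^2 e1\<close>, which is independent of \<open>u\<close> because
  \<open>x \<noteq> 0\<close>.\<close>

lemma N06_degenerates_N01:
  assumes "x \<noteq> 0"
  shows "degenerates (structure_of (N06 x)) (structure_of N01)"
  by (rule degenerates_curveI[where u = "\<lambda>t. vector [t, t]"
      and v = "\<lambda>t. vector [x * (t * t), 0]" and a = "\<lambda>t. vector [0, 0]"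
      and b = "\<lambda>t. vector [0, 0]" and c = "\<lambda>t. vector [0, 0]"
      and d = "\<lambda>t. vector [0, 0]" and a' = "\<lambda>t. vector [t, 1]"
      and b' = "\<lambda>t. vector [0, x * t]" and c' = "\<lambda>t. vector [0, t]"
      and d' = "\<lambda>t. vector [0, 0]"])
    (simp_all add: curve_simps assms, (simp add: field_simps assms)?)

lemma N04_degenerates_N01:
  shows "degenerates (structure_of N04) (structure_of N01)"
  by (rule degenerates_curveI[where u = "\<lambda>t. vector [t, t]" and v = "\<lambda>t. vector [(t * t), 0]"
      and a = "\<lambda>t. vector [0, 0]" and b = "\<lambda>t. vector [0, 0]"
      and c = "\<lambda>t. vector [0, 0]" and d = "\<lambda>t. vector [0, 0]"
      and a' = "\<lambda>t. vector [0, 1]" and b' = "\<lambda>t. vector [0, t]"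
      and c' = "\<lambda>t. vector [0, t]" and d' = "\<lambda>t. vector [0, (t * t)]"])
    (simp_all add: curve_simps, (simp add: field_simps)?)

lemma N02_degenerates_N01:
  shows "degenerates (structure_of N02) (structure_of N01)"
  by (rule degenerates_curveI[where u = "\<lambda>t. vector [t, t]"
      and v = "\<lambda>t. vector [- ((t * t)), 0]" and a = "\<lambda>t. vector [0, 0]"
      and b = "\<lambda>t. vector [0, 0]" and c = "\<lambda>t. vector [0, 0]"
      and d = "\<lambda>t. vector [0, 0]" and a' = "\<lambda>t. vector [0, 1]"
      and b' = "\<lambda>t. vector [0, - t]" and c' = "\<lambda>t. vector [0, 0]"
      and d' = "\<lambda>t. vector [0, 0]"])
    (simp_all add: curve_simps, (simp add: field_simps)?)

lemma N14_degenerates_NZero: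
  shows "degenerates (structure_of (N14 x)) (structure_of NZero)"
  by (rule degenerates_curveI[where u = "\<lambda>t. vector [t, 0]" and v = "\<lambda>t. vector [0, t]"
      and a = "\<lambda>t. vector [0, t]" and b = "\<lambda>t. vector [0, 0]"
      and c = "\<lambda>t. vector [0, 0]" and d = "\<lambda>t. vector [0, 0]"
      and a' = "\<lambda>t. vector [0, x * t]" and b' = "\<lambda>t. vector [0, 0]"
      and c' = "\<lambda>t. vector [0, 0]" and d' = "\<lambda>t. vector [0, 0]"])
    (simp_all add: curve_simps, (simp add: field_simps)?)

lemma N06_degenerates_NZero:
  shows "degenerates (structure_of (N06 0)) (structure_of NZero)"
  by (rule degenerates_curveI[where u = "\<lambda>t. vector [t, 0]" and v = "\<lambda>t. vector [0, t]"
      and a = "\<lambda>t. vector [0, 0]" and b = "\<lambda>t. vector [0, 0]"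
      and c = "\<lambda>t. vector [0, 0]" and d = "\<lambda>t. vector [0, 0]"
      and a' = "\<lambda>t. vector [0, 0]" and b' = "\<lambda>t. vector [t, 0]"
      and c' = "\<lambda>t. vector [0, 0]" and d' = "\<lambda>t. vector [0, t]"])
    (simp_all add: curve_simps, (simp add: field_simps)?)

lemma N01_degenerates_NZero:
  shows "degenerates (structure_of N01) (structure_of NZero)"
  by (rule degenerates_curveI[where u = "\<lambda>t. vector [t, 0]" and v = "\<lambda>t. vector [0, t]"
      and a = "\<lambda>t. vector [0, 0]" and b = "\<lambda>t. vector [0, 0]"
      and c = "\<lambda>t. vector [0, 0]" and d = "\<lambda>t. vector [0, 0]"
      and a' = "\<lambda>t. vector [0, t]" and b' = "\<lambda>t. vector [0, 0]"
      and c' = "\<lambda>t. vector [0, 0]" and d' = "\<lambda>t. vector [0, 0]"])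
    (simp_all add: curve_simps, (simp add: field_simps)?)

text \<open>The direct curves from \<open>N07\<close> and \<open>N08\<close> to \<open>N14\<close>
  break down when the parameter of \<open>N14\<close> equals one of \<open>N07\<close>, respectively
  the second one of \<open>N08\<close>. There the degeneration passes through \<open>N11\<close>,
  respectively \<open>N09\<close>.\<close>

lemma edge_imp_degenerates: "edge T T' \<Longrightarrow> degenerates (structure_of T) (structure_of T')"
proof (induction rule: edge.induct)
  case (6 \<delta> \<epsilon> \<alpha>)
  show ?case
  proof (cases "\<alpha> = \<delta> \<or> \<alpha> = \<epsilon>")
    case True
    then show ?thesis
      using degenerates_trans[OF _ _ N07_degenerates_N11 N11_degenerates_N14]
        degenerates_trans[OF _ _ N07_degenerates_N11_snd N11_degenerates_N14] by auto
  next
    case False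
    then show ?thesis
      using 6 by (intro N07_degenerates_N14) auto
  qed
next
  case (10 \<delta> \<epsilon> \<alpha>)
  show ?case
    using degenerates_trans[OF _ _ N08_degenerates_N09 N09_degenerates_N14] N08_degenerates_N14
    by (cases "\<alpha> = \<epsilon>") auto
qed (assumption | rule N03_degenerates_N06 N03_degenerates_N04 N07_degenerates_N11 N07_degenerates_N11_snd
    N07_degenerates_N01 N07_degenerates_N14 N07_degenerates_N09 N08_degenerates_N09 N08_degenerates_N01
    N08_degenerates_N14 N10_degenerates_N11 N10_degenerates_N04 N10_degenerates_N14 N12_degenerates_N02
    N12_degenerates_N06 N12_degenerates_N14 N09_degenerates_N14 N11_degenerates_N14 N13_degenerates_N14
    N13_degenerates_N06 N05_degenerates_N06 N05_degenerates_N01 N06_degenerates_N01 N04_degenerates_N01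
    N02_degenerates_N01 N14_degenerates_NZero N06_degenerates_NZero N01_degenerates_NZero)+

lemma tranclp_edge_imp_degenerates:
  "edge\<^sup>+\<^sup>+ T T' \<Longrightarrow> degenerates (structure_of T) (structure_of T')"
  by (induction rule: tranclp_induct)
    (auto intro: edge_imp_degenerates degenerates_trans[OF structure_of_in_Bil2 structure_of_in_Bil2])

section \<open>Closed invariant conditions\<close>

text \<open>The traces of left and right multiplication by \<open>x\<close>. For the commutative
  product they agree, so \<open>rtr\<close> is applied only to \<open>\<circ>\<close> in the
  identities below.\<close>

definition ltr :: "product \<Rightarrow> V \<Rightarrow> complex" where
  "ltr m x = m x e1 $ 1 + m x e2 $ 2"

definition rtr :: "product \<Rightarrow> V \<Rightarrow> complex" where
  "rtr m x = m e1 x $ 1 + m e2 x $ 2"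

lemma trace_conj:
  fixes f :: "V \<Rightarrow> V"
  assumes f: "Vector_Spaces.linear (*s) (*s) f" and A: "invertible A"
  shows "(A *v f (matrix_inv A *v e1)) $ 1 + (A *v f (matrix_inv A *v e2)) $ 2 = f e1 $ 1 + f e2 $ 2"
proof -
  define M where "M = matrix f"
  have M: "f x = M *v x" for x
    using matrix_works[OF f] by (simp add: M_def)
  have tr: "(N *v e1) $ 1 + (N *v e2) $ 2 = trace N" for N :: "complex^2^2"
    by (simp add: mat_vec_nth e1_nth e2_nth trace_def sum_2)
  have "trace (A ** (M ** matrix_inv A)) = trace M"
    using trace_mul_sym[of A "M ** matrix_inv A"] by (simp add: matrix_mul_assoc[symmetric] matrix_inv_left[OF A])
  then show ?thesis
    by (simp add: M matrix_vector_mul_assoc tr)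
qed

text \<open>Multiplication by \<open>x\<close> in the translated structure is conjugate under
  \<open>A\<close> to multiplication by the inverse image of \<open>x\<close>.\<close>

lemma ltr_act:
  assumes "p \<in> Bil2" "invertible A"
  shows "ltr (fst (act A p)) x = ltr (fst p) (matrix_inv A *v x)"
    "ltr (snd (act A p)) x = ltr (snd p) (matrix_inv A *v x)"
    "rtr (fst (act A p)) x = rtr (fst p) (matrix_inv A *v x)"
    "rtr (snd (act A p)) x = rtr (snd p) (matrix_inv A *v x)"
  using assms trace_conj[OF _ assms(2), of "fst p (matrix_inv A *v x)"]
    trace_conj[OF _ assms(2), of "snd p (matrix_inv A *v x)"]
    trace_conj[OF _ assms(2), of "\<lambda>w. fst p w (matrix_inv A *v x)"]
    trace_conj[OF _ assms(2), of "\<lambda>w. snd p w (matrix_inv A *v x)"]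
  by (auto simp: ltr_def rtr_def fst_act snd_act matrix_inv_cancel Bil2_def bilinear_product_def)

lemma regular_ltr_rtr:
  assumes "\<And>i. regular (\<lambda>p. u p $ i)"
  shows "regular (\<lambda>p. ltr (fst p) (u p))" "regular (\<lambda>p. ltr (snd p) (u p))"
    "regular (\<lambda>p. rtr (fst p) (u p))" "regular (\<lambda>p. rtr (snd p) (u p))"
  unfolding ltr_def rtr_def by (intro regular_intros assms)+

lemma degenerates_closed_condition:
  fixes F :: "V \<Rightarrow> V \<Rightarrow> V \<Rightarrow> bilpair \<Rightarrow> complex"
  assumes deg: "degenerates p q" and pq: "p \<in> Bil2" "q \<in> Bil2"
    and reg: "\<And>x y z. regular (F x y z)"
    and inv: "\<And>A x y z. invertible A \<Longrightarrow> F x y z (act A p) = 0"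
  shows "F x y z q = 0"
  using deg reg inv unfolding degenerates_iff_regular[OF pq] by blast

text \<open>This covers proportional products, commutativity of \<open>\<circ>\<close>, and the
  algebras in which \<open>\<circ>\<close> is a multiple of \<open>\<cdot>\<close> up to a term
  given by a linear form in the right argument times the left argument.\<close>

definition vec_identity :: "complex \<Rightarrow> complex \<Rightarrow> complex \<Rightarrow> complex \<Rightarrow> complex \<Rightarrow> bilpair \<Rightarrow> bool" where
  "vec_identity a1 a2 a3 b c p \<longleftrightarrow> (\<forall>x y.
    a1 *s fst p x y + a2 *s snd p x y + a3 *s snd p y x + (b * ltr (fst p) y + c * rtr (snd p) y) *s x = 0)"

definition linear_identity :: "complex \<Rightarrow> complex \<Rightarrow> complex \<Rightarrow> bilpair \<Rightarrow> bool" where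
  "linear_identity a b c p \<longleftrightarrow> (\<forall>x. a * ltr (fst p) x + b * ltr (snd p) x + c * rtr (snd p) x = 0)"

definition quadratic_identity ::
  "complex \<Rightarrow> complex \<Rightarrow> complex \<Rightarrow> complex \<Rightarrow> complex \<Rightarrow> complex \<Rightarrow> complex \<Rightarrow> complex \<Rightarrow> bilpair \<Rightarrow> bool" where
  "quadratic_identity c1 c2 c3 c4 d1 d2 d3 d4 p \<longleftrightarrow> (\<forall>x y.
    c1 * ltr (fst p) (fst p x y) + c2 * ltr (fst p) (snd p x y)
    + c3 * ltr (snd p) (snd p x y) + c4 * rtr (snd p) (snd p x y)
    + d1 * ltr (fst p) x * ltr (fst p) y + d2 * (ltr (fst p) x * ltr (snd p) y + ltr (snd p) x * ltr (fst p) y)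
    + d3 * ltr (snd p) x * ltr (snd p) y + d4 * rtr (snd p) x * rtr (snd p) y = 0)"

text \<open>If the linear form is not zero, the identity says that the product \<open>c m + d n\<close> takes values in a line
  and depends on its left argument only through the form.\<close>

definition rank_one_identity :: "complex \<Rightarrow> complex \<Rightarrow> complex \<Rightarrow> complex \<Rightarrow> bilpair \<Rightarrow> bool" where
  "rank_one_identity a b c d p \<longleftrightarrow> (\<forall>x y z.
    (a * ltr (fst p) z + b * ltr (snd p) z) *s (c *s fst p x y + d *s snd p x y)
    = (a * ltr (fst p) x + b * ltr (snd p) x) *s (c *s fst p z y + d *s snd p z y))"

text \<open>The left-hand side of the identity is equivariant, so it vanishes identically on every
  translate once it does on \<open>p\<close>.\<close>

lemma vec_identity_degenerates:
  assumes deg: "degenerates p q" and pq: "p \<in> Bil2" "q \<in> Bil2" and p: "vec_identity a1 a2 a3 b c p"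
  shows "vec_identity a1 a2 a3 b c q"
proof -
  define G where "G x y p = a1 *s fst p x y + a2 *s snd p x y + a3 *s snd p y x + (b * ltr (fst p) y + c * rtr (snd p) y) *s x" for x y p
  have "G x y (act A p) = A *v G (matrix_inv A *v x) (matrix_inv A *v y) p" if "invertible A" for A x y
    using that
    by (simp add: G_def fst_act snd_act ltr_act[OF pq(1)] matrix_vector_right_distrib vec.scale matrix_inv_cancel)
  then have "G x y (act A p) = 0" if "invertible A" for A x y
    using that p by (simp add: G_def vec_identity_def)
  then have "G x y q $ i = 0" for x y i
    by (intro degenerates_closed_condition[OF deg pq, where F = "\<lambda>x y z p. G x y p $ i"])
      (simp_all add: G_def, intro regular_intros regular_ltr_rtr)
  then show ?thesis
    unfolding G_def vec_identity_def by (simp add: vec2_eq_iff)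
qed

lemma linear_identity_degenerates:
  assumes deg: "degenerates p q" and pq: "p \<in> Bil2" "q \<in> Bil2" and p: "linear_identity a b c p"
  shows "linear_identity a b c q"
  unfolding linear_identity_def
  by (intro allI degenerates_closed_condition[OF deg pq, where F = "\<lambda>x y z p. a * ltr (fst p) x + b * ltr (snd p) x + c * rtr (snd p) x"]
      regular_intros regular_ltr_rtr)
    (simp add: ltr_act[OF pq(1)] p[unfolded linear_identity_def])

lemma quadratic_identity_degenerates:
  assumes deg: "degenerates p q" and pq: "p \<in> Bil2" "q \<in> Bil2"
    and p: "quadratic_identity c1 c2 c3 c4 d1 d2 d3 d4 p"
  shows "quadratic_identity c1 c2 c3 c4 d1 d2 d3 d4 q"
  unfolding quadratic_identity_def
  by (intro allI degenerates_closed_condition[OF deg pq, where F = "\<lambda>x y z p.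
      c1 * ltr (fst p) (fst p x y) + c2 * ltr (fst p) (snd p x y)
      + c3 * ltr (snd p) (snd p x y) + c4 * rtr (snd p) (snd p x y)
      + d1 * ltr (fst p) x * ltr (fst p) y + d2 * (ltr (fst p) x * ltr (snd p) y + ltr (snd p) x * ltr (fst p) y)
      + d3 * ltr (snd p) x * ltr (snd p) y + d4 * rtr (snd p) x * rtr (snd p) y"] regular_intros regular_ltr_rtr)
    (simp add: ltr_act[OF pq(1)] fst_act snd_act matrix_inv_cancel p[unfolded quadratic_identity_def])

lemma rank_one_identity_degenerates:
  assumes deg: "degenerates p q" and pq: "p \<in> Bil2" "q \<in> Bil2" and p: "rank_one_identity a b c d p"
  shows "rank_one_identity a b c d q"
proof -
  define G where "G x y z p = (a * ltr (fst p) z + b * ltr (snd p) z) *s (c *s fst p x y + d *s snd p x y)" for x y z p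
  have "G x y z (act A p) = A *v G (matrix_inv A *v x) (matrix_inv A *v y) (matrix_inv A *v z) p"
    if "invertible A" for A x y z
    using that
    by (simp add: G_def fst_act snd_act ltr_act[OF pq(1)] matrix_vector_right_distrib vec.scale matrix_inv_cancel)
  moreover have "G x y z p = G z y x p" for x y z
    using p unfolding G_def rank_one_identity_def by blast
  ultimately have "G x y z (act A p) = G z y x (act A p)" if "invertible A" for A x y z
    using that by simp
  then have "G x y z q $ i - G z y x q $ i = 0" for x y z i
    by (intro degenerates_closed_condition[OF deg pq, where F = "\<lambda>x y z p. G x y z p $ i - G z y x p $ i"])
      (simp_all, simp add: G_def, intro regular_intros regular_ltr_rtr)
  then show ?thesis
    unfolding G_def rank_one_identity_def by (simp add: vec2_eq_iff)
qed

lemmas identity_defs = vec_identity_def linear_identity_def quadratic_identity_def rank_one_identity_def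
lemmas basis_simps = ltr_def rtr_def vec2_eq_iff table_nth e1_nth e2_nth

text \<open>Basis vectors yield finitely many equations, enough to determine the admissible
  parameters of the target.\<close>

lemma vec_identity_ball: "vec_identity a1 a2 a3 b c p \<Longrightarrow> \<forall>x\<in>{e1, e2}. \<forall>y\<in>{e1, e2}.
    a1 *s fst p x y + a2 *s snd p x y + a3 *s snd p y x + (b * ltr (fst p) y + c * rtr (snd p) y) *s x = 0"
  by (simp add: vec_identity_def)

lemma linear_identity_ball: "linear_identity a b c p \<Longrightarrow> \<forall>x\<in>{e1, e2}.
    a * ltr (fst p) x + b * ltr (snd p) x + c * rtr (snd p) x = 0"
  by (simp add: linear_identity_def)

lemma quadratic_identity_ball: "quadratic_identity c1 c2 c3 c4 d1 d2 d3 d4 p \<Longrightarrow> \<forall>x\<in>{e1, e2}. \<forall>y\<in>{e1, e2}.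
    c1 * ltr (fst p) (fst p x y) + c2 * ltr (fst p) (snd p x y)
    + c3 * ltr (snd p) (snd p x y) + c4 * rtr (snd p) (snd p x y)
    + d1 * ltr (fst p) x * ltr (fst p) y + d2 * (ltr (fst p) x * ltr (snd p) y + ltr (snd p) x * ltr (fst p) y)
    + d3 * ltr (snd p) x * ltr (snd p) y + d4 * rtr (snd p) x * rtr (snd p) y = 0"
  by (simp add: quadratic_identity_def)

lemma rank_one_identity_ball: "rank_one_identity a b c d p \<Longrightarrow> \<forall>y\<in>{e1, e2}.
    (a * ltr (fst p) e2 + b * ltr (snd p) e2) *s (c *s fst p e1 y + d *s snd p e1 y)
    = (a * ltr (fst p) e1 + b * ltr (snd p) e1) *s (c *s fst p e2 y + d *s snd p e2 y)"
  unfolding rank_one_identity_def by blast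

lemmas vec_identity_basis = vec_identity_ball[unfolded ball_simps simp_thms]
lemma commutative_identity_basis: "vec_identity 0 1 (-1) 0 0 p \<Longrightarrow> snd p e1 e2 = snd p e2 e1"
  by (simp add: vec_identity_def)

lemmas linear_identity_basis = linear_identity_ball[unfolded ball_simps simp_thms]
lemmas quadratic_identity_basis = quadratic_identity_ball[unfolded ball_simps simp_thms]
lemmas rank_one_identity_basis = rank_one_identity_ball[unfolded ball_simps simp_thms]

section \<open>Necessary conditions for degenerations\<close>

lemma N01_degenerates:
  assumes "degenerates (structure_of N01) (structure_of T')"
  shows "T' = N01 \<or> T' = NZero"
proof -
  have i1: "vec_identity 1 0 0 0 0 (structure_of N01)"
    and i2: "linear_identity 0 1 0 (structure_of N01)"
    and i3: "linear_identity 0 0 1 (structure_of N01)"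
    by (simp_all add: identity_defs basis_simps) (simp_all add: algebra_simps power2_eq_square)?
  note D = assms(1) structure_of_in_Bil2 structure_of_in_Bil2
  note I = vec_identity_degenerates[OF D i1, THEN vec_identity_basis]
    linear_identity_degenerates[OF D i2, THEN linear_identity_basis]
    linear_identity_degenerates[OF D i3, THEN linear_identity_basis]
  show ?thesis
    using I
    by (cases T') (simp_all add: basis_simps, (simp add: algebra_simps power2_eq_square)?)
qed

lemma N02_degenerates:
  assumes "degenerates (structure_of N02) (structure_of T')"
  shows "T' = N01 \<or> T' = N02 \<or> T' = NZero"
proof -
  have i1: "vec_identity 1 0 0 0 0 (structure_of N02)"
    and i2: "linear_identity 0 0 1 (structure_of N02)"
    by (simp_all add: identity_defs basis_simps) (simp_all add: algebra_simps power2_eq_square)?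
  note D = assms(1) structure_of_in_Bil2 structure_of_in_Bil2
  note I = vec_identity_degenerates[OF D i1, THEN vec_identity_basis]
    linear_identity_degenerates[OF D i2, THEN linear_identity_basis]
  show ?thesis
    using I
    by (cases T') (simp_all add: basis_simps, (simp add: algebra_simps power2_eq_square)?)
qed

lemma N03_degenerates:
  assumes "degenerates (structure_of N03) (structure_of T')"
  shows "T' = N01 \<or> T' = N03 \<or> T' = N04 \<or> T' = N06 1 \<or> T' = NZero"
proof -
  have i1: "vec_identity 1 0 0 0 0 (structure_of N03)"
    and i2: "vec_identity 0 1 (-1) 0 0 (structure_of N03)"
    by (simp_all add: identity_defs basis_simps) (simp_all add: algebra_simps power2_eq_square)?
  note D = assms(1) structure_of_in_Bil2 structure_of_in_Bil2
  note I = vec_identity_degenerates[OF D i1, THEN vec_identity_basis]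
    vec_identity_degenerates[OF D i2, THEN commutative_identity_basis]
  show ?thesis
    using I
    by (cases T') (simp_all add: basis_simps, (simp add: algebra_simps power2_eq_square)?)
qed

text \<open>Commutativity still allows \<open>N03\<close> and \<open>N06 1\<close>; the rank-one
  identity rules them out.\<close>

lemma N04_degenerates:
  assumes "degenerates (structure_of N04) (structure_of T')"
  shows "T' = N01 \<or> T' = N04 \<or> T' = NZero"
proof -
  have i1: "vec_identity 1 0 0 0 0 (structure_of N04)"
    and i2: "vec_identity 0 1 (-1) 0 0 (structure_of N04)"
    and i3: "rank_one_identity 0 1 0 1 (structure_of N04)"
    by (simp_all add: identity_defs basis_simps) (simp_all add: algebra_simps power2_eq_square)?
  note D = assms(1) structure_of_in_Bil2 structure_of_in_Bil2
  note I = vec_identity_degenerates[OF D i1, THEN vec_identity_basis]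
    vec_identity_degenerates[OF D i2, THEN commutative_identity_basis]
    rank_one_identity_degenerates[OF D i3, THEN rank_one_identity_basis]
  show ?thesis
    using I
    by (cases T') (simp_all add: basis_simps, (simp add: algebra_simps power2_eq_square)?)
qed

lemma N05_degenerates:
  assumes "degenerates (structure_of N05) (structure_of T')"
  shows "T' = N01 \<or> T' = N05 \<or> T' = N06 0 \<or> T' = NZero"
proof -
  have i1: "vec_identity 1 0 0 0 0 (structure_of N05)"
    and i2: "linear_identity 0 2 (-1) (structure_of N05)"
    by (simp_all add: identity_defs basis_simps) (simp_all add: algebra_simps power2_eq_square)?
  note D = assms(1) structure_of_in_Bil2 structure_of_in_Bil2
  note I = vec_identity_degenerates[OF D i1, THEN vec_identity_basis]
    linear_identity_degenerates[OF D i2, THEN linear_identity_basis]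
  show ?thesis
    using I
    by (cases T') (simp_all add: basis_simps, (simp add: algebra_simps power2_eq_square)?)
qed

text \<open>In this algebra the product \<open>x \<circ> y\<close> is a linear form in
  \<open>y\<close> times \<open>x\<close>, and the form is half the trace of right multiplication by
  \<open>y\<close>.\<close>

lemma N06_degenerates_zero:
  assumes "degenerates (structure_of (N06 0)) (structure_of T')"
  shows "T' = N06 0 \<or> T' = NZero"
proof -
  have i1: "vec_identity 1 0 0 0 0 (structure_of (N06 0))"
    and i2: "vec_identity 0 1 0 0 (-(1/2)) (structure_of (N06 0))"
    by (simp_all add: identity_defs basis_simps) (simp_all add: algebra_simps power2_eq_square)?
  note D = assms(1) structure_of_in_Bil2 structure_of_in_Bil2
  note I = vec_identity_degenerates[OF D i1, THEN vec_identity_basis]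
    vec_identity_degenerates[OF D i2, THEN vec_identity_basis]
  show ?thesis
    using I
    by (cases T') (simp_all add: basis_simps, (simp add: algebra_simps power2_eq_square)?)
qed

text \<open>The ratio of the two traces of \<open>\<circ>\<close> determines the parameter. The
  quadratic identity says that half the right trace is multiplicative, which excludes
  \<open>N03\<close> and \<open>N04\<close> when \<open>x = 1\<close>.\<close>

lemma N06_degenerates:
  assumes "degenerates (structure_of (N06 x)) (structure_of T')" and "x \<noteq> 0"
  shows "T' = N01 \<or> T' = N06 x \<or> T' = NZero"
proof -
  have i1: "vec_identity 1 0 0 0 0 (structure_of (N06 x))"
    and i2: "linear_identity 0 2 (-(1 + x)) (structure_of (N06 x))"
    and i3: "quadratic_identity 0 0 0 2 0 0 0 (-1) (structure_of (N06 x))"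
    by (simp_all add: identity_defs basis_simps) (simp_all add: algebra_simps power2_eq_square)?
  note D = assms(1) structure_of_in_Bil2 structure_of_in_Bil2
  note I = vec_identity_degenerates[OF D i1, THEN vec_identity_basis]
    linear_identity_degenerates[OF D i2, THEN linear_identity_basis]
    quadratic_identity_degenerates[OF D i3, THEN quadratic_identity_basis]
  show ?thesis
    using I assms(2)
    by (cases T') (simp_all add: basis_simps, (simp add: algebra_simps power2_eq_square)?)
qed

text \<open>With equal parameters \<open>\<circ>\<close> is \<open>x\<close> times
  \<open>\<cdot>\<close>, and this property alone singles out the admissible targets.\<close>

lemma N07_degenerates_same:
  assumes "degenerates (structure_of (N07 x x)) (structure_of T')"
  shows "T' = N07 x x \<or> T' = N09 x x \<or> T' = N11 x \<or> T' = N14 x \<or> T' = NZero"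
proof -
  have i1: "vec_identity x (-1) 0 0 0 (structure_of (N07 x x))"
    by (simp_all add: identity_defs basis_simps) (simp_all add: algebra_simps power2_eq_square)?
  note D = assms(1) structure_of_in_Bil2 structure_of_in_Bil2
  note I = vec_identity_degenerates[OF D i1, THEN vec_identity_basis]
  show ?thesis
    using I
    by (cases T') (simp_all add: basis_simps, (simp add: algebra_simps power2_eq_square)?)
qed

text \<open>With \<open>t\<close> and \<open>l\<close> the traces of the left multiplications of \<open>\<cdot>\<close> and \<open>\<circ>\<close>, the last identity is the
  polarization of \<open>2 (l(v) - x t(v)) (l(v) - y t(v)) = - (x - y)\<^sup>2 (t(v)\<^sup>2 - t(v \<cdot> v))\<close>; it excludes the
  algebras \<open>N07\<close>, \<open>N08\<close> and \<open>N09\<close> with equal parameters.\<close>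

lemma N07_degenerates:
  assumes "degenerates (structure_of (N07 x y)) (structure_of T')" and "x \<noteq> y"
  shows "T' = N01 \<or> T' = N07 x y \<or> T' = N07 y x \<or> T' = N11 x \<or> T' = N11 y \<or> (\<exists>z. T' = N14 z) \<or> T' = NZero"
proof -
  have i1: "vec_identity 0 1 (-1) 0 0 (structure_of (N07 x y))"
    and i2: "quadratic_identity (x * y) (-(x + y)) 1 0 0 0 0 0 (structure_of (N07 x y))"
    and i3: "quadratic_identity (-((x - y)^2)) 0 0 0 (2 * x * y+ (x - y)^2) (-(x + y)) 2 0 (structure_of (N07 x y))"
    by (simp_all add: identity_defs basis_simps) (simp_all add: algebra_simps power2_eq_square)?
  note D = assms(1) structure_of_in_Bil2 structure_of_in_Bil2
  note I = vec_identity_degenerates[OF D i1, THEN commutative_identity_basis]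
    quadratic_identity_degenerates[OF D i2, THEN quadratic_identity_basis]
    quadratic_identity_degenerates[OF D i3, THEN quadratic_identity_basis]
  \<comment> \<open>The second identity says that \<open>(l - x t)\<close>-type expressions compose
    like \<open>(X - x) (X - y)\<close>; at an idempotent of \<open>\<cdot>\<close> with
    \<open>e1 \<circ> e1 = a e1\<close> it forces \<open>a\<close> to be a root of this
    polynomial.\<close>
  have root: "a = x \<or> a = y" if "a * a + x * y = a * x + a * y" for a
  proof -
    have "(a - x) * (a - y) = 0"
      using that by (simp only: left_diff_distrib right_diff_distrib) (simp add: algebra_simps)
    then show ?thesis
      by simp
  qed
  have no_double: False if "2 * a * a + 2 * x * y = 2 * a * x + 2 * a * y"
    "2 * x * x + 2 * y * y + 4 * x * y + 8 * a * a = 8 * a * x + 8 * a * y" for a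
  proof -
    have "2 * (a * a + x * y) = 2 * (a * x + a * y)"
      using that(1) by (simp only: distrib_left mult.assoc)
    then have "a * a + x * y = a * x + a * y"
      unfolding mult_cancel_left by simp
    then have "a = x \<or> a = y"
      by (rule root)
    then have "2 * x * x + 2 * y * y - 4 * x * y = 0"
      using that(2) by (auto simp: algebra_simps)
    moreover have "(x - y) * (x - y) = (2 * x * x + 2 * y * y - 4 * x * y) / 2"
      by (simp add: field_simps)
    ultimately have "(x - y) * (x - y) = 0"
      by simp
    then show False
      using assms(2) by simp
  qed
  show ?thesis
  proof (cases T')
    case (N07 a b)
    have "a * a + x * y = a * x + a * y" "b * b + x * y = b * x + b * y" "x * x + y * y + 2 * a * b = (a + b) * (x + y)"
      using I unfolding N07 by (simp_all add: basis_simps) (simp_all add: algebra_simps power2_eq_square)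
    then have ab: "a = x \<or> a = y" "b = x \<or> b = y" and sum: "x * x + y * y + 2 * a * b = (a + b) * (x + y)"
      using root by simp_all
    have "(x - y) * (x - y) = 0" if "a = b"
      using ab sum unfolding that by (auto simp: algebra_simps)
    then show ?thesis
      using ab assms(2) N07 by auto
  next
    case (N08 a b)
    then have "b = a"
      using I by (simp add: basis_simps)
    then have "2 * a * a + 2 * x * y = 2 * a * x + 2 * a * y"
      "2 * x * x + 2 * y * y + 4 * x * y + 8 * a * a = 8 * a * x + 8 * a * y"
      using I unfolding N08 by (simp_all add: basis_simps) (simp_all add: algebra_simps power2_eq_square)
    then show ?thesis
      using no_double by blast
  next
    case (N09 a b)
    then have "b = a"
      using I by (simp add: basis_simps)
    then have "2 * a * a + 2 * x * y = 2 * a * x + 2 * a * y"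
      "2 * x * x + 2 * y * y + 4 * x * y + 8 * a * a = 8 * a * x + 8 * a * y"
      using I unfolding N09 by (simp_all add: basis_simps) (simp_all add: algebra_simps power2_eq_square)
    then show ?thesis
      using no_double by blast
  next
    case (N11 a)
    have "a * a + x * y = a * x + a * y"
      using I unfolding N11 by (simp add: basis_simps) (simp add: algebra_simps)
    then show ?thesis
      using N11 root by simp
  qed (use I in \<open>simp_all add: basis_simps\<close>)
qed

text \<open>The two linear identities recover both parameters from the traces wherever the trace of
  \<open>\<cdot>\<close> is not zero. The quadratic one says that half the trace of
  \<open>\<cdot>\<close> is multiplicative, as in a local algebra; it excludes \<open>N07\<close>,
  \<open>N10\<close> and \<open>N11\<close>.\<close>

lemma N08_degenerates:
  assumes "degenerates (structure_of (N08 x y)) (structure_of T')"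
  shows "T' = N01 \<or> T' = N08 x y \<or> T' = N09 x y \<or> (\<exists>z. T' = N14 z) \<or> T' = NZero"
proof -
  have i1: "linear_identity x 0 (-1) (structure_of (N08 x y))"
    and i2: "linear_identity (x + y) (-2) 0 (structure_of (N08 x y))"
    and i3: "quadratic_identity 2 0 0 0 (-1) 0 0 0 (structure_of (N08 x y))"
    by (simp_all add: identity_defs basis_simps) (simp_all add: algebra_simps power2_eq_square)?
  note D = assms(1) structure_of_in_Bil2 structure_of_in_Bil2
  note I = linear_identity_degenerates[OF D i1, THEN linear_identity_basis]
    linear_identity_degenerates[OF D i2, THEN linear_identity_basis]
    quadratic_identity_degenerates[OF D i3, THEN quadratic_identity_basis]
  show ?thesis
    using I
    by (cases T') (simp_all add: basis_simps, (simp add: algebra_simps power2_eq_square)?)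
qed

text \<open>Here \<open>v \<circ> w\<close> equals
  \<open>y (v \<cdot> w) + ((x - y) / 2) t(w) v\<close>, with \<open>t\<close> the trace of
  \<open>\<cdot>\<close>. On targets where \<open>t\<close> vanishes, \<open>\<circ>\<close> is
  therefore \<open>y\<close> times \<open>\<cdot>\<close>, which explains the parameter of
  \<open>N14\<close>.\<close>

lemma N09_degenerates:
  assumes "degenerates (structure_of (N09 x y)) (structure_of T')"
  shows "T' = N09 x y \<or> T' = N14 y \<or> T' = NZero"
proof -
  have i1: "vec_identity y (-1) 0 ((x - y)/2) 0 (structure_of (N09 x y))"
    and i2: "quadratic_identity 2 0 0 0 (-1) 0 0 0 (structure_of (N09 x y))"
    by (simp_all add: identity_defs basis_simps) (simp_all add: algebra_simps power2_eq_square)?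
  note D = assms(1) structure_of_in_Bil2 structure_of_in_Bil2
  note I = vec_identity_degenerates[OF D i1, THEN vec_identity_basis]
    quadratic_identity_degenerates[OF D i2, THEN quadratic_identity_basis]
  show ?thesis
    using I
    by (cases T') (simp_all add: basis_simps, simp add: field_simps)
qed

text \<open>The algebra is a direct sum of two lines: \<open>\<cdot>\<close> lives on the first one
  and \<open>\<circ> - x \<cdot>\<close> on the second. Each of these products is of rank
  one.\<close>

lemma N10_degenerates:
  assumes "degenerates (structure_of (N10 x)) (structure_of T')"
  shows "T' = N01 \<or> T' = N04 \<or> T' = N10 x \<or> T' = N11 x \<or> (\<exists>z. T' = N14 z) \<or> T' = NZero"
proof -
  have i1: "vec_identity 0 1 (-1) 0 0 (structure_of (N10 x))"
    and i2: "rank_one_identity 1 0 1 0 (structure_of (N10 x))"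
    and i3: "rank_one_identity (-x) 1 (-x) 1 (structure_of (N10 x))"
    and i4: "quadratic_identity (-x) 1 0 0 0 0 0 0 (structure_of (N10 x))"
    by (simp_all add: identity_defs basis_simps) (simp_all add: algebra_simps power2_eq_square)?
  note D = assms(1) structure_of_in_Bil2 structure_of_in_Bil2
  note I = vec_identity_degenerates[OF D i1, THEN commutative_identity_basis]
    rank_one_identity_degenerates[OF D i2, THEN rank_one_identity_basis]
    rank_one_identity_degenerates[OF D i3, THEN rank_one_identity_basis]
    quadratic_identity_degenerates[OF D i4, THEN quadratic_identity_basis]
  show ?thesis
    using I
    by (cases T') (simp_all add: basis_simps, (simp add: algebra_simps power2_eq_square)?)
qed

lemma N11_degenerates:
  assumes "degenerates (structure_of (N11 x)) (structure_of T')"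
  shows "T' = N11 x \<or> T' = N14 x \<or> T' = NZero"
proof -
  have i1: "vec_identity x (-1) 0 0 0 (structure_of (N11 x))"
    and i2: "rank_one_identity 1 0 1 0 (structure_of (N11 x))"
    by (simp_all add: identity_defs basis_simps) (simp_all add: algebra_simps power2_eq_square)?
  note D = assms(1) structure_of_in_Bil2 structure_of_in_Bil2
  note I = vec_identity_degenerates[OF D i1, THEN vec_identity_basis]
    rank_one_identity_degenerates[OF D i2, THEN rank_one_identity_basis]
  show ?thesis
    using I
    by (cases T') (simp_all add: basis_simps, (simp add: algebra_simps power2_eq_square)?)
qed

text \<open>The relation between the traces of \<open>\<circ>\<close> is that of \<open>N06\<close>
  with parameter \<open>1 / x\<close>, cleared of the denominator. For \<open>x = 0\<close> it says
  that right traces vanish, as they do in \<open>N02\<close>.\<close>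

lemma N12_degenerates:
  assumes "degenerates (structure_of (N12 x)) (structure_of T')"
  shows "T' = N01 \<or> x = 0 \<and> T' = N02 \<or> x \<noteq> 0 \<and> T' = N06 (inverse x) \<or> T' = N12 x \<or> (\<exists>z. T' = N14 z) \<or> T' = NZero"
proof -
  have i1: "linear_identity 1 0 0 (structure_of (N12 x))"
    and i2: "linear_identity 0 (2 * x) (-(1 + x)) (structure_of (N12 x))"
    and i3: "quadratic_identity 0 0 0 2 0 0 0 (-1) (structure_of (N12 x))"
    by (simp_all add: identity_defs basis_simps) (simp_all add: algebra_simps power2_eq_square)?
  note D = assms(1) structure_of_in_Bil2 structure_of_in_Bil2
  note I = linear_identity_degenerates[OF D i1, THEN linear_identity_basis]
    linear_identity_degenerates[OF D i2, THEN linear_identity_basis]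
    quadratic_identity_degenerates[OF D i3, THEN quadratic_identity_basis]
  have *: "u = 1 / x" if "u * x = 1" for u
    using that by (metis mult_zero_right nonzero_eq_divide_eq zero_neq_one)
  show ?thesis
    using I
    by (cases T') (simp_all add: basis_simps, auto simp: field_simps intro: *)
qed

text \<open>The product \<open>v \<circ> w\<close> is \<open>x (v \<cdot> w)\<close> plus half the
  right trace of \<open>w\<close> times \<open>v\<close>. The two summands survive separately in
  \<open>N14 x\<close> and \<open>N06 0\<close>.\<close>

lemma N13_degenerates:
  assumes "degenerates (structure_of (N13 x)) (structure_of T')"
  shows "T' = N06 0 \<or> T' = N13 x \<or> T' = N14 x \<or> T' = NZero"
proof -
  have i1: "vec_identity x (-1) 0 0 (1/2) (structure_of (N13 x))"
    and i2: "linear_identity 1 0 0 (structure_of (N13 x))"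
    by (simp_all add: identity_defs basis_simps) (simp_all add: algebra_simps power2_eq_square)?
  note D = assms(1) structure_of_in_Bil2 structure_of_in_Bil2
  note I = vec_identity_degenerates[OF D i1, THEN vec_identity_basis]
    linear_identity_degenerates[OF D i2, THEN linear_identity_basis]
  show ?thesis
    using I
    by (cases T') (simp_all add: basis_simps, (simp add: algebra_simps power2_eq_square)?)
qed

lemma N14_degenerates:
  assumes "degenerates (structure_of (N14 x)) (structure_of T')"
  shows "T' = N14 x \<or> T' = NZero"
proof -
  have i1: "vec_identity x (-1) 0 0 0 (structure_of (N14 x))"
    and i2: "linear_identity 1 0 0 (structure_of (N14 x))"
    by (simp_all add: identity_defs basis_simps) (simp_all add: algebra_simps power2_eq_square)?
  note D = assms(1) structure_of_in_Bil2 structure_of_in_Bil2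
  note I = vec_identity_degenerates[OF D i1, THEN vec_identity_basis]
    linear_identity_degenerates[OF D i2, THEN linear_identity_basis]
  show ?thesis
    using I
    by (cases T') (simp_all add: basis_simps, (simp add: algebra_simps power2_eq_square)?)
qed

lemma NZero_degenerates:
  assumes "degenerates (structure_of NZero) (structure_of T')"
  shows "T' = NZero"
proof -
  have i1: "vec_identity 1 0 0 0 0 (structure_of NZero)"
    and i2: "vec_identity 0 1 0 0 0 (structure_of NZero)"
    by (simp_all add: identity_defs basis_simps) (simp_all add: algebra_simps power2_eq_square)?
  note D = assms(1) structure_of_in_Bil2 structure_of_in_Bil2
  note I = vec_identity_degenerates[OF D i1, THEN vec_identity_basis]
    vec_identity_degenerates[OF D i2, THEN vec_identity_basis]
  show ?thesis
    using I
    by (cases T') (simp_all add: basis_simps, (simp add: algebra_simps power2_eq_square)?)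
qed

section \<open>Chains of generating degenerations\<close>

lemmas edge_trancl = tranclp.r_into_trancl[of edge]
lemmas edge_step = tranclp_into_tranclp2[of edge]

lemma edge_trancl_NZero:
  assumes "T \<noteq> NZero"
  shows "edge\<^sup>+\<^sup>+ T NZero"
proof -
  have N01: "edge\<^sup>+\<^sup>+ N01 NZero" and N14: "edge\<^sup>+\<^sup>+ (N14 \<alpha>) NZero" for \<alpha>
    by (auto intro: edge_trancl edge.intros)
  have N06: "edge\<^sup>+\<^sup>+ (N06 \<alpha>) NZero" for \<alpha>
    by (cases "\<alpha> = 0") (auto intro: edge_trancl edge.intros edge_step[OF _ N01])
  have "edge\<^sup>+\<^sup>+ (N11 \<alpha>) NZero" for \<alpha>
    by (rule edge_step[OF _ N14]) (rule edge.intros)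
  then show ?thesis
    using assms N01 N14 N06 by (cases T) (blast intro: edge.intros edge_step)+
qed

lemma edge_trancl_N01:
  assumes "x \<noteq> y"
  shows "edge\<^sup>+\<^sup>+ N02 N01" "edge\<^sup>+\<^sup>+ N03 N01" "edge\<^sup>+\<^sup>+ N04 N01" "edge\<^sup>+\<^sup>+ N05 N01"
    "edge\<^sup>+\<^sup>+ (N07 x y) N01" "edge\<^sup>+\<^sup>+ (N08 \<alpha> \<beta>) N01" "edge\<^sup>+\<^sup>+ (N10 \<alpha>) N01" "edge\<^sup>+\<^sup>+ (N12 \<alpha>) N01"
    "\<gamma> \<noteq> 0 \<Longrightarrow> edge\<^sup>+\<^sup>+ (N06 \<gamma>) N01"
proof -
  show N02: "edge\<^sup>+\<^sup>+ N02 N01" and N04: "edge\<^sup>+\<^sup>+ N04 N01" and "edge\<^sup>+\<^sup>+ N05 N01" and "edge\<^sup>+\<^sup>+ (N07 x y) N01"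
    and "edge\<^sup>+\<^sup>+ (N08 \<alpha> \<beta>) N01"
    using assms by (auto intro: edge_trancl edge.intros)
  show N06: "edge\<^sup>+\<^sup>+ (N06 \<gamma>) N01" if "\<gamma> \<noteq> 0" for \<gamma>
    using that by (auto intro: edge_trancl edge.intros)
  show "edge\<^sup>+\<^sup>+ N03 N01" "edge\<^sup>+\<^sup>+ (N10 \<alpha>) N01"
    by (rule edge_step[OF _ N04], rule edge.intros)+
  show "edge\<^sup>+\<^sup>+ (N12 \<alpha>) N01"
  proof (cases "\<alpha> = 0")
    case True
    then show ?thesis
      using edge_step[OF _ N02] edge.intros by blast
  next
    case False
    then show ?thesis
      by (intro edge_step[OF edge.intros(15) N06]) simp_all
  qed
qed

lemma edge_trancl_N14:
  "edge\<^sup>+\<^sup>+ (N07 x x) (N14 x)" "x \<noteq> y \<Longrightarrow> edge\<^sup>+\<^sup>+ (N07 x y) (N14 \<alpha>)" "edge\<^sup>+\<^sup>+ (N08 x y) (N14 \<alpha>)"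
  "edge\<^sup>+\<^sup>+ (N09 x y) (N14 y)" "edge\<^sup>+\<^sup>+ (N10 x) (N14 \<alpha>)" "edge\<^sup>+\<^sup>+ (N11 x) (N14 x)"
  "edge\<^sup>+\<^sup>+ (N12 x) (N14 \<alpha>)" "edge\<^sup>+\<^sup>+ (N13 x) (N14 x)"
proof -
  show N11: "edge\<^sup>+\<^sup>+ (N11 x) (N14 x)" for x
    by (intro edge_trancl edge.intros)
  show "edge\<^sup>+\<^sup>+ (N07 x x) (N14 x)"
    by (rule edge_step[OF _ N11]) (rule edge.intros)
  show "edge\<^sup>+\<^sup>+ (N10 x) (N14 \<alpha>)"
  proof (cases "\<alpha> = x")
    case True
    then show ?thesis
      using edge_step[OF _ N11] edge.intros by blast
  qed (auto intro: edge_trancl edge.intros)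
qed (auto intro: edge_trancl edge.intros)

text \<open>The exchange of the two idempotents. It is the only coincidence in the list that has to
  be known: every other necessary condition returns the source with its own parameters.\<close>

lemma isomorphic_N07_swap: "isomorphic (structure_of (N07 \<alpha> \<beta>)) (structure_of (N07 \<beta> \<alpha>))"
proof -
  define g :: "V \<Rightarrow> V" where "g x = x $ 2 *s e1 + x $ 1 *s e2" for x
  have g: "g x $ 1 = x $ 2" "g x $ 2 = x $ 1" for x
    by (simp_all add: g_def e1_nth e2_nth)
  have "g (g x) = x" for x
    by (simp add: vec2_eq_iff g)
  then have "bij g"
    by (intro o_bij[of g g]) (simp_all add: fun_eq_iff)
  moreover have "Vector_Spaces.linear (*s) (*s) g"
    unfolding Vector_Spaces.linear_iff by (simp add: vec2_eq_iff g vec.vector_space_axioms)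
  ultimately show ?thesis
    unfolding isomorphic_def by (intro exI[of _ g]) (simp add: vec2_eq_iff g table_nth e1_nth e2_nth)
qed

section \<open>Pulling back polynomial functions to families of matrices\<close>

text \<open>Multiplication by the adjugate of \<open>A\<close>, whose entries are polynomial in
  those of \<open>A\<close>.\<close>

definition adj_vec :: "complex^2^2 \<Rightarrow> V \<Rightarrow> V" where
  "adj_vec A x = vector [A$2$2 * x$1 - A$1$2 * x$2, A$1$1 * x$2 - A$2$1 * x$1]"

lemma adj_vec_nth: "adj_vec A x $ 1 = A$2$2 * x$1 - A$1$2 * x$2" "adj_vec A x $ 2 = A$1$1 * x$2 - A$2$1 * x$1"
  by (simp_all add: adj_vec_def vector2_nth)

lemma matrix_inv_vec:
  assumes "det (A :: complex^2^2) \<noteq> 0"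
  shows "matrix_inv A *v x = inverse (det A) *s adj_vec A x"
proof -
  have "A *v adj_vec A x = det A *s x"
    by (simp add: vec2_eq_iff mat_vec_nth adj_vec_nth det_2 algebra_simps)
  then have "A *v (inverse (det A) *s adj_vec A x) = x"
    using assms by (simp add: vec.scale)
  then have "matrix_inv A *v x = matrix_inv A *v (A *v (inverse (det A) *s adj_vec A x))"
    by simp
  then show ?thesis
    using assms by (simp add: matrix_inv_cancel invertible_det_nz)
qed

text \<open>Each of the two arguments of a bilinear product contributes one inverse determinant,
  whence the square.\<close>

lemma act_coordinate:
  assumes "p \<in> Bil2" "det A \<noteq> 0"
  shows "fst (act A p) x y $ k * det A ^ 2 =
      A$k$1 * fst p (adj_vec A x) (adj_vec A y) $ 1 + A$k$2 * fst p (adj_vec A x) (adj_vec A y) $ 2"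
    "snd (act A p) x y $ k * det A ^ 2 =
      A$k$1 * snd p (adj_vec A x) (adj_vec A y) $ 1 + A$k$2 * snd p (adj_vec A x) (adj_vec A y) $ 2"
  using assms
  by (simp_all add: fst_act snd_act matrix_inv_vec Bil2_linear mat_vec_nth field_simps power2_eq_square)

text \<open>The sets \<open>R e\<close> play the role of functions of degree at most
  \<open>e\<close>. Two instances are needed: polynomials on a line of matrices, where degrees are
  irrelevant, and polynomials in \<open>d\<close> parameters, where they are counted.\<close>

locale function_filtration =
  fixes R :: "nat \<Rightarrow> ('x \<Rightarrow> complex) set" and M :: "'x \<Rightarrow> complex^2^2"
  assumes const: "(\<lambda>x. c) \<in> R 0"
    and add: "f \<in> R e \<Longrightarrow> g \<in> R e \<Longrightarrow> (\<lambda>x. f x + g x) \<in> R e"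
    and mult: "f \<in> R a \<Longrightarrow> g \<in> R b \<Longrightarrow> (\<lambda>x. f x * g x) \<in> R (a + b)"
    and mono: "a \<le> b \<Longrightarrow> R a \<subseteq> R b"
    and entry: "(\<lambda>x. M x $ r $ s) \<in> R 1"
begin

lemma scale: "f \<in> R e \<Longrightarrow> (\<lambda>x. c * f x) \<in> R e"
  using mult[OF const, of f e c] by simp

lemma diff: "f \<in> R e \<Longrightarrow> g \<in> R e \<Longrightarrow> (\<lambda>x. f x - g x) \<in> R e"
  using add[OF _ scale, of f e g "-1"] by simp

lemma power: "f \<in> R e \<Longrightarrow> (\<lambda>x. f x ^ k) \<in> R (k * e)"
  by (induction k) (use const mult[of f e] in simp_all)

lemma det_mem: "(\<lambda>x. det (M x)) \<in> R 2"
  unfolding det_2 using mult[OF entry entry] by (intro diff) (simp_all add: numeral_2_eq_2)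

text \<open>The degree bound is twice the exponent because the determinant has degree two; the
  exponent can then be raised freely.\<close>

definition pullback :: "bilpair \<Rightarrow> nat \<Rightarrow> (bilpair \<Rightarrow> complex) \<Rightarrow> bool" where
  "pullback p e f \<longleftrightarrow> (\<exists>F\<in>R (2 * e). \<forall>x. det (M x) \<noteq> 0 \<longrightarrow> f (act (M x) p) * det (M x) ^ e = F x)"

lemma pullbackI:
  assumes "F \<in> R (2 * e)" "\<And>x. det (M x) \<noteq> 0 \<Longrightarrow> f (act (M x) p) * det (M x) ^ e = F x"
  shows "pullback p e f"
  unfolding pullback_def using assms by (intro bexI[of _ F]) simp_all

lemma pullbackE:
  assumes "pullback p e f"
  obtains F where "F \<in> R (2 * e)" "\<And>x. det (M x) \<noteq> 0 \<Longrightarrow> f (act (M x) p) * det (M x) ^ e = F x"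
  using assms unfolding pullback_def by (elim bexE) simp

lemma pullback_mult:
  assumes "pullback p a f" "pullback p b g"
  shows "pullback p (a + b) (\<lambda>q. f q * g q)"
proof -
  from assms(1) obtain F where F: "F \<in> R (2 * a)" "\<And>x. det (M x) \<noteq> 0 \<Longrightarrow> f (act (M x) p) * det (M x) ^ a = F x"
    by (rule pullbackE) (rule that)
  from assms(2) obtain G where G: "G \<in> R (2 * b)" "\<And>x. det (M x) \<noteq> 0 \<Longrightarrow> g (act (M x) p) * det (M x) ^ b = G x"
    by (rule pullbackE) (rule that)
  show ?thesis
  proof (rule pullbackI)
    show "(\<lambda>x. F x * G x) \<in> R (2 * (a + b))"
      using mult[OF F(1) G(1)] by (simp add: distrib_left)
  qed (simp add: F(2)[symmetric] G(2)[symmetric] power_add)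
qed

lemma pullback_const: "pullback p 0 (\<lambda>q. c)"
  by (rule pullbackI[of "\<lambda>x. c"]) (simp_all add: const)

lemma pullback_mono:
  assumes "pullback p a f" "a \<le> b"
  shows "pullback p b f"
proof -
  from assms(1) obtain F where F: "F \<in> R (2 * a)" "\<And>x. det (M x) \<noteq> 0 \<Longrightarrow> f (act (M x) p) * det (M x) ^ a = F x"
    by (rule pullbackE) (rule that)
  have b: "2 * a + (b - a) * 2 = 2 * b" "b = a + (b - a)"
    using assms(2) by simp_all
  show ?thesis
  proof (rule pullbackI)
    show "(\<lambda>x. F x * det (M x) ^ (b - a)) \<in> R (2 * b)"
      using mult[OF F(1) power[OF det_mem, of "b - a"]] unfolding b(1) .
    show "f (act (M x) p) * det (M x) ^ b = F x * det (M x) ^ (b - a)" if "det (M x) \<noteq> 0" for x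
      using F(2)[OF that] by (subst b(2)) (simp only: power_add mult.assoc[symmetric])
  qed
qed

lemma pullback_add:
  assumes "pullback p a f" "pullback p b g"
  shows "pullback p (max a b) (\<lambda>q. f q + g q)"
proof -
  from pullback_mono[OF assms(1) max.cobounded1[of a b]] obtain F where F: "F \<in> R (2 * max a b)"
    "\<And>x. det (M x) \<noteq> 0 \<Longrightarrow> f (act (M x) p) * det (M x) ^ max a b = F x"
    by (rule pullbackE) (rule that)
  from pullback_mono[OF assms(2) max.cobounded2[of b a]] obtain G where G: "G \<in> R (2 * max a b)"
    "\<And>x. det (M x) \<noteq> 0 \<Longrightarrow> g (act (M x) p) * det (M x) ^ max a b = G x"
    by (rule pullbackE) (rule that)
  show ?thesis
    by (rule pullbackI[OF add[OF F(1) G(1)]]) (simp add: F(2) G(2) distrib_right)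
qed

lemma pullback_power: "pullback p a f \<Longrightarrow> pullback p (k * a) (\<lambda>q. f q ^ k)"
  by (induction k) (use pullback_const pullback_mult[of p a f] in simp_all)

lemma pullback_prod:
  assumes "finite I" "\<And>i. i \<in> I \<Longrightarrow> pullback p (a i) (f i)"
  shows "pullback p (\<Sum>i\<in>I. a i) (\<lambda>q. \<Prod>i\<in>I. f i q)"
  using assms by (induction I) (simp_all add: pullback_const pullback_mult)

lemma adj_vec_mem: "(\<lambda>x. adj_vec (M x) v $ i) \<in> R 1"
proof -
  have "(\<lambda>x. M x $ r $ s * c) \<in> R 1" for r s c
    using scale[OF entry, of c] by (simp add: mult.commute)
  then show ?thesis
    using exhaust_2[of i] by (auto simp: adj_vec_nth diff)
qed

lemma bilinear_adj_vec_mem: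
  assumes "p \<in> Bil2"
  shows "(\<lambda>x. M x $ r $ s * fst p (adj_vec (M x) u) (adj_vec (M x) v) $ l) \<in> R 3"
    "(\<lambda>x. M x $ r $ s * snd p (adj_vec (M x) u) (adj_vec (M x) v) $ l) \<in> R 3"
proof -
  have 1: "(\<lambda>x. adj_vec (M x) u $ i * adj_vec (M x) v $ j * c) \<in> R 2" for i j c
    using scale[OF mult[OF adj_vec_mem adj_vec_mem], of c] by (simp add: numeral_2_eq_2 mult.commute)
  have "(\<lambda>x. table a b c d (adj_vec (M x) u) (adj_vec (M x) v) $ l) \<in> R 2" for a b c d
    unfolding table_nth by (intro add 1)
  from mult[OF entry this]
  show "(\<lambda>x. M x $ r $ s * fst p (adj_vec (M x) u) (adj_vec (M x) v) $ l) \<in> R 3"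
    "(\<lambda>x. M x $ r $ s * snd p (adj_vec (M x) u) (adj_vec (M x) v) $ l) \<in> R 3"
    unfolding Bil2_expand[OF assms, of "adj_vec _ _"] by (simp_all add: numeral_3_eq_3)
qed

lemma pullback_polyfun:
  assumes "polyfun f" "p \<in> Bil2"
  shows "\<exists>e. pullback p e f"
  using assms(1)
proof induction
  case (const c)
  show ?case
    using pullback_const by (rule exI)
next
  case (coord_fst i j k)
  let ?F = "\<lambda>x. M x $ k $ 1 * fst p (adj_vec (M x) (axis i 1)) (adj_vec (M x) (axis j 1)) $ 1
     + M x $ k $ 2 * fst p (adj_vec (M x) (axis i 1)) (adj_vec (M x) (axis j 1)) $ 2"
  have "?F \<in> R 3"
    by (rule add; rule bilinear_adj_vec_mem[OF assms(2)])
  \<comment> \<open>One degree comes from the matrix entry and one from each adjugate factor; three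
    is rounded up to twice the exponent of the determinant.\<close>
  then have F: "?F \<in> R (2 * 2)"
    by (rule subsetD[OF mono, rotated]) simp
  have "pullback p 2 (\<lambda>q. fst q (axis i 1) (axis j 1) $ k)"
    by (rule pullbackI[OF F]) (rule act_coordinate[OF assms(2)])
  then show ?case
    by (rule exI)
next
  case (coord_snd i j k)
  let ?F = "\<lambda>x. M x $ k $ 1 * snd p (adj_vec (M x) (axis i 1)) (adj_vec (M x) (axis j 1)) $ 1
     + M x $ k $ 2 * snd p (adj_vec (M x) (axis i 1)) (adj_vec (M x) (axis j 1)) $ 2"
  have "?F \<in> R 3"
    by (rule add; rule bilinear_adj_vec_mem[OF assms(2)])
  then have F: "?F \<in> R (2 * 2)"
    by (rule subsetD[OF mono, rotated]) simp
  have "pullback p 2 (\<lambda>q. snd q (axis i 1) (axis j 1) $ k)"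
    by (rule pullbackI[OF F]) (rule act_coordinate[OF assms(2)])
  then show ?case
    by (rule exI)
next
  case (add f g)
  then show ?case
    by (elim exE) (rule exI, rule pullback_add)
next
  case (mult f g)
  then show ?case
    by (elim exE) (rule exI, rule pullback_mult)
qed

end

section \<open>Lines of matrices\<close>

definition matrix_line :: "complex^2^2 \<Rightarrow> complex^2^2 \<Rightarrow> complex \<Rightarrow> complex^2^2" where
  "matrix_line A B t = (\<chi> i j. A$i$j + t * (B$i$j - A$i$j))"

lemma matrix_line_nth: "matrix_line A B t $ i $ j = A$i$j + t * (B$i$j - A$i$j)"
  by (simp add: matrix_line_def)

lemma matrix_line_ends: "matrix_line A B 0 = A" "matrix_line A B 1 = B"
  by (simp_all add: matrix_line_def vec_eq_iff)

text \<open>Exponent and polynomial may depend on the line. The notion covers both functions on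
  translates and single matrix entries, which are combined in the density argument.\<close>

definition line_regular :: "(complex^2^2 \<Rightarrow> complex) \<Rightarrow> bool" where
  "line_regular h \<longleftrightarrow> (\<forall>A B. \<exists>e q. \<forall>t. det (matrix_line A B t) \<noteq> 0 \<longrightarrow>
     h (matrix_line A B t) * det (matrix_line A B t) ^ e = poly q t)"

interpretation line: function_filtration "\<lambda>e. range poly" "matrix_line A B" for A B
proof
  show "(\<lambda>t. c) \<in> range poly" for c :: complex
    by (rule range_eqI[of _ _ "[:c:]"]) auto
  show "(\<lambda>t. f t + g t) \<in> range poly" if fg: "f \<in> range poly" "g \<in> range poly" for f g :: "complex \<Rightarrow> complex"
  proof -
    obtain a b where "f = poly a" "g = poly b"
      using fg by blast
    then show ?thesis
      by (intro range_eqI[of _ _ "a + b"]) auto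
  qed
  show "(\<lambda>t. f t * g t) \<in> range poly" if fg: "f \<in> range poly" "g \<in> range poly" for f g :: "complex \<Rightarrow> complex"
  proof -
    obtain a b where "f = poly a" "g = poly b"
      using fg by blast
    then show ?thesis
      by (intro range_eqI[of _ _ "a * b"]) auto
  qed
  show "(\<lambda>t. matrix_line A B t $ r $ s) \<in> range poly" for r s
    by (rule range_eqI[of _ _ "[:A$r$s, B$r$s - A$r$s:]"]) (auto simp: matrix_line_nth)
qed simp

lemma line_regular_polyfun:
  assumes "polyfun f" "p \<in> Bil2"
  shows "line_regular (\<lambda>A. f (act A p))"
  unfolding line_regular_def
proof (intro allI)
  fix A B
  show "\<exists>e q. \<forall>t. det (matrix_line A B t) \<noteq> 0 \<longrightarrow>
     f (act (matrix_line A B t) p) * det (matrix_line A B t) ^ e = poly q t"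
    using line.pullback_polyfun[OF assms, of A B] unfolding line.pullback_def by blast
qed

lemma line_regular_entry: "line_regular (\<lambda>A. A $ r $ s)"
  unfolding line_regular_def
proof (intro allI)
  fix A B
  show "\<exists>e q. \<forall>t. det (matrix_line A B t) \<noteq> 0 \<longrightarrow>
     matrix_line A B t $ r $ s * det (matrix_line A B t) ^ e = poly q t"
    by (intro exI[of _ 0] exI[of _ "[:A$r$s, B$r$s - A$r$s:]"]) (simp add: matrix_line_nth)
qed

text \<open>The determinant and the two cleared functions are nonzero polynomials in
  \<open>t\<close>, as their values at an end of the line show, so finitely many \<open>t\<close>
  are excluded. This is the source of irreducibility and of density.\<close>

lemma line_regular_common_point:
  assumes "line_regular h" "line_regular k" "invertible A" "invertible B" "h A \<noteq> 0" "k B \<noteq> 0"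
  obtains t where "invertible (matrix_line A B t)" "h (matrix_line A B t) \<noteq> 0" "k (matrix_line A B t) \<noteq> 0"
proof -
  let ?M = "matrix_line A B"
  obtain e q e' q' where q: "\<And>t. det (?M t) \<noteq> 0 \<Longrightarrow> h (?M t) * det (?M t) ^ e = poly q t"
    and q': "\<And>t. det (?M t) \<noteq> 0 \<Longrightarrow> k (?M t) * det (?M t) ^ e' = poly q' t"
    using assms(1,2) unfolding line_regular_def by meson
  obtain d where d: "\<And>t. det (?M t) = poly d t"
    using line.det_mem[of A B] by (auto simp: fun_eq_iff)
  have ends: "det A \<noteq> 0" "det B \<noteq> 0"
    using assms(3,4) by (simp_all add: invertible_det_nz)
  have "poly d 0 \<noteq> 0" "poly q 0 \<noteq> 0" "poly q' 1 \<noteq> 0"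
    using q[of 0] q'[of 1] d[of 0] ends assms(5,6) by (auto simp: matrix_line_ends)
  then have "q * q' * d \<noteq> 0"
    by auto
  then have "finite {t. poly (q * q' * d) t = 0}"
    by (rule poly_roots_finite)
  then obtain t where "poly (q * q' * d) t \<noteq> 0"
    using infinite_UNIV_char_0 by (metis (mono_tags, lifting) ex_new_if_finite mem_Collect_eq)
  then have "poly q t \<noteq> 0" "poly q' t \<noteq> 0" "det (?M t) \<noteq> 0"
    by (simp_all add: d)
  then show ?thesis
    using q[of t] q'[of t] by (intro that[of t]) (auto simp: invertible_det_nz)
qed

section \<open>Linear dependence of functions\<close>

interpretation funspace: vector_space "\<lambda>(c :: complex) (f :: 'x \<Rightarrow> complex). (\<lambda>x. c * f x)"
  by unfold_locales (auto simp: fun_eq_iff algebra_simps)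

text \<open>The relation is indexed by \<open>I\<close> rather than by the functions: if two indices
  give the same function, their difference is already a relation.\<close>

lemma functions_dependent:
  fixes g :: "'i \<Rightarrow> 'x \<Rightarrow> complex"
  assumes "finite I" "finite T" "card T < card I" "\<And>i. i \<in> I \<Longrightarrow> g i \<in> funspace.span T"
  obtains c where "\<exists>i\<in>I. c i \<noteq> 0" "\<And>x. (\<Sum>i\<in>I. c i * g i x) = 0"
proof (cases "inj_on g I")
  case True
  have sum_apply: "(\<Sum>i\<in>J. F i) x = (\<Sum>i\<in>J. F i x)" for J :: "('x \<Rightarrow> complex) set" and F :: "_ \<Rightarrow> 'x \<Rightarrow> complex" and x
    by (induction J rule: infinite_finite_induct) auto
  have "card (g ` I) = card I"
    using True by (rule card_image)
  then have "funspace.dependent (g ` I)"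
    using funspace.independent_span_bound[of T "g ` I"] assms by fastforce
  then obtain u where u: "\<exists>v\<in>g ` I. u v \<noteq> 0" "(\<Sum>v\<in>g ` I. (\<lambda>x. u v * v x)) = 0"
    using assms(1) by (auto simp: funspace.dependent_finite)
  have "(\<Sum>i\<in>I. u (g i) * g i x) = 0" for x
  proof -
    have "(\<Sum>v\<in>g ` I. u v * v x) = (\<Sum>v\<in>g ` I. (\<lambda>x. u v * v x)) x"
      by (rule sum_apply[symmetric])
    then show ?thesis
      by (simp add: u(2) sum.reindex[OF True])
  qed
  then show ?thesis
    using u(1) by (intro that[of "\<lambda>i. u (g i)"]) auto
next
  case False
  then obtain i j where ij: "i \<in> I" "j \<in> I" "i \<noteq> j" "g i = g j"
    unfolding inj_on_def by blast
  let ?c = "\<lambda>k. if k = i then 1 else if k = j then -1 else 0 :: complex"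
  have "(\<Sum>k\<in>I. ?c k * g k x) = (\<Sum>k\<in>{i, j}. ?c k * g k x)" for x
    using ij assms(1) by (intro sum.mono_neutral_right) auto
  then show ?thesis
    using ij by (intro that[of ?c]) auto
qed

section \<open>Polynomials of bounded degree in finitely many parameters\<close>

text \<open>Bounding each exponent separately, instead of the total degree, makes the count an
  immediate power.\<close>

definition monomials :: "nat \<Rightarrow> nat \<Rightarrow> ((nat \<Rightarrow> complex) \<Rightarrow> complex) set" where
  "monomials d N = (\<lambda>a x. \<Prod>i<d. x i ^ a i) ` ({..<d} \<rightarrow>\<^sub>E {..N})"

lemma finite_monomials: "finite (monomials d N)"
  unfolding monomials_def by (intro finite_imageI finite_PiE) auto

lemma card_monomials: "card (monomials d N) \<le> (N + 1) ^ d"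
  using card_image_le[of "{..<d} \<rightarrow>\<^sub>E {..N}" "\<lambda>a x. \<Prod>i<d. x i ^ a i"]
  by (simp add: monomials_def finite_PiE card_PiE)

lemma monomials_mult:
  assumes "f \<in> monomials d N" "g \<in> monomials d N'"
  shows "(\<lambda>x. f x * g x) \<in> monomials d (N + N')"
proof -
  obtain a b where a: "a \<in> {..<d} \<rightarrow>\<^sub>E {..N}" "f = (\<lambda>x. \<Prod>i<d. x i ^ a i)"
    and b: "b \<in> {..<d} \<rightarrow>\<^sub>E {..N'}" "g = (\<lambda>x. \<Prod>i<d. x i ^ b i)"
    using assms unfolding monomials_def by blast
  have "(\<lambda>i\<in>{..<d}. a i + b i) \<in> {..<d} \<rightarrow>\<^sub>E {..N + N'}"
    using a(1) b(1) by (auto simp: PiE_iff intro!: add_mono)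
  moreover have "(\<lambda>x. f x * g x) = (\<lambda>x. \<Prod>i<d. x i ^ (\<lambda>i\<in>{..<d}. a i + b i) i)"
    by (auto simp: a(2) b(2) fun_eq_iff prod.distrib[symmetric] power_add intro!: prod.cong)
  ultimately show ?thesis
    unfolding monomials_def by blast
qed

lemma span_monomials_mult:
  assumes "f \<in> funspace.span (monomials d N)" "g \<in> funspace.span (monomials d N')"
  shows "(\<lambda>x. f x * g x) \<in> funspace.span (monomials d (N + N'))"
proof -
  have 1: "(\<lambda>x. f x * g x) \<in> funspace.span (monomials d (N + N'))"
    if "f \<in> monomials d N" "g \<in> funspace.span (monomials d N')" for f g
    using that(2)
  proof (induction rule: funspace.span_induct_alt)
    case base
    then show ?case
      using funspace.span_zero by (simp add: zero_fun_def)
  next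
    case (step c h k)
    have "(\<lambda>x. f x * ((\<lambda>x. c * h x) + k) x) = (\<lambda>x. c * (f x * h x)) + (\<lambda>x. f x * k x)"
      by (simp add: fun_eq_iff algebra_simps)
    then show ?case
      using funspace.span_add[OF funspace.span_scale[OF funspace.span_base[OF monomials_mult[OF that(1) step(1)]]] step(2)]
      by (simp only:)
  qed
  show ?thesis
    using assms(1)
  proof (induction rule: funspace.span_induct_alt)
    case base
    then show ?case
      using funspace.span_zero by (simp add: zero_fun_def)
  next
    case (step c h k)
    have "(\<lambda>x. ((\<lambda>x. c * h x) + k) x * g x) = (\<lambda>x. c * (h x * g x)) + (\<lambda>x. k x * g x)"
      by (simp add: fun_eq_iff algebra_simps)
    then show ?case
      using funspace.span_add[OF funspace.span_scale[OF 1[OF step(1) assms(2)]] step(2)] by (simp only:)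
  qed
qed

lemma monomials_mono: "a \<le> b \<Longrightarrow> monomials d a \<subseteq> monomials d b"
  unfolding monomials_def by (intro image_mono PiE_mono) auto

lemma function_filtration_monomials:
  assumes "\<And>r s. (\<lambda>x. M x $ r $ s) \<in> funspace.span (monomials d 1)"
  shows "function_filtration (\<lambda>e. funspace.span (monomials d e)) M"
proof
  have "(\<lambda>x. 1) \<in> monomials d 0"
    unfolding monomials_def by (intro image_eqI[of _ _ "\<lambda>i\<in>{..<d}. 0"]) (auto simp: fun_eq_iff)
  from funspace.span_scale[OF funspace.span_base[OF this]]
  show "(\<lambda>x. c) \<in> funspace.span (monomials d 0)" for c :: complex
    by simp
  show "(\<lambda>x. f x + g x) \<in> funspace.span (monomials d e)"
    if "f \<in> funspace.span (monomials d e)" "g \<in> funspace.span (monomials d e)" for f g e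
    using funspace.span_add[OF that] by (simp add: plus_fun_def)
  show "(\<lambda>x. M x $ r $ s) \<in> funspace.span (monomials d 1)" for r s
    by (rule assms)
qed (auto intro: span_monomials_mult subsetD[OF funspace.span_mono[OF monomials_mono]])

section \<open>Chains of irreducible closed subsets of an orbit\<close>

lemma polyfun_minus_const: "polyfun f \<Longrightarrow> polyfun (\<lambda>q. f q - c)"
  using polyfun.add[OF _ polyfun.const[of "- c"], of f] by simp

lemma polyfun_power: "polyfun f \<Longrightarrow> polyfun (\<lambda>q. f q ^ k)"
  by (induction k) (use polyfun.const polyfun.mult in auto)

lemma polyfun_prod: "finite I \<Longrightarrow> (\<And>i. i \<in> I \<Longrightarrow> polyfun (f i)) \<Longrightarrow> polyfun (\<lambda>q. \<Prod>i\<in>I. f i q)"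
  by (induction I rule: finite_induct) (use polyfun.const polyfun.mult in auto)

lemma polyfun_sum: "finite I \<Longrightarrow> (\<And>i. i \<in> I \<Longrightarrow> polyfun (f i)) \<Longrightarrow> polyfun (\<lambda>q. \<Sum>i\<in>I. f i q)"
  by (induction I rule: finite_induct) (use polyfun.const polyfun.add in auto)

lemma closedin_orbit:
  assumes "p \<in> Bil2"
  shows "closedin (subtopology zariski (orbit p)) Z \<longleftrightarrow>
    (\<exists>F. (\<forall>f\<in>F. polyfun f) \<and> Z = {q \<in> orbit p. \<forall>f\<in>F. f q = 0})"
proof
  assume "closedin (subtopology zariski (orbit p)) Z"
  then obtain C where "algebraic_set C" "Z = C \<inter> orbit p"
    unfolding closedin_subtopology closedin_zariski by (elim exE conjE) (rule that)
  then obtain F where "\<forall>f\<in>F. polyfun f" "Z = {q \<in> Bil2. \<forall>f\<in>F. f q = 0} \<inter> orbit p"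
    unfolding algebraic_set_def by (elim exE conjE) simp
  moreover have "{q \<in> Bil2. \<forall>f\<in>F. f q = 0} \<inter> orbit p = {q \<in> orbit p. \<forall>f\<in>F. f q = 0}"
    using orbit_subset_Bil2[OF assms] by auto
  ultimately show "\<exists>F. (\<forall>f\<in>F. polyfun f) \<and> Z = {q \<in> orbit p. \<forall>f\<in>F. f q = 0}"
    by (intro exI[of _ F]) simp
next
  assume "\<exists>F. (\<forall>f\<in>F. polyfun f) \<and> Z = {q \<in> orbit p. \<forall>f\<in>F. f q = 0}"
  then obtain F where F: "\<forall>f\<in>F. polyfun f" "Z = {q \<in> orbit p. \<forall>f\<in>F. f q = 0}"
    by (elim exE conjE) (rule that)
  have "algebraic_set {q \<in> Bil2. \<forall>f\<in>F. f q = 0}"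
    unfolding algebraic_set_def by (intro exI[of _ F] conjI F(1) refl)
  moreover have "Z = {q \<in> Bil2. \<forall>f\<in>F. f q = 0} \<inter> orbit p"
    using orbit_subset_Bil2[OF assms] unfolding F(2) by auto
  ultimately show "closedin (subtopology zariski (orbit p)) Z"
    unfolding closedin_subtopology closedin_zariski by (intro exI conjI)
qed

text \<open>Irreducibility as primality of the vanishing ideal: the zero sets of \<open>f\<close>
  and \<open>g\<close> in \<open>Z\<close> are closed and cover it.\<close>

lemma irreducible_closed_orbit_prime:
  assumes p: "p \<in> Bil2" and Z: "irreducible_closed (subtopology zariski (orbit p)) Z"
    and f: "polyfun f" and g: "polyfun g" and fg: "\<And>q. q \<in> Z \<Longrightarrow> f q * g q = 0"
  shows "(\<forall>q\<in>Z. f q = 0) \<or> (\<forall>q\<in>Z. g q = 0)"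
proof -
  let ?X = "subtopology zariski (orbit p)"
  have "closedin ?X Z"
    using Z unfolding irreducible_closed_def by blast
  then obtain F where F: "\<forall>f\<in>F. polyfun f" "Z = {q \<in> orbit p. \<forall>f\<in>F. f q = 0}"
    unfolding closedin_orbit[OF p] by (elim exE conjE) (rule that)
  have cl: "closedin ?X {q \<in> Z. h q = 0}" if "polyfun h" for h
  proof -
    have "{q \<in> Z. h q = 0} = {q \<in> orbit p. \<forall>f\<in>insert h F. f q = 0}"
      unfolding F(2) by auto
    then show ?thesis
      unfolding closedin_orbit[OF p] using F(1) that by (intro exI[of _ "insert h F"]) simp
  qed
  have "Z = {q \<in> Z. f q = 0} \<union> {q \<in> Z. g q = 0}"
    using fg by auto
  then have "Z = {q \<in> Z. f q = 0} \<or> Z = {q \<in> Z. g q = 0}"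
    using Z cl[OF f] cl[OF g] unfolding irreducible_closed_def by blast
  then show ?thesis
    by blast
qed

lemma separating_polyfun:
  assumes p: "p \<in> Bil2" and Z: "closedin (subtopology zariski (orbit p)) Z"
    and Z': "closedin (subtopology zariski (orbit p)) Z'" and less: "Z \<subset> Z'"
  obtains f where "polyfun f" "\<forall>q\<in>Z. f q = 0" "\<exists>q\<in>Z'. f q \<noteq> 0"
proof -
  obtain F where F: "\<forall>f\<in>F. polyfun f" "Z = {q \<in> orbit p. \<forall>f\<in>F. f q = 0}"
    using Z unfolding closedin_orbit[OF p] by (elim exE conjE) (rule that)
  obtain q where q: "q \<in> Z'" "q \<notin> Z"
    using less by blast
  then have "q \<in> orbit p"
    using closedin_subset[OF Z'] by (auto simp: topspace_subtopology)
  then obtain f where "f \<in> F" "f q \<noteq> 0"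
    using q(2) F(2) by auto
  then show ?thesis
    using F q(1) by (intro that[of f]) auto
qed

text \<open>A relation may be divided by a power of the last function on the irreducible last member of the chain;
  restricting it to the previous member, on which that function vanishes, then leaves a shorter relation.\<close>

lemma separating_monomials_independent:
  fixes Z :: "nat \<Rightarrow> bilpair set" and f :: "nat \<Rightarrow> bilpair \<Rightarrow> complex"
  assumes p: "p \<in> Bil2" and Z: "\<And>i. i \<le> n \<Longrightarrow> irreducible_closed (subtopology zariski (orbit p)) (Z i)"
    and sub: "\<And>i. i < n \<Longrightarrow> Z i \<subseteq> Z (Suc i)"
    and poly: "\<And>i. i < n \<Longrightarrow> polyfun (f i)"
    and zero: "\<And>i q. i < n \<Longrightarrow> q \<in> Z i \<Longrightarrow> f i q = 0"
    and nonzero: "\<And>i. i < n \<Longrightarrow> \<exists>q\<in>Z (Suc i). f i q \<noteq> 0"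
    and dep: "\<And>q. q \<in> Z n \<Longrightarrow> (\<Sum>a\<in>{..<n} \<rightarrow>\<^sub>E {..K}. c a * (\<Prod>i<n. f i q ^ a i)) = 0"
    and a: "a \<in> {..<n} \<rightarrow>\<^sub>E {..K}"
  shows "c a = 0"
  using assms(2-)
proof (induction n arbitrary: c a)
  case 0
  have "Z 0 \<noteq> {}"
    using 0(1)[of 0] unfolding irreducible_closed_def by simp
  then obtain q where "q \<in> Z 0"
    by blast
  then show ?case
    using 0(6)[of q] 0(7) by simp
next
  case (Suc n)
  let ?I = "{..<n} \<rightarrow>\<^sub>E {..K}"
  \<comment> \<open>\<open>S k\<close> is the coefficient of the \<open>k\<close>-th power of
    \<open>f n\<close> in the relation and involves only the earlier functions, so the induction
    hypothesis applies to it on \<open>Z n\<close>.\<close>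
  define S where "S k q = (\<Sum>b\<in>?I. c (b(n := k)) * (\<Prod>i<n. f i q ^ b i))" for k q
  have fin: "finite ?I"
    by (intro finite_PiE) auto
  have polyS: "polyfun (S k)" for k
    unfolding S_def
    by (intro polyfun_sum fin polyfun.mult polyfun.const polyfun_prod polyfun_power Suc.prems(3)) simp_all
  have decomp: "(\<Sum>a\<in>{..<Suc n} \<rightarrow>\<^sub>E {..K}. c a * (\<Prod>i<Suc n. f i q ^ a i)) = (\<Sum>k\<le>K. S k q * f n q ^ k)" for q
  proof -
    have inj: "inj_on (\<lambda>(k, b). b(n := k)) ({..K} \<times> ?I)"
      using inj_combinator[of n "{..<n}" "\<lambda>_. {..K}"] by simp
    have img: "{..<Suc n} \<rightarrow>\<^sub>E {..K} = (\<lambda>(k, b). b(n := k)) ` ({..K} \<times> ?I)"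
      unfolding lessThan_Suc PiE_insert_eq ..
    have "(\<Sum>a\<in>{..<Suc n} \<rightarrow>\<^sub>E {..K}. c a * (\<Prod>i<Suc n. f i q ^ a i))
      = (\<Sum>(k, b)\<in>{..K} \<times> ?I. c (b(n := k)) * (\<Prod>i<Suc n. f i q ^ (b(n := k)) i))"
      unfolding img sum.reindex[OF inj] by (simp add: split_beta o_def)
    also have "\<dots> = (\<Sum>k\<le>K. \<Sum>b\<in>?I. c (b(n := k)) * (\<Prod>i<Suc n. f i q ^ (b(n := k)) i))"
      by (rule sum.cartesian_product[symmetric])
    also have "\<dots> = (\<Sum>k\<le>K. S k q * f n q ^ k)"
      unfolding S_def sum_distrib_right
    proof (intro sum.cong refl)
      fix k b
      have "(\<Prod>i<n. f i q ^ (b(n := k)) i) = (\<Prod>i<n. f i q ^ b i)"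
        by (intro prod.cong) auto
      then show "c (b(n := k)) * (\<Prod>i<Suc n. f i q ^ (b(n := k)) i) = c (b(n := k)) * (\<Prod>i<n. f i q ^ b i) * f n q ^ k"
        by (simp add: mult.assoc)
    qed
    finally show ?thesis .
  qed
  have main: "\<forall>b\<in>?I. c (b(n := k)) = 0" if "k \<le> K" for k
    using that
  proof (induction k rule: less_induct)
    case (less k)
    have S0: "S j q = 0" if "j < k" for j q
    proof -
      have "\<forall>b\<in>?I. c (b(n := j)) = 0"
        by (rule less.IH[OF that]) (use less.prems that in simp)
      then show ?thesis
        unfolding S_def by (intro sum.neutral ballI) (simp only: mult_zero_left)
    qed
    let ?T = "\<lambda>q. \<Sum>j\<in>{k..K}. S j q * f n q ^ (j - k)"
    have "f n q ^ k * ?T q = 0" if "q \<in> Z (Suc n)" for q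
    proof -
      have "f n q ^ k * ?T q = (\<Sum>j\<in>{k..K}. S j q * f n q ^ j)"
        unfolding sum_distrib_left
        by (intro sum.cong refl) (simp add: power_add[symmetric] mult.left_commute)
      also have "\<dots> = (\<Sum>j\<le>K. S j q * f n q ^ j)"
        by (intro sum.mono_neutral_left) (auto simp: S0 not_le)
      also have "\<dots> = 0"
        using Suc.prems(6)[OF that] unfolding decomp .
      finally show ?thesis .
    qed
    moreover have "polyfun (f n)"
      by (rule Suc.prems(3)) simp
    moreover have "polyfun ?T"
      using \<open>polyfun (f n)\<close> by (intro polyfun_sum polyfun.mult polyS polyfun_power) simp_all
    ultimately have "(\<forall>q\<in>Z (Suc n). f n q ^ k = 0) \<or> (\<forall>q\<in>Z (Suc n). ?T q = 0)"
      by (intro irreducible_closed_orbit_prime[OF p Suc.prems(1)] polyfun_power) simp_all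
    moreover have "\<not> (\<forall>q\<in>Z (Suc n). f n q ^ k = 0)"
      using Suc.prems(5)[of n] by auto
    ultimately have T: "?T q = 0" if "q \<in> Z (Suc n)" for q
      using that by blast
    have "S k q = 0" if "q \<in> Z n" for q
    proof -
      have "?T q = 0"
        using T Suc.prems(2)[of n] that by blast
      moreover have "?T q = S k q"
        using less.prems Suc.prems(4)[of n q] that
        by (subst sum.remove[of _ k]) (auto intro!: sum.neutral)
      ultimately show ?thesis
        by simp
    qed
    then have S: "(\<Sum>b\<in>?I. c (b(n := k)) * (\<Prod>i<n. f i q ^ b i)) = 0" if "q \<in> Z n" for q
      using that unfolding S_def .
    show ?case
    proof
      fix b assume "b \<in> ?I"
      show "c (b(n := k)) = 0"
      proof (rule Suc.IH[of "\<lambda>b. c (b(n := k))"])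
        show "irreducible_closed (subtopology zariski (orbit p)) (Z i)" if "i \<le> n" for i
          using Suc.prems(1) that by simp
        show "\<exists>q\<in>Z (Suc i). f i q \<noteq> 0" if "i < n" for i
          using Suc.prems(5) that by simp
      qed (use Suc.prems(2,3,4) S \<open>b \<in> ?I\<close> in \<open>auto simp del: fun_upd_apply\<close>)
    qed
  qed
  have "a \<in> (\<lambda>(k, b). b(n := k)) ` ({..K} \<times> ?I)"
    using Suc.prems(7) unfolding lessThan_Suc PiE_insert_eq .
  then show ?case
    using main by auto
qed


section \<open>Upper and lower bounds for the dimension of an orbit\<close>

lemma orbit_dim_le:
  assumes p: "p \<in> Bil2" and M: "\<And>r s. (\<lambda>x. M x $ r $ s) \<in> funspace.span (monomials d 1)"
    and dense: "\<And>f A. polyfun f \<Longrightarrow> invertible A \<Longrightarrow> f (act A p) \<noteq> 0 \<Longrightarrow> \<exists>x. det (M x) \<noteq> 0 \<and> f (act (M x) p) \<noteq> 0"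
  shows "orbit_dim p \<le> enat d"
proof -
  interpret mon: function_filtration "\<lambda>e. funspace.span (monomials d e)" M
    by (rule function_filtration_monomials) (rule M)
  let ?X = "subtopology zariski (orbit p)"
  have bound: "n \<le> d" if Z: "\<And>i. i \<le> n \<Longrightarrow> irreducible_closed ?X (Z i)" "\<And>i. i < n \<Longrightarrow> Z i \<subset> Z (Suc i)"
    for n and Z :: "nat \<Rightarrow> bilpair set"
  proof (rule ccontr)
    assume "\<not> n \<le> d"
    then have n: "Suc d \<le> n"
      by simp
    \<comment> \<open>The first \<open>d + 1\<close> inclusions of the chain already give a
      contradiction; the later ones are dropped.\<close>
    have cl: "closedin ?X (Z i)" if "i \<le> Suc d" for i
      using Z(1)[of i] n that unfolding irreducible_closed_def by simp
    have "\<exists>f. polyfun f \<and> (\<forall>q\<in>Z i. f q = 0) \<and> (\<exists>q\<in>Z (Suc i). f q \<noteq> 0)" if "i < Suc d" for i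
    proof -
      have i: "i \<le> Suc d" "Suc i \<le> Suc d" "Z i \<subset> Z (Suc i)"
        using Z(2) n that by simp_all
      obtain f where "polyfun f" "\<forall>q\<in>Z i. f q = 0" "\<exists>q\<in>Z (Suc i). f q \<noteq> 0"
        by (rule separating_polyfun[OF p cl[OF i(1)] cl[OF i(2)] i(3)])
      then show ?thesis
        by (intro exI conjI)
    qed
    then obtain f where f: "\<And>i. i < Suc d \<Longrightarrow> polyfun (f i)"
      "\<And>i. i < Suc d \<Longrightarrow> \<forall>q\<in>Z i. f i q = 0" "\<And>i. i < Suc d \<Longrightarrow> \<exists>q\<in>Z (Suc i). f i q \<noteq> 0"
      by metis
    have "\<exists>e. mon.pullback p e (f i)" if "i < Suc d" for i
      using mon.pullback_polyfun[OF f(1)[OF that] p] .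
    then obtain e where e: "\<And>i. i < Suc d \<Longrightarrow> mon.pullback p (e i) (f i)"
      by metis
    define E where "E = (\<Sum>i<Suc d. e i)"
    \<comment> \<open>The choice makes \<open>(2 E K + 1)^d \<le> (2 E + 1)^d (K + 1)^d = K (K +
      1)^d < (K + 1)^(d + 1)\<close>: there are more monomials in the \<open>f i\<close> than
      available monomials in the parameters.\<close>
    define K where "K = (2 * E + 1) ^ d"
    let ?I = "{..<Suc d} \<rightarrow>\<^sub>E {..K}"
    let ?m = "\<lambda>a q. \<Prod>i<Suc d. f i q ^ a i"
    \<comment> \<open>A common exponent for all \<open>a\<close> is essential: only then is a
      relation between the cleared functions also a relation between the monomials, after division
      by one power of the determinant.\<close>
    have "mon.pullback p (E * K) (?m a)" if a: "a \<in> ?I" for a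
    proof (rule mon.pullback_mono)
      show "mon.pullback p (\<Sum>i<Suc d. a i * e i) (?m a)"
        by (intro mon.pullback_prod mon.pullback_power e) simp_all
      have "(\<Sum>i<Suc d. a i * e i) \<le> (\<Sum>i<Suc d. K * e i)"
        using a by (intro sum_mono mult_right_mono) (auto simp: PiE_iff)
      then show "(\<Sum>i<Suc d. a i * e i) \<le> E * K"
        by (simp only: E_def sum_distrib_left[symmetric] mult.commute)
    qed
    then have "\<forall>a\<in>?I. \<exists>F. F \<in> funspace.span (monomials d (2 * (E * K))) \<and>
        (\<forall>x. det (M x) \<noteq> 0 \<longrightarrow> ?m a (act (M x) p) * det (M x) ^ (E * K) = F x)"
      unfolding mon.pullback_def Bex_def by (rule ballI)
    from bchoice[OF this] obtain F where F': "\<forall>a\<in>?I. F a \<in> funspace.span (monomials d (2 * (E * K))) \<and>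
        (\<forall>x. det (M x) \<noteq> 0 \<longrightarrow> ?m a (act (M x) p) * det (M x) ^ (E * K) = F a x)"
      by (rule exE)
    have F: "F a \<in> funspace.span (monomials d (2 * (E * K)))" if "a \<in> ?I" for a
      using bspec[OF F' that] by (rule conjunct1)
    have F_eq: "?m a (act (M x) p) * det (M x) ^ (E * K) = F a x" if "a \<in> ?I" "det (M x) \<noteq> 0" for a x
      using bspec[OF F' that(1), THEN conjunct2, THEN spec, THEN mp, OF that(2)] .
    have fin: "finite ?I"
      by (intro finite_PiE) auto
    have "card (monomials d (2 * (E * K))) \<le> (2 * (E * K) + 1) ^ d"
      by (rule card_monomials)
    also have "\<dots> \<le> ((2 * E + 1) * (K + 1)) ^ d"
      by (intro power_mono) (simp_all add: algebra_simps)
    also have "\<dots> = K * (K + 1) ^ d"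
      by (simp only: power_mult_distrib K_def)
    also have "\<dots> < (K + 1) ^ Suc d"
      by simp
    also have "\<dots> = card ?I"
      by (simp only: card_PiE[OF finite_lessThan] card_atMost prod_constant card_lessThan Suc_eq_plus1)
    finally have "card (monomials d (2 * (E * K))) < card ?I" .
    then obtain c where c: "\<exists>a\<in>?I. c a \<noteq> 0" "\<And>x. (\<Sum>a\<in>?I. c a * F a x) = 0"
      by (rule functions_dependent[where g = F, OF fin finite_monomials _ F]) (assumption, rule that)
    let ?h = "\<lambda>q. \<Sum>a\<in>?I. c a * ?m a q"
    have poly: "polyfun ?h"
      using f(1) by (intro polyfun_sum fin polyfun.mult polyfun.const polyfun_prod polyfun_power) simp_all
    have slice: "?h (act (M x) p) = 0" if "det (M x) \<noteq> 0" for x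
    proof -
      have "?h (act (M x) p) * det (M x) ^ (E * K) = (\<Sum>a\<in>?I. c a * F a x)"
        unfolding sum_distrib_right
        by (intro sum.cong refl) (simp only: mult.assoc F_eq that not_False_eq_True)
      then show ?thesis
        using c(2) that by simp
    qed
    have h: "?h (act A p) = 0" if "invertible A" for A
    proof (rule ccontr)
      assume "?h (act A p) \<noteq> 0"
      from dense[OF poly that this] obtain x where x: "det (M x) \<noteq> 0" "?h (act (M x) p) \<noteq> 0"
        by (elim exE conjE)
      show False
        using x(2) slice[OF x(1)] by (rule notE)
    qed
    have "c a = 0" if "a \<in> ?I" for a
    proof (rule separating_monomials_independent[OF p, where n = "Suc d" and Z = Z and f = f and K = K and c = c])
      show "?h q = 0" if "q \<in> Z (Suc d)" for q
      proof -
        have "q \<in> orbit p"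
          using closedin_subset[OF cl[of "Suc d"]] that by (auto simp: topspace_subtopology)
        then obtain A where "invertible A" "q = act A p"
          by (rule orbitE)
        then show ?thesis
          using h by simp
      qed
      show "irreducible_closed ?X (Z i)" if "i \<le> Suc d" for i
        using Z(1) that n by simp
      show "Z i \<subseteq> Z (Suc i)" if "i < Suc d" for i
        using Z(2)[of i] that n by auto
    qed (use f that in auto)
    then show False
      using c(1) by blast
  qed
  have chain: "n \<le> d"
    if "(\<forall>i\<le>n. irreducible_closed ?X (Z i)) \<and> (\<forall>i<n. Z i \<subset> Z (Suc i))" for n Z
    by (rule bound[of n Z]) (use that in simp_all)
  show ?thesis
    unfolding orbit_dim_def krull_dim_def
    by (intro Sup_least, elim imageE CollectE exE, drule chain) simp
qed

text \<open>The members of the chain are the closures in the orbit of the translates by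
  \<open>S i\<close>. They are irreducible since \<open>S i\<close> contains the line through any
  two of its matrices, and \<open>f i\<close> witnesses the \<open>i\<close>-th strict
  inclusion.\<close>

lemma le_orbit_dim:
  fixes S :: "nat \<Rightarrow> (complex^2^2) set"
  assumes p: "p \<in> Bil2"
    and S: "\<And>i. mat 1 \<in> S i" "\<And>i. S i \<subseteq> S (Suc i)" "\<And>i A B t. A \<in> S i \<Longrightarrow> B \<in> S i \<Longrightarrow> matrix_line A B t \<in> S i"
    and poly: "\<And>i. i < d \<Longrightarrow> polyfun (f i)"
    and zero: "\<And>i A. i < d \<Longrightarrow> A \<in> S i \<Longrightarrow> invertible A \<Longrightarrow> f i (act A p) = 0"
    and nonzero: "\<And>i. i < d \<Longrightarrow> \<exists>A\<in>S (Suc i). invertible A \<and> f i (act A p) \<noteq> 0"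
  shows "enat d \<le> orbit_dim p"
proof -
  let ?X = "subtopology zariski (orbit p)"
  define G where "G i = {g. polyfun g \<and> (\<forall>A\<in>S i. invertible A \<longrightarrow> g (act A p) = 0)}" for i
  define Z where "Z i = {q \<in> orbit p. \<forall>g\<in>G i. g q = 0}" for i
  have mem: "act A p \<in> Z i" if "A \<in> S i" "invertible A" for A i
    using that orbitI by (auto simp: Z_def G_def)
  have cl: "closedin ?X (Z i)" for i
    unfolding closedin_orbit[OF p] Z_def by (intro exI[of _ "G i"]) (simp add: G_def)
  \<comment> \<open>A function from a system cutting out \<open>C\<close> that does not vanish on
    all of \<open>Z i\<close> cannot vanish on all translates by \<open>S i\<close>, since
    \<open>Z i\<close> is defined by the functions that do.\<close>
  have escape: "\<exists>g A. polyfun g \<and> (\<forall>q\<in>C. g q = 0) \<and> A \<in> S i \<and> invertible A \<and> g (act A p) \<noteq> 0"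
    if C: "closedin ?X C" and sub: "C \<subseteq> Z i" "C \<noteq> Z i" for C i
  proof -
    obtain F where F: "\<forall>f\<in>F. polyfun f" "C = {q \<in> orbit p. \<forall>f\<in>F. f q = 0}"
      using C unfolding closedin_orbit[OF p] by (elim exE conjE) (rule that)
    obtain q where q: "q \<in> Z i" "q \<notin> C"
      using sub by blast
    then obtain g where g: "g \<in> F" "g q \<noteq> 0"
      unfolding F(2) Z_def by blast
    then have "g \<notin> G i"
      using q(1) unfolding Z_def by blast
    then show ?thesis
      using g F unfolding G_def by blast
  qed
  have "irreducible_closed ?X (Z i)" for i
    unfolding irreducible_closed_def
  proof (intro conjI allI impI cl)
    show "Z i \<noteq> {}"
      using mem[OF S(1) invertible_mat_1] by blast
    fix C D assume C: "closedin ?X C" and D: "closedin ?X D" and CD: "Z i = C \<union> D"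
    show "Z i = C \<or> Z i = D"
    proof (rule ccontr)
      assume "\<not> (Z i = C \<or> Z i = D)"
      then have "\<exists>g A. polyfun g \<and> (\<forall>q\<in>C. g q = 0) \<and> A \<in> S i \<and> invertible A \<and> g (act A p) \<noteq> 0"
        and "\<exists>g A. polyfun g \<and> (\<forall>q\<in>D. g q = 0) \<and> A \<in> S i \<and> invertible A \<and> g (act A p) \<noteq> 0"
        using escape[OF C] escape[OF D] CD by blast+
      then obtain g h A B where g: "polyfun g" "\<forall>q\<in>C. g q = 0" "A \<in> S i" "invertible A" "g (act A p) \<noteq> 0"
        and h: "polyfun h" "\<forall>q\<in>D. h q = 0" "B \<in> S i" "invertible B" "h (act B p) \<noteq> 0"
        by blast
      obtain t where t: "invertible (matrix_line A B t)" "g (act (matrix_line A B t) p) \<noteq> 0"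
        "h (act (matrix_line A B t) p) \<noteq> 0"
        by (rule line_regular_common_point[OF line_regular_polyfun[OF g(1) p] line_regular_polyfun[OF h(1) p] g(4) h(4) g(5) h(5)])
      have "act (matrix_line A B t) p \<in> Z i"
        by (intro mem S(3) g(3) h(3) t(1))
      then show False
        using t(2,3) g(2) h(2) unfolding CD by blast
    qed
  qed
  moreover have "Z i \<subset> Z (Suc i)" if i: "i < d" for i
  proof -
    have "G (Suc i) \<subseteq> G i"
      using S(2)[of i] unfolding G_def by blast
    then have "Z i \<subseteq> Z (Suc i)"
      unfolding Z_def by blast
    obtain A where A: "A \<in> S (Suc i)" "invertible A" "f i (act A p) \<noteq> 0"
      using nonzero[OF i] by blast
    have "f i \<in> G i"
      using poly[OF i] zero[OF i] unfolding G_def by blast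
    then have "act A p \<notin> Z i"
      using A(3) unfolding Z_def by blast
    then show ?thesis
      using mem[OF A(1,2)] \<open>Z i \<subseteq> Z (Suc i)\<close> by blast
  qed
  ultimately have "d \<in> {n. \<exists>Z. (\<forall>i\<le>n. irreducible_closed ?X (Z i)) \<and> (\<forall>i<n. Z i \<subset> Z (Suc i))}"
    by blast
  then show ?thesis
    unfolding orbit_dim_def krull_dim_def by (intro Sup_upper imageI)
qed

section \<open>Orbit dimensions\<close>

definition mat2 :: "complex \<Rightarrow> complex \<Rightarrow> complex \<Rightarrow> complex \<Rightarrow> complex^2^2" where
  "mat2 a b c d = (\<chi> i j. if i = 1 then (if j = 1 then a else b) else (if j = 1 then c else d))"

lemma mat2_nth: "mat2 a b c d $ 1 $ 1 = a" "mat2 a b c d $ 1 $ 2 = b" "mat2 a b c d $ 2 $ 1 = c" "mat2 a b c d $ 2 $ 2 = d"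
  by (simp_all add: mat2_def)

lemma mat2_eq_iff: "A = mat2 a b c d \<longleftrightarrow> A$1$1 = a \<and> A$1$2 = b \<and> A$2$1 = c \<and> A$2$2 = d"
  by (simp add: vec_eq_iff forall_2 mat2_nth)

lemma matrix_mult_nth: "(A ** B) $ i $ j = A$i$1 * B$1$j + A$i$2 * B$2$j" for A B :: "complex^2^2"
  by (simp add: matrix_matrix_mult_def sum_2)

fun coord :: "bool \<times> 2 \<times> 2 \<times> 2 \<Rightarrow> bilpair \<Rightarrow> complex" where
  "coord (w, i, j, k) q = (if w then snd q else fst q) (axis i 1) (axis j 1) $ k"

text \<open>The coordinates of the translate by \<open>A\<close>, multiplied by the square of the determinant of \<open>A\<close>.\<close>

fun act_coord :: "bool \<times> 2 \<times> 2 \<times> 2 \<Rightarrow> complex^2^2 \<Rightarrow> bilpair \<Rightarrow> complex" where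
  "act_coord (w, i, j, k) A q =
     (let v = (if w then snd q else fst q) (adj_vec A (axis i 1)) (adj_vec A (axis j 1)) in A$k$1 * v$1 + A$k$2 * v$2)"

lemma act_coord:
  assumes "p \<in> Bil2" "det A \<noteq> 0"
  shows "coord c (act A p) = z \<longleftrightarrow> act_coord c A p = z * det A ^ 2"
proof (cases c)
  case (fields w i j k)
  have "coord c (act A p) * det A ^ 2 = act_coord c A p"
    by (simp add: fields Let_def act_coordinate[OF assms])
  then show ?thesis
    using assms(2) by (metis mult_cancel_right power_eq_0_iff)
qed

lemma polyfun_coord: "polyfun (coord c)"
proof (cases c)
  case (fields w i j k)
  have "coord c = (if w then (\<lambda>q. snd q (axis i 1) (axis j 1) $ k) else (\<lambda>q. fst q (axis i 1) (axis j 1) $ k))"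
    by (simp add: fun_eq_iff fields)
  then show ?thesis
    by (simp add: polyfun.coord_fst polyfun.coord_snd)
qed

text \<open>The entries listed in \<open>L\<close> are set free one after the other, starting from the identity matrix.
  The coordinate \<open>C ! i\<close> is constant before the \<open>i\<close>-th step, and \<open>W ! i\<close> shows that it is not constant after it.\<close>

lemma length_le_orbit_dim:
  fixes L :: "(2 \<times> 2) list"
  assumes p: "p \<in> Bil2"
    and len: "length L = d"
    and zero: "\<forall>i<length L. \<forall>A. (\<forall>r s. (r, s) \<notin> set (take i L) \<longrightarrow> A$r$s = mat 1$r$s) \<longrightarrow>
      act_coord (C ! i) A p = coord (C ! i) p * det A ^ 2"
    and nonzero: "\<forall>i<length L. (\<forall>r s. (r, s) \<notin> set (take (Suc i) L) \<longrightarrow> W ! i$r$s = mat 1$r$s) \<and>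
      det (W ! i) \<noteq> 0 \<and> act_coord (C ! i) (W ! i) p \<noteq> coord (C ! i) p * det (W ! i) ^ 2"
  shows "enat d \<le> orbit_dim p"
  unfolding len[symmetric]
proof (rule le_orbit_dim[OF p, of "\<lambda>i. {A. \<forall>r s. (r, s) \<notin> set (take i L) \<longrightarrow> A$r$s = mat 1$r$s}"])
  show "{A. \<forall>r s. (r, s) \<notin> set (take i L) \<longrightarrow> A$r$s = mat 1$r$s}
    \<subseteq> {A. \<forall>r s. (r, s) \<notin> set (take (Suc i) L) \<longrightarrow> A$r$s = mat 1$r$s}" for i
    using set_take_subset_set_take[of i "Suc i" L] by auto
  show "polyfun (\<lambda>q. coord (C ! i) q - coord (C ! i) p)" for i
    by (intro polyfun_minus_const polyfun_coord)
  show "coord (C ! i) (act A p) - coord (C ! i) p = 0"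
    if "i < length L" "A \<in> {A. \<forall>r s. (r, s) \<notin> set (take i L) \<longrightarrow> A$r$s = mat 1$r$s}" "invertible A" for i A
    using zero that act_coord[OF p] by (simp add: invertible_det_nz)
  show "\<exists>A\<in>{A. \<forall>r s. (r, s) \<notin> set (take (Suc i) L) \<longrightarrow> A$r$s = mat 1$r$s}. invertible A \<and>
      coord (C ! i) (act A p) - coord (C ! i) p \<noteq> 0" if "i < length L" for i
    using nonzero that act_coord[OF p] by (intro bexI[of _ "W ! i"]) (simp_all add: invertible_det_nz)
qed (simp_all add: matrix_line_nth)

lemma const_in_span_monomials: "(\<lambda>x. c) \<in> funspace.span (monomials d 1)"
  and var_in_span_monomials: "i < d \<Longrightarrow> (\<lambda>x. x i) \<in> funspace.span (monomials d 1)"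
proof -
  have "(\<lambda>x. 1) \<in> monomials d 1"
    unfolding monomials_def by (intro image_eqI[of _ _ "\<lambda>i\<in>{..<d}. 0"]) (auto simp: fun_eq_iff)
  from funspace.span_scale[OF funspace.span_base[OF this]]
  show "(\<lambda>x. c) \<in> funspace.span (monomials d 1)"
    by simp
  assume i: "i < d"
  have "x i = (\<Prod>j<d. x j ^ (\<lambda>j\<in>{..<d}. if j = i then 1 else 0) j)" for x :: "nat \<Rightarrow> complex"
  proof -
    have "(\<Prod>j<d. x j ^ (\<lambda>j\<in>{..<d}. if j = i then 1 else 0) j) = (\<Prod>j<d. if j = i then x j else 1)"
      by (intro prod.cong) auto
    then show ?thesis
      using i by (simp add: prod.delta)
  qed
  then have "(\<lambda>x. x i) \<in> monomials d 1"
    unfolding monomials_def by (intro image_eqI[of _ _ "\<lambda>j\<in>{..<d}. if j = i then 1 else 0"]) (auto simp: fun_eq_iff)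
  then show "(\<lambda>x. x i) \<in> funspace.span (monomials d 1)"
    by (rule funspace.span_base)
qed

text \<open>If every matrix whose entry \<open>(r, r)\<close> does not vanish can be moved into a \<open>d\<close>-dimensional family by the
  stabilizer of \<open>p\<close>, then the translates of \<open>p\<close> by this family are dense in the orbit.\<close>

lemma orbit_dim_le_of_stabilizer:
  assumes p: "p \<in> Bil2" and M: "\<And>r s. (\<lambda>x. M x $ r $ s) \<in> funspace.span (monomials d 1)"
    and stab: "\<And>B. det B \<noteq> 0 \<Longrightarrow> B$r$r \<noteq> 0 \<Longrightarrow> \<exists>H x. det H \<noteq> 0 \<and> B ** H = M x \<and>
      (\<forall>u v. fst p (H *v u) (H *v v) = H *v fst p u v) \<and> (\<forall>u v. snd p (H *v u) (H *v v) = H *v snd p u v)"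
  shows "orbit_dim p \<le> enat d"
proof (rule orbit_dim_le[OF p M])
  fix f A assume f: "polyfun f" and A: "invertible A" "f (act A p) \<noteq> 0"
  \<comment> \<open>The identity matrix has a nonzero entry \<open>(r, r)\<close>, so some point on
    the line from \<open>A\<close> to it satisfies this condition without losing
    \<open>f \<noteq> 0\<close>.\<close>
  have "(mat 1 :: complex^2^2) $ r $ r \<noteq> 0"
    by (simp add: mat_def)
  then obtain t where t: "invertible (matrix_line A (mat 1) t)" "f (act (matrix_line A (mat 1) t) p) \<noteq> 0"
    "matrix_line A (mat 1) t $ r $ r \<noteq> 0"
    by (rule line_regular_common_point[OF line_regular_polyfun[OF f p] line_regular_entry A(1) invertible_mat_1 A(2)])
  define B where "B = matrix_line A (mat 1) t"
  have B: "invertible B" "f (act B p) \<noteq> 0" "B$r$r \<noteq> 0"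
    using t unfolding B_def by simp_all
  obtain H x where H: "det H \<noteq> 0" "B ** H = M x"
    "\<forall>u v. fst p (H *v u) (H *v v) = H *v fst p u v" "\<forall>u v. snd p (H *v u) (H *v v) = H *v snd p u v"
    using stab[of B] B(1,3) by (auto simp: invertible_det_nz)
  have inv: "invertible H"
    using H(1) by (simp add: invertible_det_nz)
  have "act H p = p"
    by (rule act_eqI[OF inv]) (simp_all add: H(3,4))
  then have "act (M x) p = act B p"
    using act_mult[OF B(1) inv, of p] H(2) by simp
  moreover have "det (M x) \<noteq> 0"
    using invertible_mult[OF B(1) inv] H(2) by (simp add: invertible_det_nz)
  ultimately show "\<exists>x. det (M x) \<noteq> 0 \<and> f (act (M x) p) \<noteq> 0"
    using B(2) by (intro exI[of _ x]) simp
qed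

lemma mat2_span:
  assumes "a \<in> funspace.span (monomials d 1)" "b \<in> funspace.span (monomials d 1)"
    "c \<in> funspace.span (monomials d 1)" "e \<in> funspace.span (monomials d 1)"
  shows "(\<lambda>x. mat2 (a x) (b x) (c x) (e x) $ r $ s) \<in> funspace.span (monomials d 1)"
  using assms exhaust_2[of r] exhaust_2[of s] by (auto simp: mat2_nth)

text \<open>The family of all matrices, with the identity as stabilizing element.\<close>

lemma orbit_dim_le_4:
  assumes "p \<in> Bil2"
  shows "orbit_dim p \<le> enat 4"
proof (rule orbit_dim_le_of_stabilizer[OF assms, of "\<lambda>x. mat2 (x 0) (x 1) (x 2) (x 3)" _ 1])
  show "(\<lambda>x. mat2 (x 0) (x 1) (x 2) (x 3) $ r $ s) \<in> funspace.span (monomials 4 1)" for r s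
    by (intro mat2_span var_in_span_monomials) simp_all
  show "\<exists>H (x :: nat \<Rightarrow> complex). det H \<noteq> 0 \<and> B ** H = mat2 (x 0) (x 1) (x 2) (x 3) \<and>
      (\<forall>u v. fst p (H *v u) (H *v v) = H *v fst p u v) \<and> (\<forall>u v. snd p (H *v u) (H *v v) = H *v snd p u v)"
    for B :: "complex^2^2"
    by (intro exI[of _ "mat 1"] exI[of _ "\<lambda>i. [B$1$1, B$1$2, B$2$1, B$2$2] ! i"])
      (simp add: mat2_eq_iff)
qed

lemmas stabilizer_simps = det_2 mat2_nth mat2_eq_iff matrix_mult_nth vec2_eq_iff mat_vec_nth table_nth e1_nth e2_nth

lemmas chain_simps = All_less_Suc mat2_nth det_2 table_nth e1_nth e2_nth adj_vec_nth axis_def mat_def forall_2 Let_def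
  power2_eq_square

lemma orbit_dim_N01: "orbit_dim (structure_of N01) = 2"
proof (rule antisym)
  have "orbit_dim (structure_of N01) \<le> enat 2"
  proof (rule orbit_dim_le_of_stabilizer[of _ "\<lambda>x. mat2 (x 0) (x 1) 0 1" _ 2])
    show "(\<lambda>x. mat2 (x 0) (x 1) 0 1 $ r $ s) \<in> funspace.span (monomials 2 1)" for r s
      by (intro mat2_span var_in_span_monomials const_in_span_monomials) simp_all
    fix B :: "complex^2^2" assume B: "det B \<noteq> 0" "B$2$2 \<noteq> 0"
    \<comment> \<open>An automorphism multiplies \<open>e1\<close> by \<open>a\<close> modulo
      \<open>e2\<close> and hence \<open>e2\<close> by \<open>a^2\<close>; a square root is needed
      to turn the entry \<open>(2, 2)\<close> of the product into \<open>1\<close>.\<close>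
    define a where "a = csqrt (1 / B$2$2)"
    have a: "a * a * B$2$2 = 1" "a \<noteq> 0"
      using B(2) power2_csqrt[of "1 / B$2$2"] by (auto simp: a_def power2_eq_square)
    show "\<exists>H (x :: nat \<Rightarrow> complex). det H \<noteq> 0 \<and> B ** H = mat2 (x 0) (x 1) 0 1 \<and>
        (\<forall>u v. fst (structure_of N01) (H *v u) (H *v v) = H *v fst (structure_of N01) u v) \<and>
        (\<forall>u v. snd (structure_of N01) (H *v u) (H *v v) = H *v snd (structure_of N01) u v)"
      using B a
      by (intro exI[of _ "mat2 a 0 (- a * B$2$1 / B$2$2) (a * a)"]
        exI[of _ "\<lambda>i. [a * B$1$1 - B$1$2 * a * B$2$1 / B$2$2, a * a * B$1$2] ! i"])
        (simp add: stabilizer_simps; (simp add: field_simps)?)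
  qed simp
  then show "orbit_dim (structure_of N01) \<le> 2"
    by (simp only: numeral_eq_enat)
  show "2 \<le> orbit_dim (structure_of N01)"
    using length_le_orbit_dim[of "structure_of N01" "[(1, 1), (1, 2)]" 2
      "[(True, 1, 1, 2), (True, 1, 1, 1)]"
      "[mat2 2 0 0 1, mat2 1 (- 1) 0 1]"]
    by (simp add: numeral_eq_enat chain_simps)
qed

lemma orbit_dim_N02: "orbit_dim (structure_of N02) = 3"
proof (rule antisym)
  have "orbit_dim (structure_of N02) \<le> enat 3"
  proof (rule orbit_dim_le_of_stabilizer[of _ "\<lambda>x. mat2 1 (x 0) (x 1) (x 2)" _ 1])
    show "(\<lambda>x. mat2 1 (x 0) (x 1) (x 2) $ r $ s) \<in> funspace.span (monomials 3 1)" for r s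
      by (intro mat2_span var_in_span_monomials const_in_span_monomials) simp_all
    fix B :: "complex^2^2" assume B: "det B \<noteq> 0" "B$1$1 \<noteq> 0"
    show "\<exists>H (x :: nat \<Rightarrow> complex). det H \<noteq> 0 \<and> B ** H = mat2 1 (x 0) (x 1) (x 2) \<and>
        (\<forall>u v. fst (structure_of N02) (H *v u) (H *v v) = H *v fst (structure_of N02) u v) \<and>
        (\<forall>u v. snd (structure_of N02) (H *v u) (H *v v) = H *v snd (structure_of N02) u v)"
      using B
      by (intro exI[of _ "mat2 (1 / B$1$1) 0 0 1"] exI[of _ "\<lambda>i. [B$1$2, B$2$1 / B$1$1, B$2$2] ! i"])
        (simp add: stabilizer_simps; (simp add: field_simps)?)
  qed simp
  then show "orbit_dim (structure_of N02) \<le> 3"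
    by (simp only: numeral_eq_enat)
  show "3 \<le> orbit_dim (structure_of N02)"
    using length_le_orbit_dim[of "structure_of N02" "[(1, 2), (2, 2), (2, 1)]" 3
      "[(True, 2, 2, 1), (True, 2, 1, 1), (True, 1, 1, 1)]"
      "[mat2 1 (- 1) 0 1, mat2 1 0 0 2, mat2 1 0 1 1]"]
    by (simp add: numeral_eq_enat chain_simps)
qed

lemma orbit_dim_N03: "orbit_dim (structure_of N03) = 4"
proof (rule antisym)
  show "orbit_dim (structure_of N03) \<le> 4"
    using orbit_dim_le_4[of "structure_of N03"] by (simp add: numeral_eq_enat)
  show "4 \<le> orbit_dim (structure_of N03)"
    using length_le_orbit_dim[of "structure_of N03" "[(1, 1), (1, 2), (2, 2), (2, 1)]" 4
      "[(True, 1, 1, 1), (True, 1, 2, 1), (True, 2, 2, 2), (True, 1, 1, 2)]"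
      "[mat2 2 0 0 1, mat2 1 1 0 1, mat2 1 0 0 2, mat2 1 0 1 2]"]
    by (simp add: numeral_eq_enat chain_simps)
qed

lemma orbit_dim_N04: "orbit_dim (structure_of N04) = 3"
proof (rule antisym)
  have "orbit_dim (structure_of N04) \<le> enat 3"
  proof (rule orbit_dim_le_of_stabilizer[of _ "\<lambda>x. mat2 (x 0) (x 1) (x 2) 1" _ 2])
    show "(\<lambda>x. mat2 (x 0) (x 1) (x 2) 1 $ r $ s) \<in> funspace.span (monomials 3 1)" for r s
      by (intro mat2_span var_in_span_monomials const_in_span_monomials) simp_all
    fix B :: "complex^2^2" assume B: "det B \<noteq> 0" "B$2$2 \<noteq> 0"
    show "\<exists>H (x :: nat \<Rightarrow> complex). det H \<noteq> 0 \<and> B ** H = mat2 (x 0) (x 1) (x 2) 1 \<and>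
        (\<forall>u v. fst (structure_of N04) (H *v u) (H *v v) = H *v fst (structure_of N04) u v) \<and>
        (\<forall>u v. snd (structure_of N04) (H *v u) (H *v v) = H *v snd (structure_of N04) u v)"
      using B
      by (intro exI[of _ "mat2 1 0 0 (1 / B$2$2)"] exI[of _ "\<lambda>i. [B$1$1, B$1$2 / B$2$2, B$2$1] ! i"])
        (simp add: stabilizer_simps; (simp add: field_simps)?)
  qed simp
  then show "orbit_dim (structure_of N04) \<le> 3"
    by (simp only: numeral_eq_enat)
  show "3 \<le> orbit_dim (structure_of N04)"
    using length_le_orbit_dim[of "structure_of N04" "[(1, 1), (1, 2), (2, 1)]" 3
      "[(True, 1, 1, 1), (True, 1, 2, 1), (True, 1, 1, 2)]"
      "[mat2 2 0 0 1, mat2 1 (- 1) 0 1, mat2 1 0 1 1]"]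
    by (simp add: numeral_eq_enat chain_simps)
qed

text \<open>The shears \<open>e2 \<mapsto> e2 + s e1\<close> are automorphisms, and a suitable one
  clears the entry \<open>(1, 2)\<close>.\<close>

lemma orbit_dim_N05: "orbit_dim (structure_of N05) = 3"
proof (rule antisym)
  have "orbit_dim (structure_of N05) \<le> enat 3"
  proof (rule orbit_dim_le_of_stabilizer[of _ "\<lambda>x. mat2 (x 0) 0 (x 1) (x 2)" _ 1])
    show "(\<lambda>x. mat2 (x 0) 0 (x 1) (x 2) $ r $ s) \<in> funspace.span (monomials 3 1)" for r s
      by (intro mat2_span var_in_span_monomials const_in_span_monomials) simp_all
    fix B :: "complex^2^2" assume B: "det B \<noteq> 0" "B$1$1 \<noteq> 0"
    show "\<exists>H (x :: nat \<Rightarrow> complex). det H \<noteq> 0 \<and> B ** H = mat2 (x 0) 0 (x 1) (x 2) \<and>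
        (\<forall>u v. fst (structure_of N05) (H *v u) (H *v v) = H *v fst (structure_of N05) u v) \<and>
        (\<forall>u v. snd (structure_of N05) (H *v u) (H *v v) = H *v snd (structure_of N05) u v)"
      using B
      by (intro exI[of _ "mat2 1 (- B$1$2 / B$1$1) 0 1"]
        exI[of _ "\<lambda>i. [B$1$1, B$2$1, B$2$2 - B$2$1 * B$1$2 / B$1$1] ! i"])
        (simp add: stabilizer_simps; (simp add: field_simps)?)
  qed simp
  then show "orbit_dim (structure_of N05) \<le> 3"
    by (simp only: numeral_eq_enat)
  show "3 \<le> orbit_dim (structure_of N05)"
    using length_le_orbit_dim[of "structure_of N05" "[(1, 1), (2, 2), (2, 1)]" 3
      "[(True, 2, 2, 1), (True, 1, 2, 1), (True, 1, 1, 1)]"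
      "[mat2 2 0 0 1, mat2 1 0 0 2, mat2 1 0 (- 1) 1]"]
    by (simp add: numeral_eq_enat chain_simps)
qed

text \<open>The condition \<open>\<alpha> \<noteq> 0\<close> enters the lower bound: at the last
  witness the \<open>e2\<close> coordinate of \<open>e1 \<circ> e1\<close> is
  \<open>- \<alpha>\<close>.\<close>

lemma orbit_dim_N06: assumes "\<alpha> \<noteq> 0" shows "orbit_dim (structure_of (N06 \<alpha>)) = 3"
proof (rule antisym)
  have "orbit_dim (structure_of (N06 \<alpha>)) \<le> enat 3"
  proof (rule orbit_dim_le_of_stabilizer[of _ "\<lambda>x. mat2 1 (x 0) (x 1) (x 2)" _ 1])
    show "(\<lambda>x. mat2 1 (x 0) (x 1) (x 2) $ r $ s) \<in> funspace.span (monomials 3 1)" for r s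
      by (intro mat2_span var_in_span_monomials const_in_span_monomials) simp_all
    fix B :: "complex^2^2" assume B: "det B \<noteq> 0" "B$1$1 \<noteq> 0"
    show "\<exists>H (x :: nat \<Rightarrow> complex). det H \<noteq> 0 \<and> B ** H = mat2 1 (x 0) (x 1) (x 2) \<and>
        (\<forall>u v. fst (structure_of (N06 \<alpha>)) (H *v u) (H *v v) = H *v fst (structure_of (N06 \<alpha>)) u v) \<and>
        (\<forall>u v. snd (structure_of (N06 \<alpha>)) (H *v u) (H *v v) = H *v snd (structure_of (N06 \<alpha>)) u v)"
      using B
      by (intro exI[of _ "mat2 (1 / B$1$1) 0 0 1"] exI[of _ "\<lambda>i. [B$1$2, B$2$1 / B$1$1, B$2$2] ! i"])
        (simp add: stabilizer_simps; (simp add: field_simps)?)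
  qed simp
  then show "orbit_dim (structure_of (N06 \<alpha>)) \<le> 3"
    by (simp only: numeral_eq_enat)
  show "3 \<le> orbit_dim (structure_of (N06 \<alpha>))"
    using length_le_orbit_dim[of "structure_of (N06 \<alpha>)" "[(2, 2), (1, 2), (2, 1)]" 3
      "[(True, 2, 2, 2), (True, 2, 2, 1), (True, 1, 1, 2)]"
      "[mat2 1 0 0 2, mat2 1 1 0 1, mat2 1 0 1 1]"] assms
    by (simp add: numeral_eq_enat chain_simps)
qed

text \<open>Since \<open>x \<circ> y\<close> is a linear form in \<open>y\<close> times
  \<open>x\<close>, the structure is given by that form, and every automorphism of the plane
  preserving it is in the stabilizer. Two column entries can therefore be normalized.\<close>

lemma orbit_dim_N06_0: "orbit_dim (structure_of (N06 0)) = 2"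
proof (rule antisym)
  have "orbit_dim (structure_of (N06 0)) \<le> enat 2"
  proof (rule orbit_dim_le_of_stabilizer[of _ "\<lambda>x. mat2 1 0 (x 0) (x 1)" _ 1])
    show "(\<lambda>x. mat2 1 0 (x 0) (x 1) $ r $ s) \<in> funspace.span (monomials 2 1)" for r s
      by (intro mat2_span var_in_span_monomials const_in_span_monomials) simp_all
    fix B :: "complex^2^2" assume B: "det B \<noteq> 0" "B$1$1 \<noteq> 0"
    show "\<exists>H (x :: nat \<Rightarrow> complex). det H \<noteq> 0 \<and> B ** H = mat2 1 0 (x 0) (x 1) \<and>
        (\<forall>u v. fst (structure_of (N06 0)) (H *v u) (H *v v) = H *v fst (structure_of (N06 0)) u v) \<and>
        (\<forall>u v. snd (structure_of (N06 0)) (H *v u) (H *v v) = H *v snd (structure_of (N06 0)) u v)"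
      using B
      by (intro exI[of _ "mat2 (1 / B$1$1) (- B$1$2 / B$1$1) 0 1"]
        exI[of _ "\<lambda>i. [B$2$1 / B$1$1, B$2$2 - B$2$1 * B$1$2 / B$1$1] ! i"])
        (simp add: stabilizer_simps; (simp add: field_simps)?)
  qed simp
  then show "orbit_dim (structure_of (N06 0)) \<le> 2"
    by (simp only: numeral_eq_enat)
  show "2 \<le> orbit_dim (structure_of (N06 0))"
    using length_le_orbit_dim[of "structure_of (N06 0)" "[(2, 1), (1, 2)]" 2
      "[(True, 1, 1, 1), (True, 1, 2, 1)]"
      "[mat2 1 0 1 1, mat2 1 1 (- 1) 1]"]
    by (simp add: numeral_eq_enat chain_simps)
qed

lemma orbit_dim_N07: "orbit_dim (structure_of (N07 \<alpha> \<beta>)) = 4"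
proof (rule antisym)
  show "orbit_dim (structure_of (N07 \<alpha> \<beta>)) \<le> 4"
    using orbit_dim_le_4[of "structure_of (N07 \<alpha> \<beta>)"] by (simp add: numeral_eq_enat)
  show "4 \<le> orbit_dim (structure_of (N07 \<alpha> \<beta>))"
    using length_le_orbit_dim[of "structure_of (N07 \<alpha> \<beta>)" "[(1, 1), (1, 2), (2, 2), (2, 1)]" 4
      "[(False, 1, 1, 1), (False, 1, 2, 1), (False, 2, 2, 2), (False, 1, 1, 2)]"
      "[mat2 2 0 0 1, mat2 1 1 0 1, mat2 1 0 0 2, mat2 2 0 1 1]"]
    by (simp add: numeral_eq_enat chain_simps)
qed

lemma orbit_dim_N08: "orbit_dim (structure_of (N08 \<alpha> \<beta>)) = 4"
proof (rule antisym)
  show "orbit_dim (structure_of (N08 \<alpha> \<beta>)) \<le> 4"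
    using orbit_dim_le_4[of "structure_of (N08 \<alpha> \<beta>)"] by (simp add: numeral_eq_enat)
  show "4 \<le> orbit_dim (structure_of (N08 \<alpha> \<beta>))"
    using length_le_orbit_dim[of "structure_of (N08 \<alpha> \<beta>)" "[(1, 2), (2, 2), (1, 1), (2, 1)]" 4
      "[(False, 2, 2, 1), (True, 1, 1, 2), (False, 1, 1, 1), (False, 1, 1, 2)]"
      "[mat2 1 1 0 1, mat2 1 0 0 2, mat2 2 0 0 1, mat2 1 0 (- 1) 1]"]
    by (simp add: numeral_eq_enat chain_simps)
qed

lemma orbit_dim_N09: "orbit_dim (structure_of (N09 \<alpha> \<beta>)) = 3"
proof (rule antisym)
  have "orbit_dim (structure_of (N09 \<alpha> \<beta>)) \<le> enat 3"
  proof (rule orbit_dim_le_of_stabilizer[of _ "\<lambda>x. mat2 (x 0) (x 1) (x 2) 1" _ 2])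
    show "(\<lambda>x. mat2 (x 0) (x 1) (x 2) 1 $ r $ s) \<in> funspace.span (monomials 3 1)" for r s
      by (intro mat2_span var_in_span_monomials const_in_span_monomials) simp_all
    fix B :: "complex^2^2" assume B: "det B \<noteq> 0" "B$2$2 \<noteq> 0"
    show "\<exists>H (x :: nat \<Rightarrow> complex). det H \<noteq> 0 \<and> B ** H = mat2 (x 0) (x 1) (x 2) 1 \<and>
        (\<forall>u v. fst (structure_of (N09 \<alpha> \<beta>)) (H *v u) (H *v v) = H *v fst (structure_of (N09 \<alpha> \<beta>)) u v) \<and>
        (\<forall>u v. snd (structure_of (N09 \<alpha> \<beta>)) (H *v u) (H *v v) = H *v snd (structure_of (N09 \<alpha> \<beta>)) u v)"
      using B
      by (intro exI[of _ "mat2 1 0 0 (1 / B$2$2)"] exI[of _ "\<lambda>i. [B$1$1, B$1$2 / B$2$2, B$2$1] ! i"])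
        (simp add: stabilizer_simps; (simp add: field_simps)?)
  qed simp
  then show "orbit_dim (structure_of (N09 \<alpha> \<beta>)) \<le> 3"
    by (simp only: numeral_eq_enat)
  show "3 \<le> orbit_dim (structure_of (N09 \<alpha> \<beta>))"
    using length_le_orbit_dim[of "structure_of (N09 \<alpha> \<beta>)" "[(1, 1), (1, 2), (2, 1)]" 3
      "[(False, 1, 1, 1), (False, 2, 2, 1), (False, 1, 1, 2)]"
      "[mat2 2 0 0 1, mat2 1 1 0 1, mat2 1 0 1 1]"]
    by (simp add: numeral_eq_enat chain_simps)
qed

lemma orbit_dim_N10: "orbit_dim (structure_of (N10 \<alpha>)) = 4"
proof (rule antisym)
  show "orbit_dim (structure_of (N10 \<alpha>)) \<le> 4"
    using orbit_dim_le_4[of "structure_of (N10 \<alpha>)"] by (simp add: numeral_eq_enat)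
  show "4 \<le> orbit_dim (structure_of (N10 \<alpha>))"
    using length_le_orbit_dim[of "structure_of (N10 \<alpha>)" "[(1, 1), (1, 2), (2, 2), (2, 1)]" 4
      "[(False, 1, 1, 1), (False, 1, 2, 1), (True, 2, 2, 2), (False, 1, 1, 2)]"
      "[mat2 2 0 0 1, mat2 1 (- 1) 0 1, mat2 1 0 0 2, mat2 1 0 1 1]"]
    by (simp add: numeral_eq_enat chain_simps)
qed

lemma orbit_dim_N11: "orbit_dim (structure_of (N11 \<alpha>)) = 3"
proof (rule antisym)
  have "orbit_dim (structure_of (N11 \<alpha>)) \<le> enat 3"
  proof (rule orbit_dim_le_of_stabilizer[of _ "\<lambda>x. mat2 (x 0) (x 1) (x 2) 1" _ 2])
    show "(\<lambda>x. mat2 (x 0) (x 1) (x 2) 1 $ r $ s) \<in> funspace.span (monomials 3 1)" for r s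
      by (intro mat2_span var_in_span_monomials const_in_span_monomials) simp_all
    fix B :: "complex^2^2" assume B: "det B \<noteq> 0" "B$2$2 \<noteq> 0"
    show "\<exists>H (x :: nat \<Rightarrow> complex). det H \<noteq> 0 \<and> B ** H = mat2 (x 0) (x 1) (x 2) 1 \<and>
        (\<forall>u v. fst (structure_of (N11 \<alpha>)) (H *v u) (H *v v) = H *v fst (structure_of (N11 \<alpha>)) u v) \<and>
        (\<forall>u v. snd (structure_of (N11 \<alpha>)) (H *v u) (H *v v) = H *v snd (structure_of (N11 \<alpha>)) u v)"
      using B
      by (intro exI[of _ "mat2 1 0 0 (1 / B$2$2)"] exI[of _ "\<lambda>i. [B$1$1, B$1$2 / B$2$2, B$2$1] ! i"])
        (simp add: stabilizer_simps; (simp add: field_simps)?)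
  qed simp
  then show "orbit_dim (structure_of (N11 \<alpha>)) \<le> 3"
    by (simp only: numeral_eq_enat)
  show "3 \<le> orbit_dim (structure_of (N11 \<alpha>))"
    using length_le_orbit_dim[of "structure_of (N11 \<alpha>)" "[(1, 1), (1, 2), (2, 1)]" 3
      "[(False, 1, 1, 1), (False, 1, 2, 1), (False, 1, 1, 2)]"
      "[mat2 2 0 0 1, mat2 1 (- 1) 0 1, mat2 1 0 1 1]"]
    by (simp add: numeral_eq_enat chain_simps)
qed

lemma orbit_dim_N12: "orbit_dim (structure_of (N12 \<alpha>)) = 4"
proof (rule antisym)
  show "orbit_dim (structure_of (N12 \<alpha>)) \<le> 4"
    using orbit_dim_le_4[of "structure_of (N12 \<alpha>)"] by (simp add: numeral_eq_enat)
  show "4 \<le> orbit_dim (structure_of (N12 \<alpha>))"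
    using length_le_orbit_dim[of "structure_of (N12 \<alpha>)" "[(1, 2), (2, 2), (1, 1), (2, 1)]" 4
      "[(False, 1, 1, 1), (False, 1, 1, 2), (True, 1, 2, 2), (True, 1, 1, 2)]"
      "[mat2 1 (- 1) 0 1, mat2 1 0 0 2, mat2 2 0 0 1, mat2 2 0 (- 1) 1]"]
    by (simp add: numeral_eq_enat chain_simps)
qed

lemma orbit_dim_N13: "orbit_dim (structure_of (N13 \<alpha>)) = 3"
proof (rule antisym)
  have "orbit_dim (structure_of (N13 \<alpha>)) \<le> enat 3"
  proof (rule orbit_dim_le_of_stabilizer[of _ "\<lambda>x. mat2 (x 0) (x 1) 0 (x 2)" _ 2])
    show "(\<lambda>x. mat2 (x 0) (x 1) 0 (x 2) $ r $ s) \<in> funspace.span (monomials 3 1)" for r s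
      by (intro mat2_span var_in_span_monomials const_in_span_monomials) simp_all
    fix B :: "complex^2^2" assume B: "det B \<noteq> 0" "B$2$2 \<noteq> 0"
    show "\<exists>H (x :: nat \<Rightarrow> complex). det H \<noteq> 0 \<and> B ** H = mat2 (x 0) (x 1) 0 (x 2) \<and>
        (\<forall>u v. fst (structure_of (N13 \<alpha>)) (H *v u) (H *v v) = H *v fst (structure_of (N13 \<alpha>)) u v) \<and>
        (\<forall>u v. snd (structure_of (N13 \<alpha>)) (H *v u) (H *v v) = H *v snd (structure_of (N13 \<alpha>)) u v)"
      using B
      by (intro exI[of _ "mat2 1 0 (- B$2$1 / B$2$2) 1"]
        exI[of _ "\<lambda>i. [B$1$1 - B$1$2 * B$2$1 / B$2$2, B$1$2, B$2$2] ! i"])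
        (simp add: stabilizer_simps; (simp add: field_simps)?)
  qed simp
  then show "orbit_dim (structure_of (N13 \<alpha>)) \<le> 3"
    by (simp only: numeral_eq_enat)
  show "3 \<le> orbit_dim (structure_of (N13 \<alpha>))"
    using length_le_orbit_dim[of "structure_of (N13 \<alpha>)" "[(2, 2), (1, 1), (1, 2)]" 3
      "[(False, 1, 1, 2), (True, 1, 1, 1), (False, 1, 1, 1)]"
      "[mat2 1 0 0 2, mat2 2 0 0 1, mat2 1 1 0 1]"]
    by (simp add: numeral_eq_enat chain_simps)
qed

lemma orbit_dim_N14: "orbit_dim (structure_of (N14 \<alpha>)) = 2"
proof (rule antisym)
  have "orbit_dim (structure_of (N14 \<alpha>)) \<le> enat 2"
  proof (rule orbit_dim_le_of_stabilizer[of _ "\<lambda>x. mat2 (x 0) (x 1) 0 1" _ 2])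
    show "(\<lambda>x. mat2 (x 0) (x 1) 0 1 $ r $ s) \<in> funspace.span (monomials 2 1)" for r s
      by (intro mat2_span var_in_span_monomials const_in_span_monomials) simp_all
    fix B :: "complex^2^2" assume B: "det B \<noteq> 0" "B$2$2 \<noteq> 0"
    define a where "a = csqrt (1 / B$2$2)"
    have a: "a * a * B$2$2 = 1" "a \<noteq> 0"
      using B(2) power2_csqrt[of "1 / B$2$2"] by (auto simp: a_def power2_eq_square)
    show "\<exists>H (x :: nat \<Rightarrow> complex). det H \<noteq> 0 \<and> B ** H = mat2 (x 0) (x 1) 0 1 \<and>
        (\<forall>u v. fst (structure_of (N14 \<alpha>)) (H *v u) (H *v v) = H *v fst (structure_of (N14 \<alpha>)) u v) \<and>
        (\<forall>u v. snd (structure_of (N14 \<alpha>)) (H *v u) (H *v v) = H *v snd (structure_of (N14 \<alpha>)) u v)"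
      using B a
      by (intro exI[of _ "mat2 a 0 (- a * B$2$1 / B$2$2) (a * a)"]
        exI[of _ "\<lambda>i. [a * B$1$1 - B$1$2 * a * B$2$1 / B$2$2, a * a * B$1$2] ! i"])
        (simp add: stabilizer_simps; (simp add: field_simps)?)
  qed simp
  then show "orbit_dim (structure_of (N14 \<alpha>)) \<le> 2"
    by (simp only: numeral_eq_enat)
  show "2 \<le> orbit_dim (structure_of (N14 \<alpha>))"
    using length_le_orbit_dim[of "structure_of (N14 \<alpha>)" "[(1, 1), (1, 2)]" 2
      "[(False, 1, 1, 2), (False, 1, 1, 1)]"
      "[mat2 2 0 0 1, mat2 1 (- 1) 0 1]"]
    by (simp add: numeral_eq_enat chain_simps)
qed

section \<open>The degenerations of the two-dimensional algebras\<close>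

text \<open>The orbit is a single point, parametrized by the constant family with no
  parameters.\<close>

lemma orbit_dim_NZero: "orbit_dim (structure_of NZero) = 0"
proof -
  have "act A (structure_of NZero) = structure_of NZero" if "invertible A" for A
    by (rule act_eqI[OF that]) (simp_all add: vec2_eq_iff mat_vec_nth table_nth)
  then have "orbit_dim (structure_of NZero) \<le> enat 0"
    by (intro orbit_dim_le[of _ "\<lambda>x. mat 1"] structure_of_in_Bil2 const_in_span_monomials) simp_all
  then show ?thesis
    by (simp flip: zero_enat_def)
qed

lemma degenerates_imp_isomorphic_or_edge:
  assumes "degenerates (structure_of T) (structure_of T')"
  shows "isomorphic (structure_of T) (structure_of T') \<or> edge\<^sup>+\<^sup>+ T T'"
proof (cases T)
  case N01
  then show ?thesis
    using N01_degenerates[of T'] assms by (auto simp del: structure_of.simps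
      intro: isomorphic_refl edge_trancl_NZero edge_trancl_N01 edge_trancl_N14 edge_trancl edge.intros)
next
  case N02
  then show ?thesis
    using N02_degenerates[of T'] assms by (auto simp del: structure_of.simps
      intro: isomorphic_refl edge_trancl_NZero edge_trancl_N01 edge_trancl_N14 edge_trancl edge.intros)
next
  case N03
  then show ?thesis
    using N03_degenerates[of T'] assms by (auto simp del: structure_of.simps
      intro: isomorphic_refl edge_trancl_NZero edge_trancl_N01 edge_trancl_N14 edge_trancl edge.intros)
next
  case N04
  then show ?thesis
    using N04_degenerates[of T'] assms by (auto simp del: structure_of.simps
      intro: isomorphic_refl edge_trancl_NZero edge_trancl_N01 edge_trancl_N14 edge_trancl edge.intros)
next
  case N05
  then show ?thesis
    using N05_degenerates[of T'] assms by (auto simp del: structure_of.simps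
      intro: isomorphic_refl edge_trancl_NZero edge_trancl_N01 edge_trancl_N14 edge_trancl edge.intros)
next
  case (N06 \<gamma>)
  then show ?thesis
    using N06_degenerates[of \<gamma> T'] N06_degenerates_zero[of T'] assms by (cases "\<gamma> = 0") (auto simp del: structure_of.simps
      intro: isomorphic_refl edge_trancl_NZero edge_trancl_N01 edge_trancl_N14 edge_trancl edge.intros)
next
  case (N07 \<alpha> \<beta>)
  then show ?thesis
    using N07_degenerates[of \<alpha> \<beta> T'] N07_degenerates_same[of \<alpha> T'] assms isomorphic_N07_swap
    by (cases "\<alpha> = \<beta>") (auto simp del: structure_of.simps
      intro: isomorphic_refl edge_trancl_NZero edge_trancl_N01 edge_trancl_N14 edge_trancl edge.intros)
next
  case (N08 \<alpha> \<beta>)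
  then show ?thesis
    using N08_degenerates[of \<alpha> \<beta> T'] assms by (auto simp del: structure_of.simps
      intro: isomorphic_refl edge_trancl_NZero edge_trancl_N01 edge_trancl_N14 edge_trancl edge.intros)
next
  case (N09 \<alpha> \<beta>)
  then show ?thesis
    using N09_degenerates[of \<alpha> \<beta> T'] assms by (auto simp del: structure_of.simps
      intro: isomorphic_refl edge_trancl_NZero edge_trancl_N01 edge_trancl_N14 edge_trancl edge.intros)
next
  case (N10 \<alpha>)
  then show ?thesis
    using N10_degenerates[of \<alpha> T'] assms by (auto simp del: structure_of.simps
      intro: isomorphic_refl edge_trancl_NZero edge_trancl_N01 edge_trancl_N14 edge_trancl edge.intros)
next
  case (N11 \<alpha>)
  then show ?thesis
    using N11_degenerates[of \<alpha> T'] assms by (auto simp del: structure_of.simps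
      intro: isomorphic_refl edge_trancl_NZero edge_trancl_N01 edge_trancl_N14 edge_trancl edge.intros)
next
  case (N12 \<alpha>)
  then show ?thesis
    using N12_degenerates[of \<alpha> T'] assms by (auto simp del: structure_of.simps
      intro: isomorphic_refl edge_trancl_NZero edge_trancl_N01 edge_trancl_N14 edge_trancl edge.intros)
next
  case (N13 \<alpha>)
  then show ?thesis
    using N13_degenerates[of \<alpha> T'] assms by (auto simp del: structure_of.simps
      intro: isomorphic_refl edge_trancl_NZero edge_trancl_N01 edge_trancl_N14 edge_trancl edge.intros)
next
  case (N14 \<alpha>)
  then show ?thesis
    using N14_degenerates[of \<alpha> T'] assms by (auto simp del: structure_of.simps
      intro: isomorphic_refl edge_trancl_NZero edge_trancl_N01 edge_trancl_N14 edge_trancl edge.intros)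
next
  case NZero
  then show ?thesis
    using NZero_degenerates[of T'] assms by (auto simp del: structure_of.simps
      intro: isomorphic_refl edge_trancl_NZero edge_trancl_N01 edge_trancl_N14 edge_trancl edge.intros)
qed

theorem theorem41:
  shows "(orbit_dim (structure_of N03) = 4 \<and>
      (\<forall>\<delta> \<epsilon>. orbit_dim (structure_of (N07 \<delta> \<epsilon>)) = 4) \<and>
      (\<forall>\<delta> \<epsilon>. orbit_dim (structure_of (N08 \<delta> \<epsilon>)) = 4) \<and>
      (\<forall>\<delta>. orbit_dim (structure_of (N10 \<delta>)) = 4) \<and>
      (\<forall>\<delta>. orbit_dim (structure_of (N12 \<delta>)) = 4) \<and>
      orbit_dim (structure_of N02) = 3 \<and>
      orbit_dim (structure_of N04) = 3 \<and>
      orbit_dim (structure_of N05) = 3 \<and>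
      (\<forall>\<beta>. \<beta> \<noteq> 0 \<longrightarrow> orbit_dim (structure_of (N06 \<beta>)) = 3) \<and>
      (\<forall>\<beta> \<gamma>. orbit_dim (structure_of (N09 \<beta> \<gamma>)) = 3) \<and>
      (\<forall>\<beta>. orbit_dim (structure_of (N11 \<beta>)) = 3) \<and>
      (\<forall>\<beta>. orbit_dim (structure_of (N13 \<beta>)) = 3) \<and>
      orbit_dim (structure_of N01) = 2 \<and>
      orbit_dim (structure_of (N06 0)) = 2 \<and>
      (\<forall>\<alpha>. orbit_dim (structure_of (N14 \<alpha>)) = 2) \<and>
      orbit_dim (structure_of NZero) = 0) \<and>
    (\<forall>T T'. degenerates (structure_of T) (structure_of T') \<longleftrightarrow>
      isomorphic (structure_of T) (structure_of T') \<or> edge\<^sup>+\<^sup>+ T T')"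
proof (intro conjI allI impI)
  fix T T'
  show "degenerates (structure_of T) (structure_of T') \<longleftrightarrow>
      isomorphic (structure_of T) (structure_of T') \<or> edge\<^sup>+\<^sup>+ T T'"
    using degenerates_imp_isomorphic_or_edge isomorphic_imp_degenerates[OF structure_of_in_Bil2]
      tranclp_edge_imp_degenerates by blast
qed (assumption | rule orbit_dim_N01 orbit_dim_N02 orbit_dim_N03 orbit_dim_N04 orbit_dim_N05 orbit_dim_N06
    orbit_dim_N06_0 orbit_dim_N07 orbit_dim_N08 orbit_dim_N09 orbit_dim_N10 orbit_dim_N11 orbit_dim_N12
    orbit_dim_N13 orbit_dim_N14 orbit_dim_NZero)+

end
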